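(* Let $K\subset\mathbb R^3$ be a closed (maybe non-connected) oriented space curve of class $C^2$. Then the limit $$E(K)=\lim_{\varepsilon\to0}\left(\frac{3\pi L(K)}{8\varepsilon}-\frac{3}{16\pi}\int_{\mathcal S_\varepsilon(1,3)}\lambda(\gamma,K)^2\,d\gamma\right)$$ exists, and it coincides with $$E(K)=\frac{3}{16\pi}\int_{\mathcal S(1,3)}\left(\#(K\cap[\gamma])-\lambda(\gamma,K)^2\right)d\gamma,$$ where $[\gamma]$ denotes the (flat) disk with boundary $\gamma$. The latter integral converges, and moreover $$E(K)=-\frac12\int_{K\times K}\cos\tau\,\sin\theta_p\sin\theta_q\,\frac{dp\,dq}{|q-p|^2}.$$
   Context: $\mathcal S(1,3)$ is the set of all oriented circles $\gamma\subset\mathbb R^3$; such a circle is determined by its center $c\in\mathbb R^3$, radius $r>0$, and a unit vector $n\in\mathbb S^2$ orthogonal to the plane containing $\gamma$ (determined by the orientation). The M\"obius invariant measure on $\mathcal S(1,3)$ is $d\gamma=\frac{1}{r^4}\,dr\,dc\,dn$, where $dc$ is the volume element of $\mathbb R^3$ and $dn$ the area element of $\mathbb S^2$. $\mathcal S_\varepsilon(1,3)\subset\mathcal S(1,3)$ is the set of circles of radius $r>\varepsilon$. $\lambda(\gamma,K)$ is the linking number of $\gamma$ and $K$, and $L(K)$ is the length of $K$. For $p\neq q$ in $K$, $\theta_p\in[0,\pi]$ (resp. $\theta_q\in[0,\pi]$) is the angle between the positive tangent vector of $K$ at $p$ (resp. at $q$) and $q-p$; $\tau$ is the angle between the two oriented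 planes through $p,q$ tangent to $K$ at $p$ and $q$ respectively, oriented by $\overrightarrow{dp}\wedge(q-p)$ and $\overrightarrow{dq}\wedge(q-p)$ respectively, where $\overrightarrow{dp},\overrightarrow{dq}$ denote the positive tangent vectors at $p,q$. $dp,dq$ are arc-length elements. *)

theory Defs
  imports "HOL-Analysis.Analysis"
begin

text \<open>
  A closed oriented space curve, possibly with several components, is a finite nonempty family
  \<open>K :: 'i::finite \<Rightarrow> real \<Rightarrow> real^3\<close> of parametrized closed curves of period 1, one for each
  component, oriented by increasing parameter.  The parametrizations are regular but need not
  have constant speed; as a whole the family is embedded.
\<close>

abbreviation velocity :: "(real \<Rightarrow> real^3) \<Rightarrow> real \<Rightarrow> real^3" where
  "velocity \<alpha> t \<equiv> vector_derivative \<alpha> (at t)"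

definition C2_path :: "(real \<Rightarrow> real^3) \<Rightarrow> bool" where
  "C2_path \<alpha> \<longleftrightarrow> (\<exists>\<alpha>' \<alpha>''. (\<forall>t. (\<alpha> has_vector_derivative \<alpha>' t) (at t)) \<and>
     (\<forall>t. (\<alpha>' has_vector_derivative \<alpha>'' t) (at t)) \<and> continuous_on UNIV \<alpha>'')"

definition closed_C2_curve :: "('i::finite \<Rightarrow> real \<Rightarrow> real^3) \<Rightarrow> bool" where
  "closed_C2_curve K \<longleftrightarrow>
     (\<forall>i. C2_path (K i) \<and> (\<forall>t. K i (t + 1) = K i t) \<and> (\<forall>t. velocity (K i) t \<noteq> 0)) \<and>
     inj_on (\<lambda>(i, t). K i t) (UNIV \<times> {0..<1})"

definition curve_trace :: "('i::finite \<Rightarrow> real \<Rightarrow> real^3) \<Rightarrow> (real^3) set" where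
  "curve_trace K = (\<Union>i. range (K i))"

definition curve_length :: "('i::finite \<Rightarrow> real \<Rightarrow> real^3) \<Rightarrow> real" where
  "curve_length K = (\<Sum>i\<in>UNIV. LINT t:{0..1}|lborel. norm (velocity (K i) t))"

text \<open>
  The Gauss linking integral of two closed curves of period 1.  It is the linking number when the
  curves are disjoint; the value is of no significance otherwise.
\<close>

definition linking_number :: "(real \<Rightarrow> real^3) \<Rightarrow> (real \<Rightarrow> real^3) \<Rightarrow> real" where
  "linking_number \<alpha> \<beta> = 1 / (4 * pi) *
     (LINT z:{0..1} \<times> {0..1}|lborel. (case z of (s, t) \<Rightarrow>
        (\<alpha> s - \<beta> t) \<bullet> cross3 (velocity \<alpha> s) (velocity \<beta> t) / norm (\<alpha> s - \<beta> t) ^ 3))"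

text \<open>
  The oriented circle with center \<open>c\<close>, radius \<open>r > 0\<close> and unit normal \<open>n\<close> is represented by the
  triple \<open>(c, r, n)\<close>.  It is parametrized by means of a unit vector \<open>frame_vector n\<close> orthogonal
  to \<open>n\<close>; a different choice of this vector would only shift the parameter.
\<close>

type_synonym circle = "(real^3) \<times> real \<times> (real^3)"

definition frame_vector :: "real^3 \<Rightarrow> real^3" where
  "frame_vector n =
     (if cross3 (axis 3 1) n = 0 then axis 1 1 else sgn (cross3 (axis 3 1) n))"

definition circle_path :: "circle \<Rightarrow> real \<Rightarrow> real^3" where
  "circle_path = (\<lambda>(c, r, n) t. c + (r * cos (2 * pi * t)) *\<^sub>R frame_vector n
     + (r * sin (2 * pi * t)) *\<^sub>R cross3 n (frame_vector n))"

definition circle_disk :: "circle \<Rightarrow> (real^3) set" where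
  "circle_disk = (\<lambda>(c, r, n). {x. (x - c) \<bullet> n = 0 \<and> dist c x \<le> r})"

definition linking :: "circle \<Rightarrow> ('i::finite \<Rightarrow> real \<Rightarrow> real^3) \<Rightarrow> real" where
  "linking \<gamma> K = (\<Sum>i\<in>UNIV. linking_number (circle_path \<gamma>) (K i))"

text \<open>
  Since \<open>card\<close> is 0 on infinite sets, this is 0 for circles whose disk meets the curve infinitely
  often.  These circles form a null set, as do the circles that meet the curve itself.
\<close>

definition disk_intersections :: "circle \<Rightarrow> ('i::finite \<Rightarrow> real \<Rightarrow> real^3) \<Rightarrow> real" where
  "disk_intersections \<gamma> K = real (card (curve_trace K \<inter> circle_disk \<gamma>))"

text \<open>
  The area of a Borel set \<open>A\<close> on the unit sphere is three times the volume of the cone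
  \<open>{t *\<^sub>R n | t n. 0 < t \<and> t < 1 \<and> n \<in> A}\<close>.
\<close>

definition sphere_area :: "(real^3) measure" where
  "sphere_area = distr (density lborel (\<lambda>x. 3 * indicator (ball 0 1) x)) borel sgn"

definition circle_measure :: "circle measure" where
  "circle_measure = density (lborel \<Otimes>\<^sub>M lborel \<Otimes>\<^sub>M sphere_area) (\<lambda>(c, r, n). ennreal (1 / r ^ 4))"

definition circles :: "circle set" where
  "circles = UNIV \<times> {0<..} \<times> sphere 0 1"

definition circles_above :: "real \<Rightarrow> circle set" where
  "circles_above \<epsilon> = {(c, r, n) \<in> circles. r > \<epsilon>}"

definition vec_angle :: "real^3 \<Rightarrow> real^3 \<Rightarrow> real" where
  "vec_angle u v = arccos (u \<bullet> v / (norm u * norm v))"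

text \<open>
  The angle between the planes oriented by the bivectors \<open>u \<and> w\<close> and \<open>v \<and> w\<close>, that is,
  between their oriented normals.
\<close>

definition plane_angle :: "real^3 \<Rightarrow> real^3 \<Rightarrow> real^3 \<Rightarrow> real" where
  "plane_angle u v w = vec_angle (cross3 u w) (cross3 v w)"

text \<open>
  Here \<open>u\<close> and \<open>v\<close> are positive tangent vectors at \<open>p\<close> and \<open>q\<close>.  If one of them is parallel to
  \<open>q - p\<close>, then the plane angle is meaningless but one of the sines vanishes; the value at
  \<open>p = q\<close> is 0.
\<close>

definition torsion_density :: "real^3 \<Rightarrow> real^3 \<Rightarrow> real^3 \<Rightarrow> real^3 \<Rightarrow> real" where
  "torsion_density p u q v =
     cos (plane_angle u v (q - p)) * sin (vec_angle u (q - p)) * sin (vec_angle v (q - p))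
       / (norm (q - p))\<^sup>2"

text \<open>
  The integrand of the double integral over the components \<open>i\<close> and \<open>j\<close> in terms of the
  parameters, including the arc-length factors.
\<close>

definition torsion_integrand ::
    "('i::finite \<Rightarrow> real \<Rightarrow> real^3) \<Rightarrow> 'i \<Rightarrow> 'i \<Rightarrow> real \<times> real \<Rightarrow> real" where
  "torsion_integrand K i j = (\<lambda>(s, t).
     torsion_density (K i s) (velocity (K i) s) (K j t) (velocity (K j) t)
       * norm (velocity (K i) s) * norm (velocity (K j) t))"

end

theory Submission
  imports Defs "HOL-Complex_Analysis.Winding_Numbers" "HOL-Real_Asymp.Real_Asymp"
begin

text \<open>
  Almost every circle \<open>\<gamma>\<close> meets the curve in no point, and its disk meets the curve transversally in finitely many
  points.  For these circles the linking number is the sum of the signs of the crossings, so that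
  \<open>#(K \<inter> [\<gamma>]) - \<lambda>\<^sup>2\<close> is the number of ordered pairs of distinct crossings with opposite signs minus the number
  of those with equal signs.  To integrate either number over all circles, one applies the area formula to the
  integral over the centers, in which the first point of a pair is singled out, and then to the integral over the
  normal directions, in which the second one is.  This turns the integral into a double integral over the curve, with
  densities \<open>p\<^sub>+\<close> and \<open>p\<^sub>-\<close> for equal and for opposite signs.  With tangent vectors \<open>u\<close> and \<open>v\<close> and chord
  \<open>w\<close> they satisfy
  \<open>p\<^sub>+ - p\<^sub>- = (8\<pi>/3) (u \<times> w)\<bullet>(v \<times> w) / |w|\<^sup>4\<close> and \<open>p\<^sub>+ + p\<^sub>- \<le> (16\<pi>/3) |u \<times> w| |v \<times> w| / |w|\<^sup>4\<close>.
  The first expression is \<open>8\<pi>/3\<close> times the torsion integrand; the second one is bounded, because \<open>|u \<times> w|\<close> and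
  \<open>|v \<times> w|\<close> are at most a constant times \<open>|w|\<^sup>2\<close> on a curve of class \<open>C\<^sup>2\<close>.  The integral of \<open>#(K \<inter> [\<gamma>])\<close> over
  the circles of radius greater than \<open>\<epsilon>\<close> is \<open>2\<pi>\<^sup>2 L(K) / \<epsilon>\<close>, by the same method.
\<close>

section \<open>Measurability of fibre counts\<close>

text \<open>The number of points in the disk equals the number of diagonal pairs in the square of
  the linking number. Its integral alone produces the counterterm: 3/(16 pi) times 2 pi^2
  L/\<epsilon> is 3 pi L/(8 \<epsilon>). Off the diagonal, equal and opposite signs are integrated
  separately as nonnegative counts; both totals are finite, so their difference is absolutely
  integrable and the limit is a case of dominated convergence. The factor -1/2 is 3/(16 pi) times -8
  pi/3. Only the one-dimensional area formula is used. Averaging over translations supplies the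
  missing dimensions, so plane integrals show up as integrals over slabs of thickness 1, and unit
  normals are written \<open>sgn x\<close> with \<open>x\<close> in the unit ball. A slab needs a
  direction that is transversal to the chord and does not vary with the parameter; choosing among
  the three coordinate axes achieves this piecewise. Two obstacles remain. The counts are integrated
  over all circles, so they must be Borel functions. And \<open>linking_number\<close> is a Gauss
  integral, so its expression as a sum of signs has to be derived.\<close>

definition sigma_compact :: "'a::euclidean_space set \<Rightarrow> bool" where
  "sigma_compact S \<longleftrightarrow> (\<exists>C::nat \<Rightarrow> 'a set. (\<forall>n. compact (C n)) \<and> S = (\<Union>n. C n))"

lemma sigma_compact_UN_countable:
  assumes "countable I" "\<And>i. i \<in> I \<Longrightarrow> sigma_compact (A i)"
  shows "sigma_compact (\<Union>i\<in>I. A i)"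
proof (cases "I = {}")
  case True
  then show ?thesis unfolding sigma_compact_def by (intro exI[of _ "\<lambda>_. {}"]) auto
next
  case False
  obtain C where C: "\<And>i n. i \<in> I \<Longrightarrow> compact (C i n)" "\<And>i. i \<in> I \<Longrightarrow> A i = (\<Union>n. C i (n::nat))"
    using assms(2) unfolding sigma_compact_def by metis
  define D where "D k = (case prod_decode k of (m, n) \<Rightarrow> C (from_nat_into I m) n)" for k
  have "compact (D k)" for k
    using C(1) from_nat_into[OF False] by (auto simp: D_def split: prod.split)
  moreover have "(\<Union>i\<in>I. A i) = (\<Union>k. D k)"
  proof (intro equalityI subsetI)
    fix x assume "x \<in> (\<Union>i\<in>I. A i)"
    then obtain i n where "i \<in> I" "x \<in> C i n" using C by auto
    then have "x \<in> D (prod_encode (to_nat_on I i, n))"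
      using assms(1) by (simp add: D_def)
    then show "x \<in> (\<Union>k. D k)" by blast
  next
    fix x assume "x \<in> (\<Union>k. D k)"
    then obtain k where "x \<in> D k" by blast
    then show "x \<in> (\<Union>i\<in>I. A i)"
      using C(2) from_nat_into[OF False] by (auto simp: D_def split: prod.splits)
  qed
  ultimately show ?thesis unfolding sigma_compact_def by blast
qed

lemma compact_imp_sigma_compact: "compact S \<Longrightarrow> sigma_compact S"
  unfolding sigma_compact_def by (intro exI[of _ "\<lambda>_. S"]) auto

lemma closed_imp_sigma_compact:
  assumes "closed S" shows "sigma_compact S"
proof -
  have "S = (\<Union>n::nat. S \<inter> cball 0 (real n))"
    by (auto intro: real_arch_simple)
  then show ?thesis unfolding sigma_compact_def
    using assms by (intro exI[of _ "\<lambda>n. S \<inter> cball 0 (real n)"]) (auto intro: closed_Int_compact)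
qed

lemma open_imp_sigma_compact:
  assumes "open S" shows "sigma_compact S"
proof -
  from open_UNION_cbox[OF assms] obtain D where "countable D" "D \<subseteq> Pow S" "\<And>X. X \<in> D \<Longrightarrow> \<exists>a b. X = cbox a b" "\<Union>D = S"
    using open_countable_Union_open_cbox[OF assms] by metis
  then show ?thesis
    using sigma_compact_UN_countable[of D "\<lambda>X. X"] compact_imp_sigma_compact compact_cbox by (metis image_ident)
qed

lemma sigma_compact_Int:
  assumes "sigma_compact S" "sigma_compact T" shows "sigma_compact (S \<inter> T)"
proof -
  obtain C D where C: "\<And>n::nat. compact (C n)" "S = (\<Union>n. C n)" and D: "\<And>n::nat. compact (D n)" "T = (\<Union>n. D n)"
    using assms unfolding sigma_compact_def by metis
  have "S \<inter> T = (\<Union>(m, n)\<in>UNIV. C m \<inter> D n)" using C D by auto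
  moreover have "sigma_compact \<dots>"
    using C D by (intro sigma_compact_UN_countable) (auto intro: compact_imp_sigma_compact)
  ultimately show ?thesis by simp
qed

lemma sigma_compact_Collect_conj:
  "sigma_compact {x. P x} \<Longrightarrow> sigma_compact {x. Q x} \<Longrightarrow> sigma_compact {x. P x \<and> Q x}"
  using sigma_compact_Int[of "{x. P x}" "{x. Q x}"] by (simp add: Collect_conj_eq)

text \<open>The stability that distinguishes this class from the Borel sets, whose projections are
  in general only analytic. Equations, inequations and strict inequalities between continuous
  functions define members of the class, and so do finite conjunctions of them, which covers the
  conditions imposed on crossings.\<close>

lemma sigma_compact_image:
  assumes "sigma_compact S" "continuous_on UNIV f" shows "sigma_compact (f ` S)"
proof -
  obtain C where C: "\<And>n::nat. compact (C n)" "S = (\<Union>n. C n)"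
    using assms unfolding sigma_compact_def by metis
  have "f ` S = (\<Union>n. f ` C n)" using C by auto
  then show ?thesis unfolding sigma_compact_def
    using C(1) assms(2) by (intro exI[of _ "\<lambda>n. f ` C n"])
      (meson compact_continuous_image continuous_on_subset subset_UNIV)
qed

lemma sigma_compact_borel: "sigma_compact S \<Longrightarrow> S \<in> sets borel"
  unfolding sigma_compact_def by (auto intro: borel_compact)

text \<open>
  At least \<open>k\<close> points lie in a fibre if and only if it meets \<open>k\<close> pairwise disjoint balls of a countable
  family, and the projection of a \<open>\<sigma>\<close>-compact set is \<open>\<sigma>\<close>-compact.
\<close>

lemma borel_measurable_card_fibre:
  fixes Z :: "('a::euclidean_space \<times> 'b::euclidean_space) set"
  assumes Z: "sigma_compact Z"
  shows "(\<lambda>x. emeasure (count_space UNIV) {y. (x, y) \<in> Z}) \<in> borel_measurable borel"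
proof -
  define N where "N x = emeasure (count_space UNIV) {y. (x, y) \<in> Z}" for x
  obtain D :: "'b set" where D: "countable D" "\<And>X. open X \<Longrightarrow> X \<noteq> {} \<Longrightarrow> \<exists>d\<in>D. d \<in> X"
    using countable_dense_exists by metis
  \<comment> \<open>Centers more than twice the radius \<open>1 / Suc m\<close> apart have disjoint
    closed balls, so points picked in different balls are distinct.\<close>
  define \<F> where "\<F> k m = {F. F \<subseteq> D \<and> finite F \<and> card F = k \<and>
      (\<forall>d\<in>F. \<forall>d'\<in>F. d \<noteq> d' \<longrightarrow> dist d d' > 2 / Suc m)}" for k m :: nat
  define P where "P m d = {x. \<exists>y. (x, y) \<in> Z \<and> dist d y \<le> 1 / Suc m}" for m :: nat and d
  have le_iff: "of_nat k \<le> N x \<longleftrightarrow> (\<exists>S \<subseteq> {y. (x, y) \<in> Z}. finite S \<and> card S = k)" for k x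
  proof
    assume L: "of_nat k \<le> N x"
    show "\<exists>S \<subseteq> {y. (x, y) \<in> Z}. finite S \<and> card S = k"
    proof (cases "finite {y. (x, y) \<in> Z}")
      case True
      then have "k \<le> card {y. (x, y) \<in> Z}" using L by (simp add: N_def)
      then show ?thesis using obtain_subset_with_card_n by metis
    qed (use infinite_arbitrarily_large in blast)
  next
    assume "\<exists>S \<subseteq> {y. (x, y) \<in> Z}. finite S \<and> card S = k"
    then obtain S where S: "S \<subseteq> {y. (x, y) \<in> Z}" "finite S" "card S = k" by blast
    have "emeasure (count_space UNIV) S \<le> N x" unfolding N_def using S(1) by (intro emeasure_mono) auto
    then show "of_nat k \<le> N x" using S by simp
  qed
  have ge_eq: "{x. of_nat k \<le> N x} = (\<Union>m. \<Union>F\<in>\<F> k m. {x. \<forall>d\<in>F. x \<in> P m d})" for k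
  proof (intro equalityI subsetI)
    fix x assume "x \<in> {x. of_nat k \<le> N x}"
    then obtain S where S: "S \<subseteq> {y. (x, y) \<in> Z}" "finite S" "card S = k" using le_iff by blast
    \<comment> \<open>Points more than 4/(m+1) apart, each replaced by a point of \<open>D\<close>
      within 1/(m+1), leave centers more than 2/(m+1) apart.\<close>
    have lim: "(\<lambda>m. 4 / real (Suc m)) \<longlonglongrightarrow> 0"
      using LIMSEQ_Suc[OF lim_const_over_n[of 4]] by simp
    have "\<forall>\<^sub>F m in sequentially. \<forall>y\<in>S. \<forall>y'\<in>S. y \<noteq> y' \<longrightarrow> 4 / real (Suc m) < dist y y'"
    proof (intro eventually_ball_finite S ballI)
      fix y y' assume "y \<in> S" "y' \<in> S"
      show "\<forall>\<^sub>F m in sequentially. y \<noteq> y' \<longrightarrow> 4 / real (Suc m) < dist y y'"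
        using order_tendstoD(2)[OF lim, of "dist y y'"] by (cases "y = y'") auto
    qed
    then obtain m where m: "\<And>y y'. y \<in> S \<Longrightarrow> y' \<in> S \<Longrightarrow> y \<noteq> y' \<Longrightarrow> 4 / real (Suc m) < dist y y'"
      unfolding eventually_sequentially by blast
    have "\<exists>d\<in>D. d \<in> ball y (1 / Suc m)" for y by (rule D(2)) auto
    then obtain g where g: "\<And>y. g y \<in> D" "\<And>y. dist y (g y) < 1 / Suc m" by (metis mem_ball)
    have sep: "dist (g y) (g y') > 2 / Suc m" if "y \<in> S" "y' \<in> S" "y \<noteq> y'" for y y'
    proof -
      have "dist y y' \<le> dist y (g y) + dist (g y) (g y') + dist y' (g y')"
        using dist_triangle[of y y' "g y"] dist_triangle[of "g y" y' "g y'"] by (simp add: dist_commute)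
      then show ?thesis using m[OF that] g(2)[of y] g(2)[of y'] by simp
    qed
    have "inj_on g S"
    proof (rule inj_onI, rule ccontr)
      fix y y' assume "y \<in> S" "y' \<in> S" "g y = g y'" "y \<noteq> y'"
      then show False using sep[of y y'] by simp
    qed
    then have "g ` S \<in> \<F> k m" using S g(1) sep by (auto simp: \<F>_def card_image)
    moreover have "\<forall>d\<in>g ` S. x \<in> P m d"
      using S(1) g(2) unfolding P_def by (fastforce simp: dist_commute less_imp_le)
    ultimately show "x \<in> (\<Union>m. \<Union>F\<in>\<F> k m. {x. \<forall>d\<in>F. x \<in> P m d})" by blast
  next
    fix x assume "x \<in> (\<Union>m. \<Union>F\<in>\<F> k m. {x. \<forall>d\<in>F. x \<in> P m d})"
    then obtain m F where F: "F \<in> \<F> k m" "\<forall>d\<in>F. x \<in> P m d" by blast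
    then obtain g where g: "\<And>d. d \<in> F \<Longrightarrow> (x, g d) \<in> Z" "\<And>d. d \<in> F \<Longrightarrow> dist d (g d) \<le> 1 / Suc m"
      unfolding P_def by simp metis
    have "inj_on g F"
    proof (rule inj_onI, rule ccontr)
      fix d d' assume d: "d \<in> F" "d' \<in> F" "g d = g d'" "d \<noteq> d'"
      then have "2 / Suc m < dist d d'" using F(1) by (auto simp: \<F>_def)
      also have "dist d d' \<le> dist d (g d) + dist d' (g d')" using d(3) by (metis dist_triangle2)
      finally show False using g(2)[OF d(1)] g(2)[OF d(2)] by simp
    qed
    then have "card (g ` F) = k" "finite (g ` F)" "g ` F \<subseteq> {y. (x, y) \<in> Z}"
      using F(1) g(1) by (auto simp: \<F>_def card_image)
    then show "x \<in> {x. of_nat k \<le> N x}" using le_iff by blast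
  qed
  have P_sets: "P m d \<in> sets borel" for m d
  proof -
    have "P m d = fst ` (Z \<inter> {z. dist d (snd z) \<le> 1 / Suc m})" unfolding P_def by force
    moreover have "sigma_compact \<dots>"
      by (intro sigma_compact_image sigma_compact_Int Z closed_imp_sigma_compact closed_Collect_le continuous_intros)
    ultimately show ?thesis using sigma_compact_borel by metis
  qed
  have "countable (\<F> k m)" for k m
    by (rule countable_subset[of _ "{F. finite F \<and> F \<subseteq> D}"])
       (auto simp: \<F>_def D(1) intro: countable_Collect_finite_subset)
  moreover have "{x. \<forall>d\<in>F. x \<in> P m d} \<in> sets borel" if "F \<in> \<F> k m" for k m F
  proof -
    \<comment> \<open>Complements are taken so that the empty \<open>F\<close> is covered: the
      intersection is then the whole space.\<close>
    have "{x. \<forall>d\<in>F. x \<in> P m d} = UNIV - (\<Union>d\<in>F. UNIV - P m d)" by auto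
    also have "\<dots> \<in> sets borel"
      using that P_sets by (intro sets.Diff sets.finite_UN) (auto simp: \<F>_def)
    finally show ?thesis .
  qed
  ultimately have sets_ge: "{x. of_nat k \<le> N x} \<in> sets borel" for k
    unfolding ge_eq by (intro sets.countable_UN' sets.countable_UN) auto
  have "{x. y < N x} = (\<Union>k\<in>{k. y < of_nat k}. {x. of_nat k \<le> N x})" for y
  proof (intro equalityI subsetI)
    fix x assume x: "x \<in> {x. y < N x}"
    show "x \<in> (\<Union>k\<in>{k. y < of_nat k}. {x. of_nat k \<le> N x})"
    proof (cases "finite {y. (x, y) \<in> Z}")
      case True
      then show ?thesis using x by (auto simp: N_def)
    next
      case False
      then have "N x = \<infinity>" by (simp add: N_def)
      moreover obtain k :: nat where "y < of_nat k" using x ennreal_Ex_less_of_nat[of y]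
        by (metis mem_Collect_eq order_less_le_trans top.not_eq_extremum top_greatest)
      ultimately show ?thesis by auto
    qed
  qed auto
  then have "N \<in> borel_measurable borel"
    by (intro borel_measurableI_greater) (use sets_ge in auto)
  then show ?thesis by (simp add: N_def[abs_def])
qed

section \<open>The area formula for curves and its sliced form\<close>

lemma nn_integral_count_space_at:
  assumes "\<And>s. s \<in> A \<Longrightarrow> s = t"
  shows "(\<integral>\<^sup>+s. F s * indicator A s \<partial>count_space UNIV) = (F t * indicator A t :: ennreal)"
proof -
  have "(\<integral>\<^sup>+s. F s * indicator A s \<partial>count_space UNIV) = (\<Sum>s\<in>{t}. F s * indicator A s)"
    using assms by (intro nn_integral_count_space') (auto simp: indicator_def)
  then show ?thesis by (auto simp: indicator_def)
qed

text \<open>On an interval where \<open>f\<close> increases, every fibre has at most one point, so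
  the sum over the fibre is a function of the inverse \<open>h\<close>, and the claim becomes the
  substitution rule. The Borel set \<open>A\<close> is carried along because the general case cuts
  the line into disjoint pieces that need not be intervals.\<close>

lemma area_formula_increasing:
  fixes f f' :: "real \<Rightarrow> real" and G :: "real \<Rightarrow> ennreal"
  assumes "a < b"
    and der: "\<And>t. t \<in> {a..b} \<Longrightarrow> (f has_real_derivative f' t) (at t)"
    and cont: "continuous_on {a..b} f'"
    and pos: "\<And>t. t \<in> {a..b} \<Longrightarrow> f' t > 0"
    and A: "A \<in> sets borel" "A \<subseteq> {a..b}" and [measurable]: "G \<in> borel_measurable borel"
  shows "(\<lambda>y. \<integral>\<^sup>+t. G t * indicator {t\<in>A. f t = y} t \<partial>count_space UNIV) \<in> borel_measurable borel"
    and "(\<integral>\<^sup>+y. (\<integral>\<^sup>+t. G t * indicator {t\<in>A. f t = y} t \<partial>count_space UNIV) \<partial>lborel)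
       = (\<integral>\<^sup>+t. indicator A t * ennreal \<bar>f' t\<bar> * G t \<partial>lborel)" (is "?L = ?R")
proof -
  note [measurable] = A(1)
  have contf: "continuous_on {a..b} f"
    by (intro DERIV_atLeastAtMost_imp_continuous_on) (metis atLeastAtMost_iff der)
  have mono: "f s < f t" if "a \<le> s" "s < t" "t \<le> b" for s t
    using that der pos by (intro DERIV_pos_imp_increasing[OF \<open>s < t\<close>]) (metis atLeastAtMost_iff order_trans)
  then have inj: "inj_on f {a..b}" by (intro inj_onI) (metis atLeastAtMost_iff less_irrefl linorder_neqE)
  define h where "h = the_inv_into {a..b} f"
  have hf: "h (f t) = t" if "t \<in> {a..b}" for t
    unfolding h_def using inj that by (rule the_inv_into_f_f)
  have img: "f ` {a..b} = {f a..f b}"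
  proof
    show "f ` {a..b} \<subseteq> {f a..f b}" using mono by (force simp: le_less)
    show "{f a..f b} \<subseteq> f ` {a..b}" using IVT'[of f a _ b] contf \<open>a < b\<close> by force
  qed
  have "continuous_on (f ` {a..b}) h"
    by (rule continuous_on_inv[OF contf]) (auto simp: hf)
  \<comment> \<open>The inverse matters only on \<open>{f a..f b}\<close>; its extension by 0 is
    Borel on the line, and \<open>F\<close> is multiplied by the indicator of this interval
    below.\<close>
  then have [measurable]: "(\<lambda>y. indicator {f a..f b} y *\<^sub>R h y) \<in> borel_measurable borel"
    unfolding img by (intro borel_measurable_continuous_on_indicator) auto
  define F where "F y = G (indicator {f a..f b} y *\<^sub>R h y) * indicator A (indicator {f a..f b} y *\<^sub>R h y)" for y
  have [measurable]: "F \<in> borel_measurable borel" unfolding F_def by measurable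
  have L_eq: "(\<integral>\<^sup>+t. G t * indicator {t\<in>A. f t = y} t \<partial>count_space UNIV) = F y * indicator {f a..f b} y" for y
  proof (cases "y \<in> {f a..f b}")
    case True
    then obtain t where t: "t \<in> {a..b}" "y = f t" using img by blast
    have "s = t" if "s \<in> {t\<in>A. f t = y}" for s using that t A(2) inj by (auto simp: inj_on_def)
    from nn_integral_count_space_at[of "{t\<in>A. f t = y}" t G, OF this] show ?thesis
      using True t by (simp add: F_def hf indicator_def)
  next
    case False
    then have "{t\<in>A. f t = y} = {}" using A(2) img by blast
    then show ?thesis using False by simp
  qed
  show "(\<lambda>y. \<integral>\<^sup>+t. G t * indicator {t\<in>A. f t = y} t \<partial>count_space UNIV) \<in> borel_measurable borel"
    unfolding L_eq by measurable
  have "?L = (\<integral>\<^sup>+y. F y * indicator {f a..f b} y \<partial>lborel)" by (simp add: L_eq)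
  also have "\<dots> = (\<integral>\<^sup>+t. F (f t) * ennreal (f' t) * indicator {a..b} t \<partial>lborel)"
    using der pos \<open>a < b\<close> cont by (intro nn_integral_substitution_aux) (auto intro: less_imp_le)
  also have "\<dots> = ?R"
  proof (intro nn_integral_cong)
    fix t
    show "F (f t) * ennreal (f' t) * indicator {a..b} t = indicator A t * ennreal \<bar>f' t\<bar> * G t"
    proof (cases "t \<in> {a..b}")
      case True
      then have "f t \<in> {f a..f b}" using img by blast
      then show ?thesis using True pos[OF True] by (simp add: F_def hf mult_ac)
    next
      case False
      then have "t \<notin> A" using A(2) by blast
      then show ?thesis using False by simp
    qed
  qed
  finally show "?L = ?R" .
qed

text \<open>A continuous derivative without zeros has constant sign by connectedness. A decreasing
  function is reduced to the increasing case by reflecting the parameter.\<close>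

lemma area_formula_injective:
  fixes f f' :: "real \<Rightarrow> real" and G :: "real \<Rightarrow> ennreal"
  assumes "a < b"
    and der: "\<And>t. t \<in> {a..b} \<Longrightarrow> (f has_real_derivative f' t) (at t)"
    and cont: "continuous_on {a..b} f'"
    and nz: "\<And>t. t \<in> {a..b} \<Longrightarrow> f' t \<noteq> 0"
    and A: "A \<in> sets borel" "A \<subseteq> {a..b}" and G[measurable]: "G \<in> borel_measurable borel"
  shows "(\<lambda>y. \<integral>\<^sup>+t. G t * indicator {t\<in>A. f t = y} t \<partial>count_space UNIV) \<in> borel_measurable borel"
    and "(\<integral>\<^sup>+y. (\<integral>\<^sup>+t. G t * indicator {t\<in>A. f t = y} t \<partial>count_space UNIV) \<partial>lborel)
       = (\<integral>\<^sup>+t. indicator A t * ennreal \<bar>f' t\<bar> * G t \<partial>lborel)" (is "?L = ?R")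
proof -
  have "(\<forall>t\<in>{a..b}. f' t > 0) \<or> (\<forall>t\<in>{a..b}. f' t < 0)"
  proof (rule ccontr)
    assume "\<not> ?thesis"
    then obtain s t where st: "s \<in> {a..b}" "t \<in> {a..b}" "f' s < 0" "f' t > 0"
      using nz by (meson not_less_iff_gr_or_eq)
    have "connected (f' ` {a..b})" using cont by (intro connected_continuous_image) auto
    then have "0 \<in> f' ` {a..b}" using st by (meson connectedD_interval image_eqI less_imp_le)
    then show False using nz by auto
  qed
  then consider "\<forall>t\<in>{a..b}. f' t > 0" | "\<forall>t\<in>{a..b}. f' t < 0" by blast
  then have "(\<lambda>y. \<integral>\<^sup>+t. G t * indicator {t\<in>A. f t = y} t \<partial>count_space UNIV) \<in> borel_measurable borel
    \<and> ?L = ?R"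
  proof cases
    case 1
    then show ?thesis using assms by (intro conjI area_formula_increasing[where a=a and b=b]) auto
  next
    case neg: 2
    note [measurable] = A(1)
    have A': "uminus -` A \<in> sets borel" using measurable_sets[of "uminus :: real \<Rightarrow> real" borel borel A] by simp
    have cf': "continuous_on {-b..-a} (\<lambda>t. - f' (- t))"
      by (intro continuous_intros continuous_on_compose2[OF cont]) auto
    \<comment> \<open>Continuity of \<open>f'\<close> is given on \<open>{a..b}\<close> only, so
      measurability is claimed for the product with the indicator of \<open>A\<close>.\<close>
    have [measurable]: "(\<lambda>t. indicator A t * f' t) \<in> borel_measurable borel"
    proof -
      have "(\<lambda>t. indicator {a..b} t *\<^sub>R f' t) \<in> borel_measurable borel"
        using cont by (intro borel_measurable_continuous_on_indicator) auto
      moreover have "(\<lambda>t. indicator A t * f' t) = (\<lambda>t. indicator A t * (indicator {a..b} t *\<^sub>R f' t))"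
        using A(2) by (intro ext) (auto simp: indicator_def split: if_splits)
      ultimately show ?thesis by simp
    qed
    have eq: "indicator A t * ennreal \<bar>f' t\<bar> * G t = ennreal \<bar>indicator A t * f' t\<bar> * G t" for t
      by (auto simp: indicator_def)
    have refl: "(\<integral>\<^sup>+t. G t * indicator {t\<in>A. f t = y} t \<partial>count_space UNIV)
        = (\<integral>\<^sup>+t. G (- t) * indicator {t\<in>uminus -` A. f (- t) = y} t \<partial>count_space UNIV)" for y
    proof -
      have "(\<integral>\<^sup>+t. G t * indicator {t\<in>A. f t = y} t \<partial>count_space UNIV)
          = (\<integral>\<^sup>+t. G (- t) * indicator {t\<in>A. f t = y} (- t) \<partial>count_space UNIV)"
        by (rule nn_integral_bij_count_space[symmetric]) (rule bij_uminus)
      also have "\<dots> = (\<integral>\<^sup>+t. G (- t) * indicator {t\<in>uminus -` A. f (- t) = y} t \<partial>count_space UNIV)"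
        by (intro nn_integral_cong) (auto simp: indicator_def)
      finally show ?thesis .
    qed
    have der': "((\<lambda>t. f (- t)) has_real_derivative - f' (- t)) (at t)" if "t \<in> {-b..-a}" for t
    proof -
      have "((\<lambda>t. f (- t)) has_real_derivative f' (- t) * (- 1)) (at t)"
        using that by (intro DERIV_chain2[of f] der) (auto intro!: derivative_eq_intros)
      then show ?thesis by simp
    qed
    note inc = area_formula_increasing[where a="-b" and b="-a" and f="\<lambda>t. f (- t)" and f'="\<lambda>t. - f' (- t)"
        and A="uminus -` A" and G="\<lambda>t. G (- t)", OF _ der' cf' _ A']
    have "?L = (\<integral>\<^sup>+t. indicator (uminus -` A) t * ennreal \<bar>- f' (- t)\<bar> * G (- t) \<partial>lborel)"
      unfolding refl using neg \<open>a < b\<close> A(2) by (intro inc(2)) auto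
    also have "\<dots> = (\<integral>\<^sup>+t. ennreal \<bar>indicator A (0 + (- 1) * t) * f' (0 + (- 1) * t)\<bar> * G (0 + (- 1) * t) \<partial>lborel)"
      by (intro nn_integral_cong) (auto simp: indicator_def)
    also have "\<dots> = (\<integral>\<^sup>+t. ennreal \<bar>indicator A t * f' t\<bar> * G t \<partial>lborel)"
      by (subst (2) nn_integral_real_affine[where c="-1" and t=0]) (auto, measurable)
    finally have "?L = ?R" unfolding eq .
    moreover have "(\<lambda>y. \<integral>\<^sup>+t. G t * indicator {t\<in>A. f t = y} t \<partial>count_space UNIV) \<in> borel_measurable borel"
      unfolding refl using neg \<open>a < b\<close> A(2) by (intro inc(1)) auto
    ultimately show ?thesis by blast
  qed
  then show "(\<lambda>y. \<integral>\<^sup>+t. G t * indicator {t\<in>A. f t = y} t \<partial>count_space UNIV) \<in> borel_measurable borel"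
    and "?L = ?R" by blast+
qed

text \<open>The one-dimensional Sard theorem, obtained from \<open>baby_Sard\<close> on
  \<open>real^1\<close>, where a vanishing derivative has rank 0.\<close>

lemma negligible_critical_values:
  fixes f f' :: "real \<Rightarrow> real"
  assumes der: "\<And>t. t \<in> S \<Longrightarrow> (f has_real_derivative f' t) (at t)" and "\<And>t. t \<in> S \<Longrightarrow> f' t = 0"
  shows "negligible (f ` S)"
proof -
  define g :: "real^1 \<Rightarrow> real^1" where "g x = vec (f (x $ 1))" for x
  have "negligible (g ` (vec ` S))"
  proof (rule baby_Sard[where f' = "\<lambda>_ _. 0"])
    fix x :: "real^1" assume "x \<in> vec ` S"
    then have x: "x $ 1 \<in> S" by auto
    have "(f has_derivative (\<lambda>_. 0)) (at (x $ 1))"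
      using der[OF x] assms(2)[OF x] by (simp add: has_field_derivative_def mult_zero_left[abs_def])
    moreover have "((\<lambda>x::real^1. x $ 1) has_derivative (\<lambda>h. h $ 1)) (at x)"
      by (intro bounded_linear_imp_has_derivative bounded_linear_vec_nth)
    ultimately have "((\<lambda>x. f (x $ 1)) has_derivative (\<lambda>_. 0)) (at x)"
      using has_derivative_compose[of "\<lambda>x::real^1. x $ 1" "\<lambda>h. h $ 1" x UNIV f "\<lambda>_. 0"] by simp
    then have "((\<lambda>x. vec (f (x $ 1)) :: real^1) has_derivative (\<lambda>_. vec 0)) (at x)"
    proof (rule bounded_linear.has_derivative[rotated])
      show "bounded_linear (vec :: real \<Rightarrow> real^1)"
        by (intro linear_conv_bounded_linear[THEN iffD1] linearI) (auto simp: vec_eq_iff)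
    qed
    then have "(g has_derivative (\<lambda>_. 0)) (at x)"
      by (simp add: g_def[abs_def])
    then show "(g has_derivative (\<lambda>_. 0)) (at x within vec ` S)"
      by (rule has_derivative_at_withinI)
    have "matrix (\<lambda>_::real^1. 0::real^1) = 0" by (simp add: matrix_def vec_eq_iff)
    then show "rank (matrix (\<lambda>_::real^1. 0::real^1)) < CARD(1)"
      unfolding less_rank_noninjective inj_def by (metis matrix_vector_mult_0 zero_neq_one)
  qed simp
  moreover have "(indicator (g ` (vec ` S)) :: real^1 \<Rightarrow> real) \<circ> vec = indicator (f ` S)"
    by (auto simp: g_def indicator_def vec_eq_iff image_iff fun_eq_iff)
  ultimately have "((indicator (f ` S) :: real \<Rightarrow> real) has_integral 0) {(vec a :: real^1) $ 1..(vec b :: real^1) $ 1}" for a b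
    unfolding negligible_def by (metis has_integral_vec1_I_cbox)
  then show ?thesis by (simp add: negligible_def)
qed

text \<open>The regular points are covered by countably many rational intervals without zeros of
  \<open>f'\<close>, which are made disjoint; on each piece the injective case applies. Critical
  points contribute nothing: on the right \<open>f'\<close> vanishes, and on the left their values
  form a null set.\<close>

lemma nn_integral_area_formula:
  fixes f f' :: "real \<Rightarrow> real" and G :: "real \<Rightarrow> ennreal"
  assumes U: "open U" and T: "T \<in> sets borel" "T \<subseteq> U"
    and der: "\<And>t. t \<in> U \<Longrightarrow> (f has_real_derivative f' t) (at t)"
    and cont: "continuous_on U f'" and G[measurable]: "G \<in> borel_measurable borel"
  shows "(\<integral>\<^sup>+y. (\<integral>\<^sup>+t. G t * indicator {t\<in>T. f t = y} t \<partial>count_space UNIV) \<partial>lborel)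
       = (\<integral>\<^sup>+t. indicator T t * ennreal \<bar>f' t\<bar> * G t \<partial>lborel)" (is "?L = ?R")
proof -
  note [measurable] = T(1)
  define good where "good = {(a, b). a < b \<and> {a..b} \<subseteq> U \<and> (\<forall>t\<in>{a..b}. f' t \<noteq> 0)}"
  \<comment> \<open>An enumeration of all pairs of rationals; a pair that is not \<open>good\<close>
    gets the empty interval.\<close>
  define e :: "nat \<Rightarrow> real \<times> real" where "e k = (case prod_decode k of (m, n) \<Rightarrow> (of_rat (from_nat m), of_rat (from_nat n)))" for k
  define I where "I k = (if e k \<in> good then {fst (e k)..snd (e k)} else {})" for k
  define A where "A k = T \<inter> disjointed I k" for k
  have I_sets: "range I \<subseteq> sets borel" by (auto simp: I_def)
  have [measurable]: "A k \<in> sets borel" for k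
    using sets.range_disjointed_sets[OF I_sets] by (auto simp: A_def)
  have A_sub: "A k \<subseteq> I k" for k using disjointed_subset[of I k] by (auto simp: A_def)
  have A_disj: "disjoint_family A"
    using disjoint_family_disjointed[of I] by (auto simp: A_def disjoint_family_on_def)
  have cover: "(\<Union>k. I k) = {t\<in>U. f' t \<noteq> 0}"
  proof (intro equalityI subsetI)
    fix t assume "t \<in> {t\<in>U. f' t \<noteq> 0}"
    moreover have "open {t\<in>U. f' t \<noteq> 0}"
      using continuous_open_preimage[OF cont U, of "-{0}"] by (simp add: vimage_def Int_def open_Compl)
    ultimately obtain d where d: "d > 0" "cball t d \<subseteq> {t\<in>U. f' t \<noteq> 0}"
      by (auto simp: open_contains_cball)
    obtain p where p: "t - d < of_rat p" "of_rat p < t" using of_rat_dense[of "t - d" t] d(1) by auto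
    obtain q where q: "t < of_rat q" "of_rat q < t + d" using of_rat_dense[of t "t + d"] d(1) by auto
    have "{of_rat p..of_rat q} \<subseteq> cball t d" using p q by (auto simp: dist_real_def)
    then have "(of_rat p, of_rat q) \<in> good" using d(2) p q by (auto simp: good_def)
    moreover have "e (prod_encode (to_nat p, to_nat q)) = (of_rat p, of_rat q)" by (simp add: e_def)
    ultimately have "t \<in> I (prod_encode (to_nat p, to_nat q))" using p q by (simp add: I_def)
    then show "t \<in> (\<Union>k. I k)" by blast
  qed (auto simp: I_def good_def split: if_splits)
  have UA: "(\<Union>k. A k) = {t\<in>T. f' t \<noteq> 0}"
    using cover UN_disjointed_eq[of I] T(2) by (auto simp: A_def)
  have piece: "(\<integral>\<^sup>+y. (\<integral>\<^sup>+t. G t * indicator {t\<in>A k. f t = y} t \<partial>count_space UNIV) \<partial>lborel)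
       = (\<integral>\<^sup>+t. indicator (A k) t * ennreal \<bar>f' t\<bar> * G t \<partial>lborel)" for k
  proof (cases "e k \<in> good")
    case True
    then have "fst (e k) < snd (e k)" "{fst (e k)..snd (e k)} \<subseteq> U" "\<forall>t\<in>{fst (e k)..snd (e k)}. f' t \<noteq> 0"
      by (auto simp: good_def)
    then show ?thesis using A_sub[of k] True
      by (intro area_formula_injective[where a="fst (e k)" and b="snd (e k)"])
         (auto simp: I_def intro!: der intro: continuous_on_subset[OF cont])
  next
    case False
    then have "A k = {}" using A_sub[of k] by (simp add: I_def)
    then show ?thesis by simp
  qed
  have piece_meas: "(\<lambda>y. (\<integral>\<^sup>+t. G t * indicator {t\<in>A k. f t = y} t \<partial>count_space UNIV)) \<in> borel_measurable borel" for k
  proof (cases "e k \<in> good")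
    case True
    then have "fst (e k) < snd (e k)" "{fst (e k)..snd (e k)} \<subseteq> U" "\<forall>t\<in>{fst (e k)..snd (e k)}. f' t \<noteq> 0"
      by (auto simp: good_def)
    then show ?thesis using A_sub[of k] True
      by (intro area_formula_injective(1)[where a="fst (e k)" and b="snd (e k)" and f'=f'])
         (auto simp: I_def intro!: der intro: continuous_on_subset[OF cont])
  next
    case False
    then have "A k = {}" using A_sub[of k] by (simp add: I_def)
    then show ?thesis by simp
  qed
  have sum_ind: "(\<Sum>k. c * indicator (A k) t) = (c * indicator {t\<in>T. f' t \<noteq> 0} t :: ennreal)" for c t
  proof (cases "t \<in> {t\<in>T. f' t \<noteq> 0}")
    case True
    then obtain i where "t \<in> A i" using UA by blast
    from suminf_cmult_indicator[OF A_disj this, of "\<lambda>_. c"] show ?thesis using True by simp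
  next
    case False
    then have "t \<notin> A k" for k using UA by blast
    then show ?thesis using False by simp
  qed
  have crit: "AE y in lborel. y \<notin> f ` {t\<in>T. f' t = 0}"
  proof -
    have "negligible (f ` {t\<in>T. f' t = 0})"
    proof (rule negligible_critical_values[where f'=f'])
      fix t assume "t \<in> {t\<in>T. f' t = 0}"
      then show "(f has_real_derivative f' t) (at t)" using T(2) by (intro der) auto
    qed auto
    then have "AE y in lebesgue. y \<notin> f ` {t\<in>T. f' t = 0}"
      by (auto simp: negligible_iff_null_sets intro: AE_not_in)
    then show ?thesis by (simp add: AE_completion_iff)
  qed
  have "?L = (\<integral>\<^sup>+y. (\<Sum>k. \<integral>\<^sup>+t. G t * indicator {t\<in>A k. f t = y} t \<partial>count_space UNIV) \<partial>lborel)"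
  proof (rule nn_integral_cong_AE, use crit in eventually_elim)
    fix y assume y: "y \<notin> f ` {t\<in>T. f' t = 0}"
    have "G t * indicator {t\<in>T. f t = y} t = (\<Sum>k. G t * indicator {t\<in>A k. f t = y} t)" for t
    proof -
      have "(\<Sum>k. G t * indicator {t\<in>A k. f t = y} t) = (\<Sum>k. (G t * indicator {t. f t = y} t) * indicator (A k) t)"
        by (intro suminf_cong) (auto simp: indicator_def)
      also have "\<dots> = G t * indicator {t\<in>T. f t = y} t"
        unfolding sum_ind using y by (auto simp: indicator_def)
      finally show ?thesis by simp
    qed
    then show "(\<integral>\<^sup>+t. G t * indicator {t\<in>T. f t = y} t \<partial>count_space UNIV)
      = (\<Sum>k. \<integral>\<^sup>+t. G t * indicator {t\<in>A k. f t = y} t \<partial>count_space UNIV)"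
      by (subst nn_integral_suminf[symmetric]) auto
  qed
  also have "\<dots> = (\<Sum>k. \<integral>\<^sup>+y. (\<integral>\<^sup>+t. G t * indicator {t\<in>A k. f t = y} t \<partial>count_space UNIV) \<partial>lborel)"
    using piece_meas by (intro nn_integral_suminf) simp
  also have "\<dots> = (\<Sum>k. \<integral>\<^sup>+t. indicator (A k) t * ennreal \<bar>f' t\<bar> * G t \<partial>lborel)"
    by (simp only: piece)
  \<comment> \<open>\<open>f'\<close> is continuous only on \<open>U\<close>; its product with the
    indicator of \<open>U\<close> is Borel and agrees with it on every \<open>A k\<close>.\<close>
  also have "\<dots> = (\<Sum>k. \<integral>\<^sup>+t. ennreal \<bar>indicator U t *\<^sub>R f' t\<bar> * G t * indicator (A k) t \<partial>lborel)"
    using A_sub T(2) by (intro suminf_cong nn_integral_cong) (auto simp: A_def indicator_def)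
  also have "\<dots> = (\<integral>\<^sup>+t. (\<Sum>k. ennreal \<bar>indicator U t *\<^sub>R f' t\<bar> * G t * indicator (A k) t) \<partial>lborel)"
  proof (rule nn_integral_suminf[symmetric])
    have [measurable]: "(\<lambda>t. indicator U t *\<^sub>R f' t) \<in> borel_measurable borel"
      using cont U by (intro borel_measurable_continuous_on_indicator) auto
    show "(\<lambda>t. ennreal \<bar>indicator U t *\<^sub>R f' t\<bar> * G t * indicator (A k) t) \<in> borel_measurable lborel" for k
      by measurable
  qed
  also have "\<dots> = ?R"
    unfolding sum_ind using T(2) by (intro nn_integral_cong) (auto simp: indicator_def)
  finally show ?thesis .
qed

lemma nn_integral_lborel_translation:
  fixes a :: "'a::euclidean_space"
  assumes [measurable]: "F \<in> borel_measurable borel"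
  shows "(\<integral>\<^sup>+x. F (x + a) \<partial>lborel) = (\<integral>\<^sup>+x. F x \<partial>lborel)"
proof -
  have "(\<integral>\<^sup>+x. F x \<partial>distr lborel borel ((+) a)) = (\<integral>\<^sup>+x. F (a + x) \<partial>lborel)"
    by (intro nn_integral_distr) auto
  then show ?thesis by (simp add: lborel_distr_plus add.commute)
qed

text \<open>
  Averaging the left-hand side over the translations of \<open>x\<close> by \<open>\<tau> *\<^sub>R e\<close>, \<open>0 \<le> \<tau> \<le> 1\<close>, reduces the
  statement to the one-dimensional area formula for \<open>\<lambda>t. f t x\<close>.
\<close>

lemma nn_integral_slices:
  fixes e :: "'a::euclidean_space" and f f' :: "real \<Rightarrow> 'a \<Rightarrow> real"
    and G :: "real \<Rightarrow> 'a \<Rightarrow> ennreal"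
  assumes U: "open U" and T: "T \<in> sets borel" "T \<subseteq> U"
    and der: "\<And>x t. t \<in> U \<Longrightarrow> ((\<lambda>t. f t x) has_real_derivative f' t x) (at t)"
    and cont: "\<And>x. continuous_on U (\<lambda>t. f' t x)"
    and [measurable]: "(\<lambda>(t, x). f t x) \<in> borel_measurable (borel \<Otimes>\<^sub>M borel)"
      "(\<lambda>(t, x). f' t x) \<in> borel_measurable (borel \<Otimes>\<^sub>M borel)"
      "(\<lambda>(t, x). G t x) \<in> borel_measurable (borel \<Otimes>\<^sub>M borel)"
    and R: "\<And>t x \<tau>. t \<in> T \<Longrightarrow> R t (x + \<tau> *\<^sub>R e) \<longleftrightarrow> f t x = \<tau>"
    and S[measurable]: "(\<lambda>x. \<integral>\<^sup>+t. G t x * indicator {t\<in>T. R t x} t \<partial>count_space UNIV) \<in> borel_measurable borel"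
  shows "(\<integral>\<^sup>+x. (\<integral>\<^sup>+t. G t x * indicator {t\<in>T. R t x} t \<partial>count_space UNIV) \<partial>lborel)
    = (\<integral>\<^sup>+t. indicator T t * (\<integral>\<^sup>+x. indicator {0..1} (f t x) * ennreal \<bar>f' t x\<bar> * G t (x + f t x *\<^sub>R e) \<partial>lborel) \<partial>lborel)"
proof -
  note [measurable] = T(1)
  define S where "S x = (\<integral>\<^sup>+t. G t x * indicator {t\<in>T. R t x} t \<partial>count_space UNIV)" for x
  have [measurable]: "S \<in> borel_measurable borel" unfolding S_def by measurable
  have "(\<integral>\<^sup>+x. S x \<partial>lborel) = (\<integral>\<^sup>+\<tau>. indicator {0..1::real} \<tau> * (\<integral>\<^sup>+x. S (x + \<tau> *\<^sub>R e) \<partial>lborel) \<partial>lborel)"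
    by (subst nn_integral_lborel_translation) (auto simp: nn_integral_multc)
  also have "\<dots> = (\<integral>\<^sup>+\<tau>. (\<integral>\<^sup>+x. indicator {0..1::real} \<tau> * S (x + \<tau> *\<^sub>R e) \<partial>lborel) \<partial>lborel)"
    by (subst nn_integral_cmult) auto
  also have "\<dots> = (\<integral>\<^sup>+x. (\<integral>\<^sup>+\<tau>. indicator {0..1::real} \<tau> * S (x + \<tau> *\<^sub>R e) \<partial>lborel) \<partial>lborel)"
    by (rule lborel_pair.Fubini') measurable
  also have "\<dots> = (\<integral>\<^sup>+x. (\<integral>\<^sup>+t. indicator T t * ennreal \<bar>f' t x\<bar> * (indicator {0..1} (f t x) * G t (x + f t x *\<^sub>R e)) \<partial>lborel) \<partial>lborel)"
  proof (rule nn_integral_cong)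
    fix x
    have "indicator {0..1::real} \<tau> * S (x + \<tau> *\<^sub>R e)
      = (\<integral>\<^sup>+t. (indicator {0..1} (f t x) * G t (x + f t x *\<^sub>R e)) * indicator {t\<in>T. f t x = \<tau>} t \<partial>count_space UNIV)" for \<tau>
    proof -
      have "indicator {0..1::real} \<tau> * S (x + \<tau> *\<^sub>R e) = (\<integral>\<^sup>+t. indicator {0..1::real} \<tau> *
          (G t (x + \<tau> *\<^sub>R e) * indicator {t\<in>T. R t (x + \<tau> *\<^sub>R e)} t) \<partial>count_space UNIV)"
        unfolding S_def by (rule nn_integral_cmult[symmetric]) simp
      \<comment> \<open>Only \<open>\<tau> = f t x\<close> contributes, so \<tau> can be replaced by
        \<open>f t x\<close> in the weight and in \<open>G\<close>; the sum over \<open>t\<close>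
        then has the form treated by the area formula.\<close>
      also have "\<dots> = (\<integral>\<^sup>+t. (indicator {0..1} (f t x) * G t (x + f t x *\<^sub>R e)) * indicator {t\<in>T. f t x = \<tau>} t \<partial>count_space UNIV)"
      proof (intro nn_integral_cong)
        fix t
        show "indicator {0..1::real} \<tau> * (G t (x + \<tau> *\<^sub>R e) * indicator {t\<in>T. R t (x + \<tau> *\<^sub>R e)} t)
          = (indicator {0..1} (f t x) * G t (x + f t x *\<^sub>R e)) * indicator {t\<in>T. f t x = \<tau>} t"
          by (cases "t \<in> T \<and> f t x = \<tau>") (auto simp: R mult_ac)
      qed
      finally show ?thesis .
    qed
    then have "(\<integral>\<^sup>+\<tau>. indicator {0..1::real} \<tau> * S (x + \<tau> *\<^sub>R e) \<partial>lborel)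
      = (\<integral>\<^sup>+\<tau>. (\<integral>\<^sup>+t. (indicator {0..1} (f t x) * G t (x + f t x *\<^sub>R e)) * indicator {t\<in>T. f t x = \<tau>} t \<partial>count_space UNIV) \<partial>lborel)"
      by simp
    also have "\<dots> = (\<integral>\<^sup>+t. indicator T t * ennreal \<bar>f' t x\<bar> * (indicator {0..1} (f t x) * G t (x + f t x *\<^sub>R e)) \<partial>lborel)"
      by (rule nn_integral_area_formula[OF U T der cont]) (auto, measurable)
    finally show "(\<integral>\<^sup>+\<tau>. indicator {0..1::real} \<tau> * S (x + \<tau> *\<^sub>R e) \<partial>lborel)
      = (\<integral>\<^sup>+t. indicator T t * ennreal \<bar>f' t x\<bar> * (indicator {0..1} (f t x) * G t (x + f t x *\<^sub>R e)) \<partial>lborel)" .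
  qed
  also have "\<dots> = (\<integral>\<^sup>+t. (\<integral>\<^sup>+x. indicator T t * ennreal \<bar>f' t x\<bar> * (indicator {0..1} (f t x) * G t (x + f t x *\<^sub>R e)) \<partial>lborel) \<partial>lborel)"
    by (rule lborel_pair.Fubini') measurable
  also have "\<dots> = (\<integral>\<^sup>+t. indicator T t * (\<integral>\<^sup>+x. indicator {0..1} (f t x) * ennreal \<bar>f' t x\<bar> * G t (x + f t x *\<^sub>R e) \<partial>lborel) \<partial>lborel)"
    by (subst nn_integral_cmult[symmetric]) (auto intro!: nn_integral_cong simp: mult_ac)
  finally show ?thesis by (simp add: S_def)
qed

section \<open>Integrals in space\<close>

text \<open>The measure \<open>lborel\<close> is determined by the volumes of boxes, and
  \<open>measure_linear_image\<close> expresses the volume of a box through that of its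
  preimage.\<close>

lemma nn_integral_linear_R3:
  fixes f :: "real^3 \<Rightarrow> real^3" and F :: "real^3 \<Rightarrow> ennreal"
  assumes f: "linear f" and det: "det (matrix f) \<noteq> 0" and [measurable]: "F \<in> borel_measurable borel"
  shows "(\<integral>\<^sup>+x. F x \<partial>lborel) = ennreal \<bar>det (matrix f)\<bar> * (\<integral>\<^sup>+x. F (f x) \<partial>lborel)"
proof -
  define D where "D = \<bar>det (matrix f)\<bar>"
  have "D > 0" using det by (simp add: D_def)
  have [measurable]: "f \<in> borel_measurable borel"
    using f by (intro borel_measurable_continuous_onI linear_continuous_on) (simp add: linear_conv_bounded_linear)
  have "inj f" using det f by (metis det_nz_iff_inj)
  then have bij: "bij f" using f by (metis bij_def linear_injective_imp_surjective)
  have "lborel = density (distr lborel borel f) (\<lambda>_. ennreal D)"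
  proof (rule lborel_eqI)
    fix l u :: "real^3" assume lu: "\<And>b. b \<in> Basis \<Longrightarrow> l \<bullet> b \<le> u \<bullet> b"
    have pre: "f -` box l u \<in> sets borel" using measurable_sets[of f borel borel "box l u"] by simp
    have img: "f ` (f -` box l u) = box l u" using bij by (simp add: bij_is_surj)
    \<comment> \<open>A bounded preimage has finite measure, as \<open>measure_linear_image\<close>
      requires.\<close>
    have "bounded (f -` box l u)"
    proof -
      from linear_injective_left_inverse[OF f \<open>inj f\<close>] obtain g where g: "linear g" "g \<circ> f = id" by blast
      have "f -` box l u \<subseteq> g ` box l u" using g(2) by (metis comp_apply id_apply image_eqI subsetI vimage_eq)
      moreover have "bounded (g ` box l u)" using g(1) by (intro bounded_linear_image) (auto simp: linear_conv_bounded_linear)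
      ultimately show ?thesis using bounded_subset by blast
    qed
    then have fin: "emeasure lborel (f -` box l u) < \<infinity>" by (rule emeasure_bounded_finite)
    then have lm: "f -` box l u \<in> lmeasurable" using pre by (intro fmeasurableI) auto
    have "measure lebesgue (box l u) = D * measure lebesgue (f -` box l u)"
      using measure_linear_image[OF f lm] by (simp only: img D_def)
    then have "measure lborel (box l u) = D * measure lborel (f -` box l u)"
      using pre by (simp add: measure_completion)
    then have "ennreal (measure lborel (box l u)) = D * ennreal (measure lborel (f -` box l u))"
      using \<open>D > 0\<close> by (simp add: ennreal_mult')
    then have "emeasure lborel (box l u) = D * emeasure lborel (f -` box l u)"
      using fin emeasure_lborel_box_finite[of l u]
      by (metis emeasure_eq_ennreal_measure infinity_ennreal_def less_top)
    moreover have "emeasure (density (distr lborel borel f) (\<lambda>_. ennreal D)) (box l u) = D * emeasure lborel (f -` box l u)"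
      using pre by (subst emeasure_density_const) (auto simp: emeasure_distr)
    ultimately show "emeasure (density (distr lborel borel f) (\<lambda>_. ennreal D)) (box l u) = (\<Prod>b\<in>Basis. (u - l) \<bullet> b)"
      using lu emeasure_lborel_box[of l u] by simp
  qed simp
  then have "(\<integral>\<^sup>+x. F x \<partial>lborel) = (\<integral>\<^sup>+x. F x \<partial>density (distr lborel borel f) (\<lambda>_. ennreal D))" by simp
  also have "\<dots> = ennreal D * (\<integral>\<^sup>+x. F (f x) \<partial>lborel)"
    by (simp add: nn_integral_density nn_integral_distr nn_integral_cmult)
  finally show ?thesis by (simp add: D_def)
qed

text \<open>\<open>real^3\<close> is a type of functions on indices, not a product of lines; the two
  measures are matched on boxes.\<close>

lemma nn_integral_R3:
  fixes F :: "real^3 \<Rightarrow> ennreal"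
  assumes [measurable]: "F \<in> borel_measurable borel"
  shows "(\<integral>\<^sup>+x. F x \<partial>lborel) = (\<integral>\<^sup>+a. \<integral>\<^sup>+b. \<integral>\<^sup>+c. F (vector [a, b, c]) \<partial>lborel \<partial>lborel \<partial>lborel)"
proof -
  define \<phi> :: "real \<times> real \<times> real \<Rightarrow> real^3" where "\<phi> = (\<lambda>(a, b, c). vector [a, b, c])"
  have \<phi>_eq: "\<phi> = (\<lambda>p. fst p *\<^sub>R axis 1 1 + fst (snd p) *\<^sub>R axis 2 1 + snd (snd p) *\<^sub>R axis 3 1)"
    by (auto simp: \<phi>_def fun_eq_iff vec_eq_iff forall_3 axis_def)
  have [measurable]: "\<phi> \<in> borel_measurable borel"
    unfolding \<phi>_eq by (intro borel_measurable_continuous_onI continuous_intros)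
  have prod3: "f 1 * (f 2 * f 3) = (\<Prod>i\<in>UNIV. f i)" for f :: "3 \<Rightarrow> ennreal"
    unfolding UNIV_3 by (simp add: ac_simps)
  have "lborel = distr (lborel :: (real \<times> real \<times> real) measure) borel \<phi>"
  proof (rule lborel_eqI)
    fix l u :: "real^3" assume lu: "\<And>b. b \<in> Basis \<Longrightarrow> l \<bullet> b \<le> u \<bullet> b"
    have le: "l $ i \<le> u $ i" for i using lu[of "axis i 1"] by (simp add: inner_axis axis_in_Basis_iff)
    have "\<phi> -` box l u = {l $ 1<..<u $ 1} \<times> {l $ 2<..<u $ 2} \<times> {l $ 3<..<u $ 3}"
      by (auto simp: \<phi>_def mem_box_cart forall_3)
    then have "emeasure (distr lborel borel \<phi>) (box l u)
        = emeasure (lborel \<Otimes>\<^sub>M lborel \<Otimes>\<^sub>M lborel) ({l $ 1<..<u $ 1} \<times> {l $ 2<..<u $ 2} \<times> {l $ 3<..<u $ 3})"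
      by (subst emeasure_distr) (auto simp: lborel_prod)
    also have "\<dots> = ennreal (u $ 1 - l $ 1) * (ennreal (u $ 2 - l $ 2) * ennreal (u $ 3 - l $ 3))"
    proof -
      have "emeasure (lborel \<Otimes>\<^sub>M (lborel :: (real \<times> real) measure)) ({l $ 1<..<u $ 1} \<times> {l $ 2<..<u $ 2} \<times> {l $ 3<..<u $ 3})
          = emeasure lborel {l $ 1<..<u $ 1} * emeasure lborel ({l $ 2<..<u $ 2} \<times> {l $ 3<..<u $ 3})"
        by (rule lborel.emeasure_pair_measure_Times) (auto intro!: borel_open open_Times)
      moreover have "emeasure (lborel \<Otimes>\<^sub>M lborel) ({l $ 2<..<u $ 2} \<times> {l $ 3<..<u $ 3})
          = emeasure lborel {l $ 2<..<u $ 2} * emeasure lborel {l $ 3<..<u $ 3}"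
        by (rule lborel.emeasure_pair_measure_Times) auto
      ultimately show ?thesis using le by (simp add: lborel_prod)
    qed
    also have "\<dots> = (\<Prod>i\<in>UNIV. ennreal (u $ i - l $ i))" by (rule prod3[of "\<lambda>i. ennreal (u $ i - l $ i)"])
    also have "\<dots> = (\<Prod>b\<in>Basis. (u - l) \<bullet> b)"
    proof -
      have B: "Basis = range (\<lambda>i::3. axis i (1::real))" by (auto simp: Basis_vec_def)
      have "inj (\<lambda>i::3. axis i (1::real))" by (auto simp: inj_def axis_eq_axis)
      then show ?thesis unfolding B using le
        by (subst prod.reindex) (simp_all add: prod_ennreal inner_axis)
    qed
    finally show "emeasure (distr lborel borel \<phi>) (box l u) = (\<Prod>b\<in>Basis. (u - l) \<bullet> b)" .
  qed simp
  then have "(\<integral>\<^sup>+x. F x \<partial>lborel) = (\<integral>\<^sup>+x. F x \<partial>distr (lborel :: (real \<times> real \<times> real) measure) borel \<phi>)" by simp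
  also have "\<dots> = (\<integral>\<^sup>+p. F (\<phi> p) \<partial>lborel)" by (intro nn_integral_distr) auto
  also have "\<dots> = (\<integral>\<^sup>+p. F (\<phi> p) \<partial>(lborel \<Otimes>\<^sub>M (lborel :: (real \<times> real) measure)))" by (simp only: lborel_prod)
  also have "\<dots> = (\<integral>\<^sup>+a. \<integral>\<^sup>+q. F (\<phi> (a, q)) \<partial>(lborel :: (real \<times> real) measure) \<partial>lborel)"
    by (rule lborel.nn_integral_fst[symmetric]) (simp only: lborel_prod, measurable)
  also have "\<dots> = (\<integral>\<^sup>+a. \<integral>\<^sup>+q. F (\<phi> (a, q)) \<partial>(lborel \<Otimes>\<^sub>M lborel) \<partial>lborel)"
    by (simp only: lborel_prod)
  also have "\<dots> = (\<integral>\<^sup>+a. \<integral>\<^sup>+b. \<integral>\<^sup>+c. F (\<phi> (a, b, c)) \<partial>lborel \<partial>lborel \<partial>lborel)"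
  proof (rule nn_integral_cong)
    fix a
    have "(\<lambda>q. F (\<phi> (a, q))) \<in> borel_measurable (lborel \<Otimes>\<^sub>M lborel)"
      unfolding \<phi>_eq fst_conv snd_conv by measurable
    then show "(\<integral>\<^sup>+q. F (\<phi> (a, q)) \<partial>(lborel \<Otimes>\<^sub>M lborel)) = (\<integral>\<^sup>+b. \<integral>\<^sup>+c. F (\<phi> (a, b, c)) \<partial>lborel \<partial>lborel)"
      by (rule lborel.nn_integral_fst[symmetric])
  qed
  finally show ?thesis by (simp add: \<phi>_def)
qed

lemma nn_integral_frame:
  fixes F :: "real^3 \<Rightarrow> ennreal" and f1 f2 f3 :: "real^3"
  assumes "f3 \<bullet> (cross3 f1 f2) \<noteq> 0" and [measurable]: "F \<in> borel_measurable borel"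
  shows "(\<integral>\<^sup>+x. F x \<partial>lborel) = ennreal \<bar>f3 \<bullet> (cross3 f1 f2)\<bar> *
    (\<integral>\<^sup>+a. \<integral>\<^sup>+b. \<integral>\<^sup>+c. F (a *\<^sub>R f1 + b *\<^sub>R f2 + c *\<^sub>R f3) \<partial>lborel \<partial>lborel \<partial>lborel)"
proof -
  define f :: "real^3 \<Rightarrow> real^3" where "f x = (x $ 1) *\<^sub>R f1 + (x $ 2) *\<^sub>R f2 + (x $ 3) *\<^sub>R f3" for x
  have lin: "linear f" by (rule linearI) (auto simp: f_def algebra_simps)
  have [measurable]: "f \<in> borel_measurable borel"
    unfolding f_def by (intro borel_measurable_continuous_onI continuous_intros)
  have "det (matrix f) = f3 \<bullet> (cross3 f1 f2)"
    by (simp add: matrix_def f_def det_3 axis_def cross3_def inner_vec_def sum_3 algebra_simps)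
  then have "(\<integral>\<^sup>+x. F x \<partial>lborel) = ennreal \<bar>f3 \<bullet> (cross3 f1 f2)\<bar> * (\<integral>\<^sup>+x. F (f x) \<partial>lborel)"
    using nn_integral_linear_R3[OF lin _ assms(2)] assms(1) by simp
  also have "(\<integral>\<^sup>+x. F (f x) \<partial>lborel) = (\<integral>\<^sup>+a. \<integral>\<^sup>+b. \<integral>\<^sup>+c. F (f (vector [a, b, c])) \<partial>lborel \<partial>lborel \<partial>lborel)"
    by (rule nn_integral_R3) measurable
  also have "\<dots> = (\<integral>\<^sup>+a. \<integral>\<^sup>+b. \<integral>\<^sup>+c. F (a *\<^sub>R f1 + b *\<^sub>R f2 + c *\<^sub>R f3) \<partial>lborel \<partial>lborel \<partial>lborel)"
    by (simp only: f_def vector_3)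
  finally show ?thesis .
qed

definition orthonormal_pair :: "real^3 \<Rightarrow> real^3 \<Rightarrow> bool" where
  "orthonormal_pair f1 f2 \<longleftrightarrow> norm f1 = 1 \<and> norm f2 = 1 \<and> f1 \<bullet> f2 = 0"

lemma norm_orthonormal_pair:
  assumes "orthonormal_pair f1 f2"
  shows "norm (a *\<^sub>R f1 + b *\<^sub>R f2) = sqrt (a\<^sup>2 + b\<^sup>2)"
proof -
  have "f1 \<bullet> f1 = 1" "f2 \<bullet> f2 = 1" "f1 \<bullet> f2 = 0" "f2 \<bullet> f1 = 0"
    using assms by (auto simp: orthonormal_pair_def norm_eq_1 inner_commute)
  then show ?thesis
    by (simp add: norm_eq_sqrt_inner inner_add_left inner_add_right power2_eq_square)
qed

lemma orthonormal_pair_cross: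
  assumes "norm n = 1" "norm f = 1" "n \<bullet> f = 0"
  shows "orthonormal_pair f (cross3 n f)" "cross3 f (cross3 n f) = n"
proof -
  have "n \<bullet> n = 1" "f \<bullet> f = 1" using assms by (auto simp: norm_eq_1)
  moreover have "(norm (cross3 n f))\<^sup>2 = 1" using norm_cross_dot[of n f] assms by simp
  then have "norm (cross3 n f) = 1" using norm_ge_zero[of "cross3 n f"] by (auto simp: power2_eq_1_iff)
  ultimately show "orthonormal_pair f (cross3 n f)" "cross3 f (cross3 n f) = n"
    using assms Lagrange[of f n f]
    by (auto simp: orthonormal_pair_def dot_cross_self inner_commute Lagrange)
qed

lemma obtain_orthonormal_pair:
  assumes "norm (n::real^3) = 1"
  obtains f1 f2 where "orthonormal_pair f1 f2" "cross3 f1 f2 = n"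
proof -
  have "\<exists>f. f \<noteq> 0 \<and> n \<bullet> f = 0"
    using orthogonal_to_vector_exists[of n] by (auto simp: orthogonal_def)
  then obtain f where f: "f \<noteq> 0" "n \<bullet> f = 0" by blast
  then have "norm (sgn f) = 1" "n \<bullet> sgn f = 0" by (auto simp: norm_sgn sgn_div_norm)
  from orthonormal_pair_cross[OF assms this] show thesis using that by blast
qed

text \<open>In the frame \<open>f1\<close>, \<open>f2\<close>, \<open>e\<close> the quotient is
  minus the coordinate along \<open>e\<close>, and the argument of \<open>g\<close> is the oblique
  projection along \<open>e\<close> to the plane orthogonal to \<open>w\<close>. The coordinate
  along \<open>e\<close> runs through an interval of length 1, which leaves the plane integral and
  the determinant of the frame. In this way the slabs produced by \<open>nn_integral_slices\<close>
  are turned back into planes.\<close>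

lemma nn_integral_slab_projection:
  fixes w e f1 f2 :: "real^3" and g :: "real^3 \<Rightarrow> ennreal"
  assumes f: "orthonormal_pair f1 f2" "w = norm w *\<^sub>R cross3 f1 f2" and ew: "e \<bullet> w \<noteq> 0"
    and [measurable]: "g \<in> borel_measurable borel"
  shows "(\<integral>\<^sup>+x. indicator {0..1} (- (x \<bullet> w) / (e \<bullet> w)) * g (x + (- (x \<bullet> w) / (e \<bullet> w)) *\<^sub>R e) \<partial>lborel)
    = ennreal (\<bar>e \<bullet> w\<bar> / norm w) * (\<integral>\<^sup>+a. \<integral>\<^sup>+b. g (a *\<^sub>R f1 + b *\<^sub>R f2) \<partial>lborel \<partial>lborel)"
proof -
  define n where "n = cross3 f1 f2"
  have w: "w = norm w *\<^sub>R n" "norm w > 0" using f(2) ew by (auto simp: n_def)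
  have "e \<bullet> w = norm w * (e \<bullet> n)" by (subst w(1)) simp
  then have en: "e \<bullet> n = (e \<bullet> w) / norm w" using w(2) by (simp add: field_simps)
  have perp: "f1 \<bullet> w = 0" "f2 \<bullet> w = 0"
    by (subst w(1); simp add: n_def dot_cross_self)+
  have coord: "- ((a *\<^sub>R f1 + b *\<^sub>R f2 + c *\<^sub>R e) \<bullet> w) / (e \<bullet> w) = - c" for a b c
    using ew by (simp add: inner_add_left perp)
  have one: "(\<integral>\<^sup>+c. indicator {0..1::real} (- c) * K \<partial>lborel) = K" for K :: ennreal
  proof -
    have "(\<integral>\<^sup>+c. indicator {0..1::real} (- c) * K \<partial>lborel) = (\<integral>\<^sup>+c. K * indicator {-1..0::real} c \<partial>lborel)"
      by (intro nn_integral_cong) (auto simp: indicator_def)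
    then show ?thesis by (simp add: nn_integral_cmult_indicator)
  qed
  have "(\<integral>\<^sup>+x. indicator {0..1} (- (x \<bullet> w) / (e \<bullet> w)) * g (x + (- (x \<bullet> w) / (e \<bullet> w)) *\<^sub>R e) \<partial>lborel)
    = ennreal \<bar>e \<bullet> cross3 f1 f2\<bar> * (\<integral>\<^sup>+a. \<integral>\<^sup>+b. \<integral>\<^sup>+c. indicator {0..1::real} (- c) *
        g (a *\<^sub>R f1 + b *\<^sub>R f2) \<partial>lborel \<partial>lborel \<partial>lborel)"
  proof (subst nn_integral_frame[of e f1 f2])
    show "e \<bullet> cross3 f1 f2 \<noteq> 0" using en ew w(2) by (simp add: n_def)
    have proj: "a *\<^sub>R f1 + b *\<^sub>R f2 + c *\<^sub>R e + (- c) *\<^sub>R e = a *\<^sub>R f1 + b *\<^sub>R f2" for a b c by simp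
    show "ennreal \<bar>e \<bullet> cross3 f1 f2\<bar> * (\<integral>\<^sup>+a. \<integral>\<^sup>+b. \<integral>\<^sup>+c.
        indicator {0..1} (- ((a *\<^sub>R f1 + b *\<^sub>R f2 + c *\<^sub>R e) \<bullet> w) / (e \<bullet> w)) *
        g (a *\<^sub>R f1 + b *\<^sub>R f2 + c *\<^sub>R e + (- ((a *\<^sub>R f1 + b *\<^sub>R f2 + c *\<^sub>R e) \<bullet> w) / (e \<bullet> w)) *\<^sub>R e)
        \<partial>lborel \<partial>lborel \<partial>lborel)
      = ennreal \<bar>e \<bullet> cross3 f1 f2\<bar> * (\<integral>\<^sup>+a. \<integral>\<^sup>+b. \<integral>\<^sup>+c. indicator {0..1::real} (- c) *
        g (a *\<^sub>R f1 + b *\<^sub>R f2) \<partial>lborel \<partial>lborel \<partial>lborel)"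
      by (simp only: coord proj)
  qed measurable
  also have "\<dots> = ennreal (\<bar>e \<bullet> w\<bar> / norm w) * (\<integral>\<^sup>+a. \<integral>\<^sup>+b. g (a *\<^sub>R f1 + b *\<^sub>R f2) \<partial>lborel \<partial>lborel)"
    using en by (simp add: n_def one abs_divide)
  finally show ?thesis .
qed

section \<open>Elementary integrals over the radii and centers of disks through two points\<close>

lemma nn_integral_even:
  fixes g :: "real \<Rightarrow> ennreal"
  assumes [measurable]: "g \<in> borel_measurable borel" and even: "\<And>x. g (- x) = g x"
  shows "(\<integral>\<^sup>+x. g x \<partial>lborel) = 2 * (\<integral>\<^sup>+x. g x * indicator {0..} x \<partial>lborel)"
proof -
  have "(\<integral>\<^sup>+x. g x \<partial>lborel) = (\<integral>\<^sup>+x. g x * indicator {0..} x + g x * indicator {..<0} x \<partial>lborel)"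
    by (intro nn_integral_cong) (auto simp: indicator_def)
  also have "\<dots> = (\<integral>\<^sup>+x. g x * indicator {0..} x \<partial>lborel) + (\<integral>\<^sup>+x. g x * indicator {..<0} x \<partial>lborel)"
    by (rule nn_integral_add) auto
  also have "(\<integral>\<^sup>+x. g x * indicator {..<0} x \<partial>lborel) = (\<integral>\<^sup>+x. g x * indicator {..<0} (- x) \<partial>lborel)"
    by (subst nn_integral_real_affine[where c="-1" and t=0]) (auto simp: even)
  also have "\<dots> = (\<integral>\<^sup>+x. g x * indicator {0..} x \<partial>lborel)"
    by (intro nn_integral_cong_AE, use AE_lborel_singleton[of 0] in eventually_elim) (auto simp: indicator_def)
  finally show ?thesis by (simp add: mult_2)
qed

text \<open>The weight \<open>1 / r ^ 4\<close> is that of \<open>circle_measure\<close>;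
  \<open>m\<close> will be the smallest radius for which the disk with a given center contains two
  given points.\<close>

lemma nn_integral_inverse_power4:
  assumes "m > 0"
  shows "(\<integral>\<^sup>+r. ennreal (1 / r ^ 4) * indicator {m..} r \<partial>lborel) = ennreal (1 / (3 * m ^ 3))"
proof -
  have lim: "((\<lambda>r::real. - 1 / (3 * r ^ 3)) \<longlongrightarrow> 0) at_top" by real_asymp
  have "(\<integral>\<^sup>+r. ennreal (1 / r ^ 4) * indicator {m..} r \<partial>lborel) = ennreal (0 - (- 1 / (3 * m ^ 3)))"
  proof (rule nn_integral_FTC_atLeast[OF _ _ _ lim])
    fix r assume "m \<le> r"
    then have "r > 0" using assms by simp
    then show "((\<lambda>r. - 1 / (3 * r ^ 3)) has_real_derivative 1 / r ^ 4) (at r)"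
      by (auto intro!: derivative_eq_intros simp: field_simps power_numeral_reduce)
  qed auto
  then show ?thesis by simp
qed

lemma nn_integral_inverse_sqrt_cubed:
  assumes A: "A > 0"
  shows "(\<integral>\<^sup>+b. ennreal (1 / (3 * sqrt (A\<^sup>2 + b\<^sup>2) ^ 3)) \<partial>lborel) = ennreal (2 / (3 * A\<^sup>2))"
proof -
  have pos: "A\<^sup>2 + b\<^sup>2 > 0" for b using A by (simp add: add_pos_nonneg)
  \<comment> \<open>The function is an antiderivative of 1/(3 sqrt(A^2 + b^2)^3) that vanishes at 0;
    by evenness its limit is half of the result.\<close>
  have lim: "((\<lambda>b. b / (3 * A\<^sup>2 * sqrt (A\<^sup>2 + b\<^sup>2))) \<longlongrightarrow> 1 / (3 * A\<^sup>2)) at_top"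
    using A by (real_asymp simp: field_simps)
  have "(\<integral>\<^sup>+b. ennreal (1 / (3 * sqrt (A\<^sup>2 + b\<^sup>2) ^ 3)) * indicator {0..} b \<partial>lborel) = ennreal (1 / (3 * A\<^sup>2) - 0 / (3 * A\<^sup>2 * sqrt (A\<^sup>2 + 0\<^sup>2)))"
  proof (rule nn_integral_FTC_atLeast[OF _ _ _ lim])
    fix b :: real
    define S where "S = sqrt (A\<^sup>2 + b\<^sup>2)"
    have S: "S > 0" "S\<^sup>2 = A\<^sup>2 + b\<^sup>2" using pos[of b] by (auto simp: S_def)
    have d1: "((\<lambda>b. sqrt (A\<^sup>2 + b\<^sup>2)) has_real_derivative b / S) (at b)"
      using pos[of b] by (auto intro!: derivative_eq_intros simp: S_def divide_simps)
    have "((\<lambda>b. b / (3 * A\<^sup>2 * sqrt (A\<^sup>2 + b\<^sup>2))) has_real_derivative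
      (1 * (3 * A\<^sup>2 * sqrt (A\<^sup>2 + b\<^sup>2)) - b * (3 * A\<^sup>2 * (b / S))) / ((3 * A\<^sup>2 * sqrt (A\<^sup>2 + b\<^sup>2)) * (3 * A\<^sup>2 * sqrt (A\<^sup>2 + b\<^sup>2)))) (at b)"
      by (rule DERIV_divide[OF DERIV_ident DERIV_cmult[OF d1]]) (use A S(1) in \<open>auto simp: S_def\<close>)
    then have "((\<lambda>b. b / (3 * A\<^sup>2 * sqrt (A\<^sup>2 + b\<^sup>2))) has_real_derivative
      (3 * A\<^sup>2 * S - b * (3 * A\<^sup>2 * (b / S))) / (3 * A\<^sup>2 * S)\<^sup>2) (at b)"
      by (simp only: S_def[symmetric] power2_eq_square[of "3 * A\<^sup>2 * S"] mult_1)
    moreover have "(3 * A\<^sup>2 * S - b * (3 * A\<^sup>2 * (b / S))) / (3 * A\<^sup>2 * S)\<^sup>2 = 1 / (3 * S ^ 3)"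
    proof -
      have "3 * A\<^sup>2 * S - b * (3 * A\<^sup>2 * (b / S)) = 3 * A\<^sup>2 * (S\<^sup>2 - b\<^sup>2) / S"
        using S(1) by (simp add: field_simps power2_eq_square)
      also have "S\<^sup>2 - b\<^sup>2 = A\<^sup>2" using S(2) by simp
      finally show ?thesis using S(1) A by (simp add: field_simps power2_eq_square power3_eq_cube)
    qed
    ultimately show "((\<lambda>b. b / (3 * A\<^sup>2 * sqrt (A\<^sup>2 + b\<^sup>2))) has_real_derivative 1 / (3 * sqrt (A\<^sup>2 + b\<^sup>2) ^ 3)) (at b)"
      by (simp add: S_def)
  qed auto
  moreover have "2 * ennreal (1 / (3 * A\<^sup>2)) = ennreal (2 / (3 * A\<^sup>2))"
    using ennreal_mult'[of 2 "1 / (3 * A\<^sup>2)"] by simp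
  ultimately show ?thesis by (subst nn_integral_even) auto
qed

text \<open>With the origin moved to the midpoint of the segment from \<open>- d\<close> to 0, the
  maximum becomes \<open>\<bar>a\<bar> + d / 2\<close>, whose inverse square has an elementary
  antiderivative.\<close>

lemma nn_integral_inverse_max_square:
  assumes d: "d > 0"
  shows "(\<integral>\<^sup>+a. ennreal (2 / (3 * (max \<bar>a\<bar> \<bar>d + a\<bar>)\<^sup>2)) \<partial>lborel) = ennreal (8 / (3 * d))"
proof -
  have mx: "max \<bar>- (d / 2) + 1 * a\<bar> \<bar>d + (- (d / 2) + 1 * a)\<bar> = \<bar>a\<bar> + d / 2" for a using d by (auto simp: max_def abs_if)
  have lim: "((\<lambda>a. - 2 / (3 * (a + d / 2))) \<longlongrightarrow> 0) at_top" by real_asymp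
  have "(\<integral>\<^sup>+a. ennreal (2 / (3 * (max \<bar>a\<bar> \<bar>d + a\<bar>)\<^sup>2)) \<partial>lborel) = (\<integral>\<^sup>+a. ennreal (2 / (3 * (\<bar>a\<bar> + d / 2)\<^sup>2)) \<partial>lborel)"
    by (subst nn_integral_real_affine[where c=1 and t="- (d / 2)"]) (auto simp only: mx, auto)
  also have "\<dots> = 2 * (\<integral>\<^sup>+a. ennreal (2 / (3 * (\<bar>a\<bar> + d / 2)\<^sup>2)) * indicator {0..} a \<partial>lborel)"
    by (rule nn_integral_even) auto
  also have "(\<integral>\<^sup>+a. ennreal (2 / (3 * (\<bar>a\<bar> + d / 2)\<^sup>2)) * indicator {0..} a \<partial>lborel)
    = (\<integral>\<^sup>+a. ennreal (2 / (3 * (a + d / 2)\<^sup>2)) * indicator {0..} a \<partial>lborel)"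
    by (intro nn_integral_cong) (auto simp: indicator_def)
  also have "\<dots> = ennreal (0 - (- 2 / (3 * (0 + d / 2))))"
  proof (rule nn_integral_FTC_atLeast[OF _ _ _ lim])
    fix a :: real assume "0 \<le> a"
    then have x: "a + d / 2 > 0" using d by simp
    have "((\<lambda>a. - 2 / (3 * (a + d / 2))) has_real_derivative
      (0 * (3 * (a + d / 2)) - - 2 * (3 * (1 + 0))) / ((3 * (a + d / 2)) * (3 * (a + d / 2)))) (at a)"
      by (rule DERIV_divide[OF DERIV_const DERIV_cmult[OF DERIV_add[OF DERIV_ident DERIV_const]]]) (use x in simp)
    moreover have "(0 * (3 * x) - - 2 * (3 * (1 + 0))) / ((3 * x) * (3 * x)) = 2 / (3 * x\<^sup>2)" for x :: real
      by (simp add: power2_eq_square)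
    ultimately show "((\<lambda>a. - 2 / (3 * (a + d / 2))) has_real_derivative 2 / (3 * (a + d / 2)\<^sup>2)) (at a)"
      by metis
  qed auto
  also have "2 * \<dots> = ennreal (8 / (3 * d))"
    using ennreal_mult'[of 2 "4 / (3 * d)"] by simp
  finally show ?thesis .
qed

text \<open>
  The center is minus the projection of \<open>y\<close> to the plane orthogonal to \<open>n\<close>, and the two points are \<open>0\<close> and
  \<open>w\<close>.  An integral over a plane is written as an integral over a slab of thickness 1 throughout.
\<close>

lemma nn_integral_disks_through_two_points:
  fixes n w :: "real^3"
  assumes n: "norm n = 1" and w: "w \<noteq> 0" "n \<bullet> w = 0"
  shows "(\<integral>\<^sup>+r. \<integral>\<^sup>+y. indicator {0<..} r * ennreal (1 / r ^ 4) * indicator {0..1} (n \<bullet> y)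
      * indicator {..r} (norm (y - (n \<bullet> y) *\<^sub>R n)) * indicator {..r} (norm (w + (y - (n \<bullet> y) *\<^sub>R n))) \<partial>lborel \<partial>lborel)
    = ennreal (8 / (3 * norm w))"
proof -
  define d where "d = norm w"
  define f where "f = sgn w"
  have d: "d > 0" "w = d *\<^sub>R f" using w by (auto simp: d_def f_def sgn_div_norm)
  have f: "norm f = 1" "n \<bullet> f = 0" using w by (auto simp: f_def norm_sgn sgn_div_norm)
  note pair = orthonormal_pair_cross[OF n f]
  define h where "h = cross3 n f"
  have nn: "n \<bullet> n = 1" using n by (simp add: norm_eq_1)
  \<comment> \<open>The smallest radius of a disk that contains 0 and \<open>w\<close> when the
    center has the coordinates \<open>- a\<close> along the chord and \<open>- b\<close> across it:
    the larger of the two distances.\<close>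
  define m where "m a b = sqrt ((max \<bar>a\<bar> \<bar>d + a\<bar>)\<^sup>2 + b\<^sup>2)" for a b
  have mpos: "m a b > 0" for a b
  proof -
    have "max \<bar>a\<bar> \<bar>d + a\<bar> > 0" using d by linarith
    then show ?thesis unfolding m_def by (simp add: add_pos_nonneg)
  qed
  have [measurable (raw)]: "(\<lambda>x. m (f x) (g x)) \<in> borel_measurable M"
    if [measurable]: "f \<in> borel_measurable M" "g \<in> borel_measurable M" for f g and M :: "'z measure"
    unfolding m_def by measurable
  \<comment> \<open>As an indicator of a fixed set applied to a difference, the factor is jointly
    measurable in all variables.\<close>
  have ind: "indicator {m a b..} r = (indicator {0..} (r - m a b) :: ennreal)" for a b r by (auto simp: indicator_def)
  have m_le: "sqrt (a\<^sup>2 + b\<^sup>2) \<le> r \<and> sqrt ((d + a)\<^sup>2 + b\<^sup>2) \<le> r \<longleftrightarrow> m a b \<le> r" for a b r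
  proof -
    have "m a b = max (sqrt (a\<^sup>2 + b\<^sup>2)) (sqrt ((d + a)\<^sup>2 + b\<^sup>2))"
    proof (cases "\<bar>a\<bar> \<le> \<bar>d + a\<bar>")
      case True
      then have "a\<^sup>2 \<le> (d + a)\<^sup>2" by (simp add: abs_le_square_iff)
      then show ?thesis using True by (simp add: m_def max_def)
    next
      case False
      then have "(d + a)\<^sup>2 < a\<^sup>2" by (simp add: abs_le_square_iff not_le[symmetric])
      then show ?thesis using False by (simp add: m_def max_def)
    qed
    then show ?thesis by simp
  qed
  have inner: "(\<integral>\<^sup>+y. indicator {0<..} r * ennreal (1 / r ^ 4) * indicator {0..1} (n \<bullet> y)
      * indicator {..r} (norm (y - (n \<bullet> y) *\<^sub>R n)) * indicator {..r} (norm (w + (y - (n \<bullet> y) *\<^sub>R n))) \<partial>lborel)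
    = (\<integral>\<^sup>+a. \<integral>\<^sup>+b. ennreal (1 / r ^ 4) * indicator {m a b..} r \<partial>lborel \<partial>lborel)" for r
  proof -
    define g where "g x = (indicator {0<..} r * ennreal (1 / r ^ 4) * indicator {..r} (norm x) * indicator {..r} (norm (w + x)) :: ennreal)" for x :: "real^3"
    have [measurable]: "g \<in> borel_measurable borel" unfolding g_def by measurable
    \<comment> \<open>With the direction \<open>- n\<close> and the plane orthogonal to
      \<open>n\<close>, the oblique projection of the slab lemma is the orthogonal one.\<close>
    have "(\<integral>\<^sup>+y. indicator {0<..} r * ennreal (1 / r ^ 4) * indicator {0..1} (n \<bullet> y)
      * indicator {..r} (norm (y - (n \<bullet> y) *\<^sub>R n)) * indicator {..r} (norm (w + (y - (n \<bullet> y) *\<^sub>R n))) \<partial>lborel)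
      = (\<integral>\<^sup>+x. indicator {0..1} (- (x \<bullet> n) / (- n \<bullet> n)) * g (x + (- (x \<bullet> n) / (- n \<bullet> n)) *\<^sub>R (- n)) \<partial>lborel)"
      by (intro nn_integral_cong) (simp add: nn g_def inner_commute mult_ac)
    also have "\<dots> = ennreal (\<bar>- n \<bullet> n\<bar> / norm n) * (\<integral>\<^sup>+a. \<integral>\<^sup>+b. g (a *\<^sub>R f + b *\<^sub>R h) \<partial>lborel \<partial>lborel)"
      using pair nn n by (intro nn_integral_slab_projection) (auto simp: h_def)
    also have "\<dots> = (\<integral>\<^sup>+a. \<integral>\<^sup>+b. g (a *\<^sub>R f + b *\<^sub>R h) \<partial>lborel \<partial>lborel)" by (simp add: nn n)
    also have "\<dots> = (\<integral>\<^sup>+a. \<integral>\<^sup>+b. ennreal (1 / r ^ 4) * indicator {m a b..} r \<partial>lborel \<partial>lborel)"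
    proof (intro nn_integral_cong)
      fix a b
      have "w + (a *\<^sub>R f + b *\<^sub>R h) = (d + a) *\<^sub>R f + b *\<^sub>R h" by (subst d(2)) (simp add: algebra_simps)
      then have "g (a *\<^sub>R f + b *\<^sub>R h) = indicator {0<..} r * ennreal (1 / r ^ 4) * indicator {..r} (sqrt (a\<^sup>2 + b\<^sup>2)) * indicator {..r} (sqrt ((d + a)\<^sup>2 + b\<^sup>2))"
        unfolding g_def by (simp only: norm_orthonormal_pair[OF pair(1), folded h_def])
      also have "\<dots> = ennreal (1 / r ^ 4) * indicator {m a b..} r"
        using m_le[of a b r] mpos[of a b] by (auto simp: indicator_def)
      finally show "g (a *\<^sub>R f + b *\<^sub>R h) = \<dots>" .
    qed
    finally show ?thesis .
  qed
  have "(\<integral>\<^sup>+r. \<integral>\<^sup>+a. \<integral>\<^sup>+b. ennreal (1 / r ^ 4) * indicator {m a b..} r \<partial>lborel \<partial>lborel \<partial>lborel)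
    = (\<integral>\<^sup>+a. \<integral>\<^sup>+r. \<integral>\<^sup>+b. ennreal (1 / r ^ 4) * indicator {m a b..} r \<partial>lborel \<partial>lborel \<partial>lborel)"
    unfolding ind by (rule lborel_pair.Fubini') measurable
  also have "\<dots> = (\<integral>\<^sup>+a. \<integral>\<^sup>+b. \<integral>\<^sup>+r. ennreal (1 / r ^ 4) * indicator {m a b..} r \<partial>lborel \<partial>lborel \<partial>lborel)"
    unfolding ind by (rule nn_integral_cong, rule lborel_pair.Fubini') measurable
  also have "\<dots> = (\<integral>\<^sup>+a. \<integral>\<^sup>+b. ennreal (1 / (3 * m a b ^ 3)) \<partial>lborel \<partial>lborel)"
    by (simp add: nn_integral_inverse_power4 mpos)
  also have "\<dots> = (\<integral>\<^sup>+a. ennreal (2 / (3 * (max \<bar>a\<bar> \<bar>d + a\<bar>)\<^sup>2)) \<partial>lborel)"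
    unfolding m_def by (intro nn_integral_cong nn_integral_inverse_sqrt_cubed) (use d in linarith)
  also have "\<dots> = ennreal (8 / (3 * d))" by (rule nn_integral_inverse_max_square[OF d(1)])
  finally show ?thesis unfolding inner by (simp add: d_def)
qed

section \<open>Moments of the unit disk and the unit ball, computed by layers instead of polar
  coordinates\<close>

lemma ennreal_one_minus_norm:
  fixes z :: "'a::euclidean_space"
  shows "ennreal (1 - norm z) * indicator (ball 0 1) z = (\<integral>\<^sup>+\<tau>. indicator {0..1} \<tau> * indicator (ball 0 \<tau>) z \<partial>lborel)"
proof (cases "norm z < 1")
    case True
    have "(\<integral>\<^sup>+\<tau>. indicator {0..1} \<tau> * indicator (ball 0 \<tau>) z \<partial>lborel) = (\<integral>\<^sup>+\<tau>. indicator {norm z<..1} \<tau> \<partial>lborel)"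
      by (intro nn_integral_cong) (auto simp: indicator_def intro: order_trans[OF norm_ge_zero] less_imp_le)
    then show ?thesis using True by simp
  next
    case False
    then have "(\<integral>\<^sup>+\<tau>. indicator {0..1} \<tau> * indicator (ball 0 \<tau>) z \<partial>lborel) = integral\<^sup>N lborel (\<lambda>\<tau>::real. 0)"
      by (intro nn_integral_cong) (auto simp: indicator_def)
    then show ?thesis using False by (simp add: indicator_def)
qed

text \<open>By layers, the integral of 1 - |z| over the unit disk is that of the areas pi \<tau>^2
  over \<tau> in [0, 1], that is pi/3; it is subtracted from the area pi.\<close>

lemma has_bochner_integral_norm_disk:
  "has_bochner_integral lborel (\<lambda>z::real \<times> real. norm z * indicator (ball 0 1) z) (2 * pi / 3)"
proof -
  have ind: "indicator (ball 0 \<tau>) z = (indicator {0<..} (\<tau> - norm z) :: ennreal)" for \<tau> and z :: "real \<times> real"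
    by (auto simp: indicator_def)
  have "(\<integral>\<^sup>+z. ennreal (1 - norm z) * indicator (ball 0 1) z \<partial>(lborel :: (real \<times> real) measure))
    = (\<integral>\<^sup>+z. (\<integral>\<^sup>+\<tau>. indicator {0..1} \<tau> * indicator (ball 0 \<tau>) z \<partial>lborel) \<partial>(lborel :: (real \<times> real) measure))"
    unfolding ennreal_one_minus_norm ..
  also have "\<dots> = (\<integral>\<^sup>+\<tau>. (\<integral>\<^sup>+z. indicator {0..1} \<tau> * indicator (ball 0 \<tau>) z \<partial>(lborel :: (real \<times> real) measure)) \<partial>lborel)"
    unfolding ind by (rule lborel_pair.Fubini') measurable
  also have "\<dots> = (\<integral>\<^sup>+\<tau>. ennreal (pi * \<tau>\<^sup>2) * indicator {0..1} \<tau> \<partial>lborel)"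
  proof (rule nn_integral_cong)
    fix \<tau> :: real
    have "ball (0 :: real \<times> real) \<tau> \<in> sets lborel" by simp
    then show "(\<integral>\<^sup>+z. indicator {0..1} \<tau> * indicator (ball 0 \<tau>) z \<partial>(lborel :: (real \<times> real) measure)) = ennreal (pi * \<tau>\<^sup>2) * indicator {0..1} \<tau>"
      by (subst nn_integral_cmult_indicator) (auto simp: emeasure_ball indicator_def unit_ball_vol_2 power2_eq_square)
  qed
  also have "\<dots> = ennreal (pi * 1 ^ 3 / 3 - pi * 0 ^ 3 / 3)"
    by (rule nn_integral_FTC_Icc) (auto intro!: derivative_eq_intros)
  also have "(\<integral>\<^sup>+z. ennreal (1 - norm z) * indicator (ball 0 1) z \<partial>(lborel :: (real \<times> real) measure))
      = (\<integral>\<^sup>+z. ennreal ((1 - norm z) * indicator (ball 0 1) z) \<partial>(lborel :: (real \<times> real) measure))"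
    by (intro nn_integral_cong) (auto simp: indicator_def)
  finally have "(\<integral>\<^sup>+z. ennreal ((1 - norm z) * indicator (ball 0 1) z) \<partial>(lborel :: (real \<times> real) measure)) = ennreal (pi / 3)"
    by simp
  then have "has_bochner_integral lborel (\<lambda>z::real \<times> real. (1 - norm z) * indicator (ball 0 1) z) (pi / 3)"
    by (intro has_bochner_integral_nn_integral) (auto simp: indicator_def)
  moreover have "has_bochner_integral lborel (\<lambda>z::real \<times> real. indicator (ball 0 1) z :: real) (pi :: real)"
    using has_bochner_integral_real_indicator[of "ball 0 1 :: (real \<times> real) set" lborel]
    by (simp add: emeasure_ball content_ball unit_ball_vol_2)
  ultimately have "has_bochner_integral lborel (\<lambda>z::real \<times> real. indicator (ball 0 1) z - (1 - norm z) * indicator (ball 0 1) z :: real) (pi - pi / 3)"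
    by (intro has_bochner_integral_diff)
  then show ?thesis by (simp add: algebra_simps)
qed

lemma integrable_disk_quotient:
  fixes Q :: "real \<times> real \<Rightarrow> real"
  assumes [measurable]: "Q \<in> borel_measurable borel" and Q: "\<And>z. \<bar>Q z\<bar> \<le> C * (norm z)\<^sup>2"
  shows "integrable lborel (\<lambda>z. Q z / norm z * indicator (ball 0 1) z)"
proof -
  have [measurable]: "ball (0::real \<times> real) 1 \<in> sets borel" by simp
  show ?thesis
  proof (rule Bochner_Integration.integrable_bound)
  show "integrable lborel (\<lambda>z::real \<times> real. C * (norm z * indicator (ball 0 1) z))"
    using has_bochner_integral_norm_disk by (intro integrable_mult_right) (auto simp: has_bochner_integral_iff)
  have "norm (Q z / norm z * indicator (ball 0 1) z) \<le> norm (C * (norm z * indicator (ball 0 1) z))" for z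
  proof (cases "z = 0")
    case False
    then have "\<bar>Q z\<bar> / norm z \<le> C * norm z" using Q[of z] by (simp add: divide_simps power2_eq_square mult_ac)
    then show ?thesis by (auto simp: indicator_def)
  qed auto
  then show "AE z in lborel. norm (Q z / norm z * indicator (ball 0 1) z) \<le> norm (C * (norm z * indicator (ball 0 1) z))" by simp
qed measurable
qed

text \<open>The symmetries \<open>(a, b) \<mapsto> (b, a)\<close> and \<open>(a, b) \<mapsto> (- a, b)\<close> reduce the integral to that of the norm.\<close>

lemma has_bochner_integral_disk_product:
  fixes u1 u2 v1 v2 :: real
  shows "has_bochner_integral lborel (\<lambda>z. (fst z * u1 + snd z * u2) * (fst z * v1 + snd z * v2) / norm z * indicator (ball 0 1) z)
    (pi / 3 * (u1 * v1 + u2 * v2))"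
proof -
  have nsq: "(norm z)\<^sup>2 = (fst z)\<^sup>2 + (snd z)\<^sup>2" for z :: "real \<times> real" by (cases z) (simp add: norm_Pair)
  define I where "I Q = integral\<^sup>L lborel (\<lambda>z::real \<times> real. Q z / norm z * indicator (ball 0 1) z)" for Q :: "real \<times> real \<Rightarrow> real"
  define A B X :: "real \<times> real \<Rightarrow> real" where "A z = (fst z)\<^sup>2" and "B z = (snd z)\<^sup>2" and "X z = fst z * snd z" for z
  note defs = A_def[abs_def] B_def[abs_def] X_def[abs_def]
  have int: "integrable lborel (\<lambda>z. A z / norm z * indicator (ball 0 1) z)"
    "integrable lborel (\<lambda>z. B z / norm z * indicator (ball 0 1) z)"
    "integrable lborel (\<lambda>z. X z / norm z * indicator (ball 0 1) z)"
  proof (rule_tac[!] integrable_disk_quotient[where C=1])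
    show "A \<in> borel_measurable borel" "B \<in> borel_measurable borel" "X \<in> borel_measurable borel"
      unfolding defs by (intro borel_measurable_continuous_onI continuous_intros)+
    show "\<bar>X z\<bar> \<le> 1 * (norm z)\<^sup>2" for z
    proof -
      have "2 * (\<bar>fst z\<bar> * \<bar>snd z\<bar>) \<le> (fst z)\<^sup>2 + (snd z)\<^sup>2"
        using sum_squares_bound[of "\<bar>fst z\<bar>" "\<bar>snd z\<bar>"] by simp
      moreover have "\<bar>fst z\<bar> * \<bar>snd z\<bar> \<ge> 0" by simp
      ultimately show ?thesis unfolding defs nsq abs_mult mult_1 by linarith
    qed
  qed (auto simp: defs nsq)
  have [measurable]: "(\<lambda>z::real \<times> real. norm z) \<in> borel_measurable (borel \<Otimes>\<^sub>M borel)" by (simp add: borel_prod)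
  have ball: "indicator (ball 0 1) z = indicator {..<1::real} (norm z)" for z :: "real \<times> real" by (auto simp: indicator_def)
  have swap: "I A = I B"
  proof -
    have "I A = integral\<^sup>L (lborel \<Otimes>\<^sub>M lborel) (\<lambda>(a, b). A (a, b) / norm (a, b) * indicator {..<1} (norm (a, b)))"
      by (simp add: I_def lborel_prod split_def ball)
    also have "\<dots> = integral\<^sup>L (lborel \<Otimes>\<^sub>M lborel) (\<lambda>(b, a). A (a, b) / norm (a, b) * indicator {..<1} (norm (a, b)))"
      unfolding defs by (subst lborel_pair.integral_product_swap[symmetric]) (auto simp: split_def)
    also have "\<dots> = I B"
      by (simp add: I_def lborel_prod split_def ball defs norm_Pair add.commute norm_prod_def)
    finally show ?thesis .
  qed
  have refl: "I X = 0"
  proof -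
    have "I X = integral\<^sup>L (lborel \<Otimes>\<^sub>M lborel) (\<lambda>(a, b). X (a, b) / norm (a, b) * indicator {..<1} (norm (a, b)))"
      by (simp add: I_def lborel_prod split_def ball)
    also have "\<dots> = (\<integral>a. \<integral>b. X (a, b) / norm (a, b) * indicator {..<1} (norm (a, b)) \<partial>lborel \<partial>lborel)"
      using int(3) by (subst lborel_pair.integral_fst') (simp_all add: lborel_prod split_def ball)
    also have "\<dots> = integral\<^sup>L lborel (\<lambda>a::real. 0)"
    proof (rule Bochner_Integration.integral_cong)
      fix a :: real
      define J where "J = (\<integral>b. X (a, b) / norm (a, b) * indicator {..<1} (norm (a, b)) \<partial>lborel)"
      have "J = (\<integral>b. X (a, 0 + (-1) * b) / norm (a, 0 + (-1) * b) * indicator {..<1} (norm (a, 0 + (-1) * b)) \<partial>lborel)"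
        unfolding J_def by (subst lborel_integral_real_affine[where c="-1" and t=0]) auto
      also have "\<dots> = - J" unfolding J_def by (simp add: defs norm_Pair)
      finally show "(\<integral>b. X (a, b) / norm (a, b) * indicator {..<1} (norm (a, b)) \<partial>lborel) = 0" unfolding J_def by simp
    qed simp
    finally show ?thesis by simp
  qed
  \<comment> \<open>The two numerators add up to the square of the norm, so each of the equal
    integrals is half of 2 pi/3.\<close>
  have "I A + I B = integral\<^sup>L lborel (\<lambda>z. A z / norm z * indicator (ball 0 1) z + B z / norm z * indicator (ball 0 1) z)"
    unfolding I_def using int by (intro Bochner_Integration.integral_add[symmetric])
  also have "\<dots> = integral\<^sup>L lborel (\<lambda>z::real \<times> real. norm z * indicator (ball 0 1) z)"
  proof (rule Bochner_Integration.integral_cong)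
    fix z :: "real \<times> real"
    have "A z / norm z + B z / norm z = norm z"
    proof -
      have "A z / norm z + B z / norm z = (norm z)\<^sup>2 / norm z"
        unfolding nsq by (simp add: defs add_divide_distrib)
      then show ?thesis by (simp add: power2_eq_square)
    qed
    then show "A z / norm z * indicator (ball 0 1) z + B z / norm z * indicator (ball 0 1) z = norm z * indicator (ball 0 1) z"
      by (metis distrib_right)
  qed simp
  also have "\<dots> = 2 * pi / 3" using has_bochner_integral_norm_disk by (simp add: has_bochner_integral_iff)
  finally have IA: "I A = pi / 3" "I B = pi / 3" using swap by auto
  have hb: "has_bochner_integral lborel (\<lambda>z. A z / norm z * indicator (ball 0 1) z) (pi / 3)"
    "has_bochner_integral lborel (\<lambda>z. B z / norm z * indicator (ball 0 1) z) (pi / 3)"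
    "has_bochner_integral lborel (\<lambda>z. X z / norm z * indicator (ball 0 1) z) 0"
    using int IA refl by (auto simp: has_bochner_integral_iff I_def)
  have "has_bochner_integral lborel (\<lambda>z. (u1 * v1) * (A z / norm z * indicator (ball 0 1) z) + (u2 * v2) * (B z / norm z * indicator (ball 0 1) z)
     + (u1 * v2 + u2 * v1) * (X z / norm z * indicator (ball 0 1) z)) ((u1 * v1) * (pi / 3) + (u2 * v2) * (pi / 3) + (u1 * v2 + u2 * v1) * 0)"
    by (intro has_bochner_integral_add has_bochner_integral_mult_right hb)
  moreover have "(u1 * v1) * (A z / norm z * indicator (ball 0 1) z) + (u2 * v2) * (B z / norm z * indicator (ball 0 1) z)
     + (u1 * v2 + u2 * v1) * (X z / norm z * indicator (ball 0 1) z)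
    = (fst z * u1 + snd z * u2) * (fst z * v1 + snd z * v2) / norm z * indicator (ball 0 1) z" for z
    by (cases "z = 0") (simp_all add: defs field_simps power2_eq_square)
  ultimately show ?thesis by (simp add: algebra_simps)
qed

text \<open>
  Since \<open>\<bar>sgn x \<bullet> u\<bar>\<close> is homogeneous of degree 0, its integral over the ball of radius \<open>\<tau>\<close> is
  \<open>\<tau> ^ 3\<close> times the integral over the unit ball.  This reduces the claim to the integral of \<open>\<bar>x \<bullet> u\<bar>\<close>.
\<close>

lemma nn_integral_ball_abs_inner:
  fixes u :: "real^3"
  assumes "u \<noteq> 0"
  shows "(\<integral>\<^sup>+x. indicator (ball 0 1) x * ennreal \<bar>x \<bullet> u\<bar> \<partial>lborel) = ennreal (pi / 2 * norm u)"
proof -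
  define n where "n = sgn u"
  have n: "norm n = 1" "u = norm u *\<^sub>R n" using assms by (auto simp: n_def norm_sgn sgn_div_norm)
  from n(1) obtain f1 f2 where f: "orthonormal_pair f1 f2" "cross3 f1 f2 = n" by (rule obtain_orthonormal_pair)
  have nn: "n \<bullet> n = 1" using n by (simp add: norm_eq_1)
  have perp: "f1 \<bullet> n = 0" "f2 \<bullet> n = 0" "n \<bullet> f1 = 0" "n \<bullet> f2 = 0" by (simp_all add: f(2)[symmetric] dot_cross_self)
  have det: "f2 \<bullet> cross3 n f1 = 1"
    using nn by (simp add: f(2)[symmetric] cross3_simps)
  have nsq: "(norm (c *\<^sub>R n + a *\<^sub>R f1 + b *\<^sub>R f2))\<^sup>2 = c\<^sup>2 + (norm (a, b))\<^sup>2" for a b c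
  proof -
    have "(norm (c *\<^sub>R n + (a *\<^sub>R f1 + b *\<^sub>R f2)))\<^sup>2 = (norm (c *\<^sub>R n))\<^sup>2 + (norm (a *\<^sub>R f1 + b *\<^sub>R f2))\<^sup>2"
      by (rule norm_add_Pythagorean) (simp add: orthogonal_def inner_add_right perp)
    then show ?thesis using n(1) by (simp add: norm_orthonormal_pair[OF f(1)] norm_Pair add.assoc)
  qed
  have [measurable]: "ball (0::real^3) 1 \<in> sets borel" by simp
  have [measurable]: "ball (0::real \<times> real) r \<in> sets borel" for r by simp
  have slice: "(\<integral>\<^sup>+a. \<integral>\<^sup>+b. indicator (ball 0 1) (c *\<^sub>R n + a *\<^sub>R f1 + b *\<^sub>R f2) * K \<partial>lborel \<partial>lborel)
    = ennreal (pi * (1 - c\<^sup>2)) * indicator {-1..1} c * K" for c and K :: ennreal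
  proof -
    have in_ball: "indicator (ball 0 1) (c *\<^sub>R n + a *\<^sub>R f1 + b *\<^sub>R f2) = (indicator (ball 0 (sqrt (1 - c\<^sup>2))) (a, b) :: ennreal)" for a b
    proof -
      have "norm (c *\<^sub>R n + a *\<^sub>R f1 + b *\<^sub>R f2) < 1 \<longleftrightarrow> (norm (c *\<^sub>R n + a *\<^sub>R f1 + b *\<^sub>R f2))\<^sup>2 < 1"
        by (simp add: power_less_one_iff abs_square_less_1)
      also have "\<dots> \<longleftrightarrow> (norm (a, b))\<^sup>2 < 1 - c\<^sup>2" unfolding nsq by linarith
      \<comment> \<open>\<open>sqrt\<close> is increasing on the whole line and negative on negative
        numbers, so the equivalence persists for |c| > 1, where the section and the ball of negative
        radius are both empty.\<close>
      also have "\<dots> \<longleftrightarrow> norm (a, b) < sqrt (1 - c\<^sup>2)"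
        using real_sqrt_less_iff[of "(norm (a, b))\<^sup>2" "1 - c\<^sup>2"] by simp
      finally show ?thesis by (simp add: indicator_def)
    qed
    have "(\<integral>\<^sup>+a. \<integral>\<^sup>+b. indicator (ball 0 1) (c *\<^sub>R n + a *\<^sub>R f1 + b *\<^sub>R f2) * K \<partial>lborel \<partial>lborel)
       = (\<integral>\<^sup>+z. indicator (ball 0 (sqrt (1 - c\<^sup>2))) z * K \<partial>(lborel \<Otimes>\<^sub>M lborel :: (real \<times> real) measure))"
      unfolding in_ball by (rule lborel.nn_integral_fst) (simp add: lborel_prod)
    also have "\<dots> = emeasure lborel (ball (0 :: real \<times> real) (sqrt (1 - c\<^sup>2))) * K"
      by (simp only: lborel_prod, subst nn_integral_multc) auto
    also have "\<dots> = ennreal (pi * (1 - c\<^sup>2)) * indicator {-1..1} c * K"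
    proof (cases "c \<in> {-1..1}")
      case True
      then have "c\<^sup>2 \<le> 1" by (simp add: abs_square_le_1 abs_le_iff)
      then show ?thesis using True by (simp add: emeasure_ball unit_ball_vol_2)
    next
      case False
      then have "\<not> c\<^sup>2 \<le> 1" by (auto simp: abs_square_le_1 abs_le_iff)
      then have "ball (0 :: real \<times> real) (sqrt (1 - c\<^sup>2)) = {}" by simp
      then have "emeasure lborel (ball (0 :: real \<times> real) (sqrt (1 - c\<^sup>2))) = 0" by (simp only: emeasure_empty)
      then show ?thesis using False by (auto simp: indicator_def)
    qed
    finally show ?thesis .
  qed
  have "(\<integral>\<^sup>+x. indicator (ball 0 1) x * ennreal \<bar>x \<bullet> u\<bar> \<partial>lborel)
    = (\<integral>\<^sup>+c. \<integral>\<^sup>+a. \<integral>\<^sup>+b. indicator (ball 0 1) (c *\<^sub>R n + a *\<^sub>R f1 + b *\<^sub>R f2) * ennreal (\<bar>c\<bar> * norm u) \<partial>lborel \<partial>lborel \<partial>lborel)"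
  proof -
    have inner_u: "(c *\<^sub>R n + a *\<^sub>R f1 + b *\<^sub>R f2) \<bullet> u = c * norm u" for a b c
      by (subst n(2)) (simp add: inner_add_left perp nn)
    have "(\<integral>\<^sup>+x. indicator (ball 0 1) x * ennreal \<bar>x \<bullet> u\<bar> \<partial>lborel) = ennreal \<bar>f2 \<bullet> cross3 n f1\<bar> *
       (\<integral>\<^sup>+c. \<integral>\<^sup>+a. \<integral>\<^sup>+b. indicator (ball 0 1) (c *\<^sub>R n + a *\<^sub>R f1 + b *\<^sub>R f2)
       * ennreal \<bar>(c *\<^sub>R n + a *\<^sub>R f1 + b *\<^sub>R f2) \<bullet> u\<bar> \<partial>lborel \<partial>lborel \<partial>lborel)"
      by (rule nn_integral_frame) (use det in \<open>simp, measurable\<close>)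
    then show ?thesis by (simp add: det inner_u abs_mult)
  qed
  also have "\<dots> = (\<integral>\<^sup>+c. ennreal (pi * (1 - c\<^sup>2)) * indicator {-1..1} c * ennreal (\<bar>c\<bar> * norm u) \<partial>lborel)"
    unfolding slice ..
  also have "\<dots> = 2 * (\<integral>\<^sup>+c. ennreal (pi * (1 - c\<^sup>2)) * indicator {-1..1} c * ennreal (\<bar>c\<bar> * norm u) * indicator {0..} c \<partial>lborel)"
    by (rule nn_integral_even) (auto simp: indicator_def)
  also have "(\<integral>\<^sup>+c. ennreal (pi * (1 - c\<^sup>2)) * indicator {-1..1} c * ennreal (\<bar>c\<bar> * norm u) * indicator {0..} c \<partial>lborel)
    = (\<integral>\<^sup>+c. ennreal (pi * (1 - c\<^sup>2) * c * norm u) * indicator {0..1} c \<partial>lborel)"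
    by (rule nn_integral_cong) (auto simp: indicator_def ennreal_mult'[symmetric] mult_ac abs_square_le_1)
  also have "\<dots> = ennreal (pi * norm u * (1\<^sup>2 / 2 - 1 ^ 4 / 4) - pi * norm u * (0\<^sup>2 / 2 - 0 ^ 4 / 4))"
  proof (rule nn_integral_FTC_Icc[where F="\<lambda>c. pi * norm u * (c\<^sup>2 / 2 - c ^ 4 / 4)"])
    fix c :: real assume "c \<in> {0..1}"
    then have c: "0 \<le> c" "c \<le> 1" by auto
    show "((\<lambda>c. pi * norm u * (c\<^sup>2 / 2 - c ^ 4 / 4)) has_real_derivative pi * (1 - c\<^sup>2) * c * norm u) (at c)"
      by (auto intro!: derivative_eq_intros simp: algebra_simps power2_eq_square power_numeral_reduce)
    show "0 \<le> pi * (1 - c\<^sup>2) * c * norm u" using c by (simp add: power_le_one)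
  qed auto
  also have "2 * \<dots> = ennreal (pi / 2 * norm u)"
    using ennreal_mult'[of 2 "pi / 4 * norm u"] by simp
  finally show ?thesis .
qed

lemma nn_integral_ball_abs_inner_sgn:
  fixes u :: "real^3"
  shows "(\<integral>\<^sup>+x. indicator (ball 0 1) x * ennreal \<bar>sgn x \<bullet> u\<bar> \<partial>lborel) = ennreal (2 * pi / 3 * norm u)"
proof (cases "u = 0")
  case False
  have [measurable]: "ball (0::real^3) r \<in> sets borel" for r by simp
  have [measurable]: "(\<lambda>x::real^3. sgn x) \<in> borel_measurable borel" unfolding sgn_div_norm by measurable
  define S where "S = (\<integral>\<^sup>+x. indicator (ball 0 1) x * ennreal \<bar>sgn x \<bullet> u\<bar> \<partial>lborel)"
  have scale: "(\<integral>\<^sup>+x. indicator (ball 0 \<tau>) x * ennreal \<bar>sgn x \<bullet> u\<bar> \<partial>lborel) = ennreal (\<tau> ^ 3) * S" if "\<tau> > 0" for \<tau>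
  proof -
    have "lborel = density (distr lborel borel (\<lambda>x::real^3. 0 + \<tau> *\<^sub>R x)) (\<lambda>_. \<bar>\<tau>\<bar> ^ DIM(real^3))"
      using lborel_affine[of \<tau> "0::real^3"] that by simp
    then have "(\<integral>\<^sup>+x. indicator (ball 0 \<tau>) x * ennreal \<bar>sgn x \<bullet> u\<bar> \<partial>lborel)
      = (\<integral>\<^sup>+x. indicator (ball 0 \<tau>) x * ennreal \<bar>sgn x \<bullet> u\<bar> \<partial>density (distr lborel borel (\<lambda>x::real^3. 0 + \<tau> *\<^sub>R x)) (\<lambda>_. \<bar>\<tau>\<bar> ^ DIM(real^3)))"
      by simp
    also have "\<dots> = ennreal (\<tau> ^ 3) * (\<integral>\<^sup>+x. indicator (ball 0 \<tau>) (\<tau> *\<^sub>R x) * ennreal \<bar>sgn (\<tau> *\<^sub>R x) \<bullet> u\<bar> \<partial>lborel)"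
      using that by (simp add: nn_integral_density nn_integral_distr nn_integral_cmult)
    also have "(\<integral>\<^sup>+x. indicator (ball 0 \<tau>) (\<tau> *\<^sub>R x) * ennreal \<bar>sgn (\<tau> *\<^sub>R x) \<bullet> u\<bar> \<partial>lborel) = S"
      unfolding S_def using that by (intro nn_integral_cong) (auto simp: sgn_scaleR indicator_def)
    finally show ?thesis .
  qed
  have ind: "indicator (ball 0 \<tau>) z = (indicator {0<..} (\<tau> - norm z) :: ennreal)" for \<tau> and z :: "real^3"
    by (auto simp: indicator_def)
  \<comment> \<open>Splitting 1 = (1 - |x|) + |x| leads, by layers and scaling, to S = S/4 + (pi/2)
    |u|; the 1/4 is the integral of \<tau>^3 over [0, 1].\<close>
  have "S = (\<integral>\<^sup>+x. ennreal (1 - norm x) * indicator (ball 0 1) x * ennreal \<bar>sgn x \<bullet> u\<bar> + indicator (ball 0 1) x * ennreal \<bar>x \<bullet> u\<bar> \<partial>lborel)"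
    unfolding S_def
  proof (rule nn_integral_cong)
    fix x :: "real^3"
    show "indicator (ball 0 1) x * ennreal \<bar>sgn x \<bullet> u\<bar> = ennreal (1 - norm x) * indicator (ball 0 1) x * ennreal \<bar>sgn x \<bullet> u\<bar> + indicator (ball 0 1) x * ennreal \<bar>x \<bullet> u\<bar>"
    proof (cases "x \<in> ball 0 1")
      case True
      have "\<bar>x \<bullet> u\<bar> = norm x * \<bar>sgn x \<bullet> u\<bar>" by (cases "x = 0") (simp_all add: sgn_div_norm abs_mult)
      then have "\<bar>sgn x \<bullet> u\<bar> = (1 - norm x) * \<bar>sgn x \<bullet> u\<bar> + \<bar>x \<bullet> u\<bar>" by (simp add: algebra_simps)
      then have "ennreal \<bar>sgn x \<bullet> u\<bar> = ennreal (1 - norm x) * ennreal \<bar>sgn x \<bullet> u\<bar> + ennreal \<bar>x \<bullet> u\<bar>"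
        using True by (subst ennreal_mult'[symmetric], simp, subst ennreal_plus[symmetric]) auto
      then show ?thesis using True by simp
    qed simp
  qed
  also have "\<dots> = (\<integral>\<^sup>+x. ennreal (1 - norm x) * indicator (ball 0 1) x * ennreal \<bar>sgn x \<bullet> u\<bar> \<partial>lborel)
      + (\<integral>\<^sup>+x. indicator (ball 0 1) x * ennreal \<bar>x \<bullet> u\<bar> \<partial>lborel)"
    by (rule nn_integral_add) measurable
  also have "(\<integral>\<^sup>+x. indicator (ball 0 1) x * ennreal \<bar>x \<bullet> u\<bar> \<partial>lborel) = ennreal (pi / 2 * norm u)"
    using False by (rule nn_integral_ball_abs_inner)
  also have "(\<integral>\<^sup>+x. ennreal (1 - norm x) * indicator (ball 0 1) x * ennreal \<bar>sgn x \<bullet> u\<bar> \<partial>lborel)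
    = (\<integral>\<^sup>+x. (\<integral>\<^sup>+\<tau>. indicator {0..1} \<tau> * indicator (ball 0 \<tau>) x * ennreal \<bar>sgn x \<bullet> u\<bar> \<partial>lborel) \<partial>lborel)"
    by (rule nn_integral_cong, simp only: ennreal_one_minus_norm, rule nn_integral_multc[symmetric]) (simp only: ind, measurable)
  also have "\<dots> = (\<integral>\<^sup>+\<tau>. (\<integral>\<^sup>+x. indicator {0..1} \<tau> * indicator (ball 0 \<tau>) x * ennreal \<bar>sgn x \<bullet> u\<bar> \<partial>lborel) \<partial>lborel)"
    unfolding ind by (rule lborel_pair.Fubini') measurable
  also have "\<dots> = (\<integral>\<^sup>+\<tau>. (ennreal (\<tau> ^ 3) * indicator {0..1} \<tau>) * S \<partial>lborel)"
  proof (rule nn_integral_cong)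
    fix \<tau> :: real
    have "(\<integral>\<^sup>+x. indicator {0..1} \<tau> * indicator (ball 0 \<tau>) x * ennreal \<bar>sgn x \<bullet> u\<bar> \<partial>lborel)
      = indicator {0..1} \<tau> * (\<integral>\<^sup>+x. indicator (ball 0 \<tau>) x * ennreal \<bar>sgn x \<bullet> u\<bar> \<partial>lborel)"
      unfolding mult.assoc by (rule nn_integral_cmult) measurable
    also have "\<dots> = (ennreal (\<tau> ^ 3) * indicator {0..1} \<tau>) * S"
    proof -
      consider "\<tau> > 0" | "\<tau> = 0" | "\<tau> < 0" by linarith
      then show ?thesis
      proof cases
        case 1
        then show ?thesis unfolding scale[OF 1] by (simp add: mult_ac)
      qed (simp_all add: indicator_def)
    qed
    finally show "(\<integral>\<^sup>+x. indicator {0..1} \<tau> * indicator (ball 0 \<tau>) x * ennreal \<bar>sgn x \<bullet> u\<bar> \<partial>lborel) = (ennreal (\<tau> ^ 3) * indicator {0..1} \<tau>) * S" .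
  qed
  also have "\<dots> = (\<integral>\<^sup>+\<tau>. ennreal (\<tau> ^ 3) * indicator {0..1} \<tau> \<partial>lborel) * S"
    by (rule nn_integral_multc) auto
  also have "(\<integral>\<^sup>+\<tau>. ennreal (\<tau> ^ 3) * indicator {0..1} \<tau> \<partial>lborel) = ennreal (1 ^ 4 / 4 - 0 ^ 4 / 4)"
    by (rule nn_integral_FTC_Icc) (auto intro!: derivative_eq_intros)
  finally have eq: "S = ennreal (1 / 4) * S + ennreal (pi / 2 * norm u)" by simp
  \<comment> \<open>Finiteness of \<open>S\<close> is what allows the equation to be solved for
    it.\<close>
  have "S \<le> (\<integral>\<^sup>+x. ennreal (norm u) * indicator (ball 0 1) x \<partial>(lborel :: (real^3) measure))"
    unfolding S_def
  proof (intro nn_integral_mono)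
    fix x :: "real^3"
    have "\<bar>sgn x \<bullet> u\<bar> \<le> norm (sgn x) * norm u" by (rule Cauchy_Schwarz_ineq2)
    also have "\<dots> \<le> norm u" by (simp add: norm_sgn)
    finally show "indicator (ball 0 1) x * ennreal \<bar>sgn x \<bullet> u\<bar> \<le> ennreal (norm u) * indicator (ball 0 1) x"
      by (auto simp: indicator_def intro: ennreal_leI)
  qed
  also have "\<dots> < \<infinity>" by (simp add: nn_integral_cmult_indicator emeasure_ball ennreal_mult_less_top)
  finally obtain s where s: "S = ennreal s" "s \<ge> 0" by (cases S) auto
  have "ennreal s = ennreal (1 / 4 * s + pi / 2 * norm u)"
    using eq s by (simp only: ennreal_mult'[symmetric] ennreal_plus mult_nonneg_nonneg norm_ge_zero pi_ge_zero
        divide_nonneg_nonneg zero_le_numeral zero_le_one)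
  then have "s = 1 / 4 * s + pi / 2 * norm u" using s(2) by (subst (asm) ennreal_inj) auto
  then have "s = 2 * pi / 3 * norm u" by simp
  then show ?thesis using s by (simp add: S_def)
qed simp

section \<open>The linking number of a circle and a curve\<close>

text \<open>
  A vector potential of the field \<open>v / norm v ^ 3\<close> whose singularity is the ray spanned by \<open>- n\<close>
  (the Dirac monopole).
\<close>

definition monopole :: "real^3 \<Rightarrow> real^3 \<Rightarrow> real^3 \<Rightarrow> real" where
  "monopole n v y = (cross3 n v \<bullet> y) / (norm v * (norm v + n \<bullet> v))"

text \<open>The derivative with respect to \<open>v\<close> in the direction \<open>z\<close>, by
  the quotient rule; \<open>y\<close> stays fixed.\<close>

definition monopole_deriv :: "real^3 \<Rightarrow> real^3 \<Rightarrow> real^3 \<Rightarrow> real^3 \<Rightarrow> real" where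
  "monopole_deriv n v z y = (cross3 n z \<bullet> y) / (norm v * (norm v + n \<bullet> v))
     - (cross3 n v \<bullet> y) * (2 * (v \<bullet> z) + (v \<bullet> z) * (n \<bullet> v) / norm v + norm v * (n \<bullet> z))
       / (norm v * (norm v + n \<bullet> v))\<^sup>2"

lemma has_real_derivative_inner:
  fixes f g :: "real \<Rightarrow> 'a::real_inner"
  assumes "(f has_vector_derivative f') (at t within S)" "(g has_vector_derivative g') (at t within S)"
  shows "((\<lambda>t. f t \<bullet> g t) has_real_derivative (f t \<bullet> g' + f' \<bullet> g t)) (at t within S)"
  using has_derivative_inner[OF assms[unfolded has_vector_derivative_def]]
  by (simp add: has_field_derivative_def algebra_simps inner_commute)
     (erule has_derivative_eq_rhs, simp add: fun_eq_iff algebra_simps inner_commute)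

lemma has_real_derivative_norm:
  fixes v :: "real \<Rightarrow> 'a::real_inner"
  assumes v: "(v has_vector_derivative v') (at t within S)" and "v t \<noteq> 0"
  shows "((\<lambda>t. norm (v t)) has_real_derivative (v t \<bullet> v') / norm (v t)) (at t within S)"
proof -
  have "v t \<bullet> v t > 0" using assms(2) by simp
  from DERIV_chain2[OF DERIV_real_sqrt[OF this] has_real_derivative_inner[OF v v]]
  have "((\<lambda>t. sqrt (v t \<bullet> v t)) has_real_derivative inverse (sqrt (v t \<bullet> v t)) / 2 * (v t \<bullet> v' + v' \<bullet> v t)) (at t within S)" .
  then show ?thesis by (simp add: norm_eq_sqrt_inner[symmetric] inner_commute[of v'] field_simps)
qed

lemma has_real_derivative_monopole:
  assumes v: "(v has_vector_derivative v') (at t within S)"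
    and nz: "v t \<noteq> 0" "norm (v t) + n \<bullet> v t \<noteq> 0"
  shows "((\<lambda>t. monopole n (v t) y) has_real_derivative monopole_deriv n (v t) v' y) (at t within S)"
proof -
  have lin: "((\<lambda>t. n \<bullet> v t) has_real_derivative n \<bullet> v') (at t within S)" for n
    using has_real_derivative_inner[OF has_vector_derivative_const v, of n] by simp
  have cr: "cross3 n z \<bullet> y = cross3 y n \<bullet> z" for z
    by (simp add: cross3_simps)
  have num: "((\<lambda>t. cross3 n (v t) \<bullet> y) has_real_derivative cross3 n v' \<bullet> y) (at t within S)"
    unfolding cr by (rule lin)
  have den: "((\<lambda>t. norm (v t) * (norm (v t) + n \<bullet> v t)) has_real_derivative
      (v t \<bullet> v') / norm (v t) * (norm (v t) + n \<bullet> v t) + ((v t \<bullet> v') / norm (v t) + n \<bullet> v') * norm (v t)) (at t within S)"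
    by (rule DERIV_mult[OF has_real_derivative_norm[OF v nz(1)] DERIV_add[OF has_real_derivative_norm[OF v nz(1)] lin]])
  have den_eq: "(v t \<bullet> v') / norm (v t) * (norm (v t) + n \<bullet> v t) + ((v t \<bullet> v') / norm (v t) + n \<bullet> v') * norm (v t)
      = 2 * (v t \<bullet> v') + (v t \<bullet> v') * (n \<bullet> v t) / norm (v t) + norm (v t) * (n \<bullet> v')"
    using nz(1) by (simp add: field_simps)
  have "norm (v t) * (norm (v t) + n \<bullet> v t) \<noteq> 0" using nz by simp
  from DERIV_divide[OF num den this] show ?thesis
    unfolding monopole_def monopole_deriv_def den_eq using nz
    by (simp add: diff_divide_distrib power2_eq_square)
qed

text \<open>The left-hand side is the exterior derivative of the 1-form \<open>monopole n v\<close>,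
  evaluated on \<open>y\<close> and \<open>x\<close>. All terms that contain \<open>n\<close>
  cancel, so the singular ray can be chosen differently on different parts of a curve without
  changing the Gauss integrand.\<close>

lemma curl_monopole:
  assumes "norm n = 1" "v \<noteq> 0" "norm v + n \<bullet> v \<noteq> 0"
  shows "monopole_deriv n v y x - monopole_deriv n v x y = (v \<bullet> cross3 y x) / norm v ^ 3"
proof -
  define \<rho> m D where "\<rho> = norm v" and "m = n \<bullet> v" and "D = \<rho> * (\<rho> + m)"
  have nn: "n \<bullet> n = 1" and vv: "v \<bullet> v = \<rho>\<^sup>2" using assms(1) by (auto simp: norm_eq_1 \<rho>_def power2_norm_eq_inner)
  have nz: "\<rho> \<noteq> 0" "\<rho> + m \<noteq> 0" "D \<noteq> 0" using assms by (auto simp: \<rho>_def m_def D_def)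
  \<comment> \<open>\<open>Q\<close> is the gradient of the denominator \<open>D\<close>, and
    \<open>P \<bullet> y\<close> is the numerator of the potential; antisymmetrizing the quotient
    rule produces \<open>cross3 P Q \<bullet> W\<close>.\<close>
  define P Q W where "P = cross3 n v" and "Q = (2 + m / \<rho>) *\<^sub>R v + \<rho> *\<^sub>R n" and "W = cross3 y x"
  have PQ: "cross3 P Q = (2 + m / \<rho>) *\<^sub>R (m *\<^sub>R v - \<rho>\<^sup>2 *\<^sub>R n) + \<rho> *\<^sub>R (v - m *\<^sub>R n)"
  proof -
    have "cross3 P z = (z \<bullet> n) *\<^sub>R v - (z \<bullet> v) *\<^sub>R n" for z
      using Lagrange[of z n v] cross_skew[of P z] by (simp add: P_def)
    then show ?thesis
      by (simp add: Q_def cross_add_right cross_mult_right nn vv m_def inner_commute)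
  qed
  have Q: "Q \<bullet> z = 2 * (v \<bullet> z) + (v \<bullet> z) * m / \<rho> + \<rho> * (n \<bullet> z)" for z
    by (simp add: Q_def inner_add_left algebra_simps)
  have "monopole_deriv n v y x - monopole_deriv n v x y
      = (cross3 n y \<bullet> x) / D - (cross3 n x \<bullet> y) / D + ((P \<bullet> y) * (Q \<bullet> x) - (P \<bullet> x) * (Q \<bullet> y)) / D\<^sup>2"
    unfolding monopole_deriv_def Q P_def[symmetric] \<rho>_def[symmetric] m_def[symmetric] D_def[symmetric]
    by (simp add: diff_divide_distrib)
  also have "(P \<bullet> y) * (Q \<bullet> x) - (P \<bullet> x) * (Q \<bullet> y) = cross3 P Q \<bullet> W"
    unfolding W_def dot_cross by simp
  also have "\<dots> = (2 + m / \<rho>) * (m * (v \<bullet> W) - \<rho>\<^sup>2 * (n \<bullet> W)) + \<rho> * ((v \<bullet> W) - m * (n \<bullet> W))"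
    unfolding PQ by (simp add: inner_add_left inner_diff_left)
  also have "\<dots> = ((2 + m / \<rho>) * m + \<rho>) * (v \<bullet> W) - (2 * D) * (n \<bullet> W)"
  proof -
    have "(2 + m / \<rho>) * (m * p - \<rho>\<^sup>2 * q) + \<rho> * (p - m * q) = ((2 + m / \<rho>) * m + \<rho>) * p - (2 * D) * q" for p q
      unfolding D_def using nz(1) by (simp add: field_simps power2_eq_square)
    then show ?thesis .
  qed
  also have "(2 + m / \<rho>) * m + \<rho> = (\<rho> + m)\<^sup>2 / \<rho>" using nz(1) by (simp add: field_simps power2_eq_square)
  also have "(cross3 n y \<bullet> x) / D - (cross3 n x \<bullet> y) / D = 2 * (n \<bullet> W) / D"
    by (simp add: W_def cross3_simps diff_divide_distrib add_divide_distrib)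
  also have "2 * (n \<bullet> W) / D + ((\<rho> + m)\<^sup>2 / \<rho> * (v \<bullet> W) - 2 * D * (n \<bullet> W)) / D\<^sup>2 = (v \<bullet> W) / \<rho> ^ 3"
  proof -
    have "(\<rho> + m)\<^sup>2 / \<rho> / D\<^sup>2 = 1 / \<rho> ^ 3"
      using nz(1,2) by (simp add: D_def power_mult_distrib power2_eq_square power3_eq_cube)
    moreover have "2 * D * q / D\<^sup>2 = 2 * q / D" for q using nz(3) by (simp add: power2_eq_square)
    moreover have "(\<rho> + m)\<^sup>2 / \<rho> * (v \<bullet> W) / D\<^sup>2 = (\<rho> + m)\<^sup>2 / \<rho> / D\<^sup>2 * (v \<bullet> W)" by simp
    ultimately show ?thesis by (simp only: diff_divide_distrib) simp
  qed
  finally show ?thesis by (simp add: W_def \<rho>_def)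
qed

definition gauss_integrand :: "(real \<Rightarrow> real^3) \<Rightarrow> (real \<Rightarrow> real^3) \<Rightarrow> (real \<Rightarrow> real^3) \<Rightarrow> (real \<Rightarrow> real^3) \<Rightarrow> real \<Rightarrow> real \<Rightarrow> real" where
  "gauss_integrand \<alpha> \<alpha>' \<beta> \<beta>' s t = (\<alpha> s - \<beta> t) \<bullet> cross3 (\<alpha>' s) (\<beta>' t) / norm (\<alpha> s - \<beta> t) ^ 3"

text \<open>By \<open>curl_monopole\<close> the integrand is \<open>A + B\<close>, where
  \<open>A\<close> is the \<open>t\<close>-derivative of the potential paired with the fixed vector
  \<open>\<alpha>' s\<close>, and \<open>B\<close> its \<open>s\<close>-derivative paired with the
  fixed vector \<open>\<beta>' t\<close>. Around the closed curve \<alpha> the term \<open>B\<close>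
  integrates to 0, and \<open>A\<close> is integrated in \<open>t\<close> after exchanging the
  integrals. The last hypothesis keeps the chords off the singular ray.\<close>

lemma integral_gauss_integrand:
  fixes \<alpha> \<alpha>' \<beta> \<beta>' :: "real \<Rightarrow> real^3"
  assumes n: "norm n = 1" and ab: "a \<le> b"
    and \<alpha>: "\<And>s. (\<alpha> has_vector_derivative \<alpha>' s) (at s)" "continuous_on UNIV \<alpha>'" "\<alpha> 1 = \<alpha> 0"
    and \<beta>: "\<And>t. (\<beta> has_vector_derivative \<beta>' t) (at t)" "continuous_on UNIV \<beta>'"
    and nz: "\<And>s t. s \<in> {0..1} \<Longrightarrow> t \<in> {a..b} \<Longrightarrow> \<alpha> s - \<beta> t \<noteq> 0 \<and> norm (\<alpha> s - \<beta> t) + n \<bullet> (\<alpha> s - \<beta> t) \<noteq> 0"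
  shows "integral {a..b} (\<lambda>t. integral {0..1} (\<lambda>s. gauss_integrand \<alpha> \<alpha>' \<beta> \<beta>' s t))
    = integral {0..1} (\<lambda>s. monopole n (\<alpha> s - \<beta> b) (\<alpha>' s)) - integral {0..1} (\<lambda>s. monopole n (\<alpha> s - \<beta> a) (\<alpha>' s))"
proof -
  define R where "R = {0..1::real} \<times> {a..b}"
  have cont1: "continuous_on S \<alpha>" "continuous_on S \<beta>" for S
    using \<alpha>(1) \<beta>(1) by (meson continuous_at_imp_continuous_on has_vector_derivative_continuous)+
  have cont: "continuous_on S (\<lambda>z. \<alpha> (f z))" "continuous_on S (\<lambda>z. \<beta> (f z))"
     "continuous_on S (\<lambda>z. \<alpha>' (f z))" "continuous_on S (\<lambda>z. \<beta>' (f z))"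
    if "continuous_on S f" for S and f :: "'z::topological_space \<Rightarrow> real"
    using that cont1[of UNIV] \<alpha>(2) \<beta>(2) by (auto intro: continuous_on_compose2)
  define A where "A s t = - monopole_deriv n (\<alpha> s - \<beta> t) (\<beta>' t) (\<alpha>' s)" for s t
  define B where "B s t = monopole_deriv n (\<alpha> s - \<beta> t) (\<alpha>' s) (\<beta>' t)" for s t
  have contA: "continuous_on R (\<lambda>(s, t). A s t)"
    unfolding A_def monopole_deriv_def split_def
    using nz by (intro continuous_intros cont continuous_on_cross) (auto simp: R_def)
  have contB: "continuous_on R (\<lambda>(s, t). B s t)"
    unfolding B_def monopole_deriv_def split_def
    using nz by (intro continuous_intros cont continuous_on_cross) (auto simp: R_def)
  have slice_t: "continuous_on {0..1} (\<lambda>s. C s t)" if "continuous_on R (\<lambda>(s, t). C s t)" "t \<in> {a..b}" for C :: "real \<Rightarrow> real \<Rightarrow> real" and t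
  proof -
    have "continuous_on {0..1} (\<lambda>s. (s, t))" by (intro continuous_intros)
    moreover have "(\<lambda>s. (s, t)) ` {0..1} \<subseteq> R" using that(2) by (auto simp: R_def)
    ultimately show ?thesis using continuous_on_compose2[OF that(1), of "{0..1}" "\<lambda>s. (s, t)"] by simp
  qed
  have split: "gauss_integrand \<alpha> \<alpha>' \<beta> \<beta>' s t = A s t + B s t" if "s \<in> {0..1}" "t \<in> {a..b}" for s t
    using curl_monopole[OF n, of "\<alpha> s - \<beta> t" "\<alpha>' s" "\<beta>' t"] nz[OF that] by (simp add: A_def B_def gauss_integrand_def)
  have derA: "((\<lambda>t. monopole n (\<alpha> s - \<beta> t) (\<alpha>' s)) has_vector_derivative A s t) (at t within {a..b})"
    if "s \<in> {0..1}" "t \<in> {a..b}" for s t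
  proof -
    have "((\<lambda>t. \<alpha> s - \<beta> t) has_vector_derivative - \<beta>' t) (at t within {a..b})"
      using has_vector_derivative_diff[OF has_vector_derivative_const has_vector_derivative_at_within[OF \<beta>(1)], of "\<alpha> s"] by simp
    from has_real_derivative_monopole[OF this, of n "\<alpha>' s"] nz[OF that]
    have "((\<lambda>t. monopole n (\<alpha> s - \<beta> t) (\<alpha>' s)) has_real_derivative monopole_deriv n (\<alpha> s - \<beta> t) (- \<beta>' t) (\<alpha>' s)) (at t within {a..b})"
      by simp
    moreover have "monopole_deriv n (\<alpha> s - \<beta> t) (- \<beta>' t) (\<alpha>' s) = A s t"
      by (simp add: A_def monopole_deriv_def algebra_simps add_divide_distrib diff_divide_distrib)
    ultimately show ?thesis by (simp add: has_real_derivative_iff_has_vector_derivative)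
  qed
  have derB: "((\<lambda>s. monopole n (\<alpha> s - \<beta> t) (\<beta>' t)) has_vector_derivative B s t) (at s within {0..1})"
    if "s \<in> {0..1}" "t \<in> {a..b}" for s t
  proof -
    have "((\<lambda>s. \<alpha> s - \<beta> t) has_vector_derivative \<alpha>' s) (at s within {0..1})"
      using has_vector_derivative_diff[OF has_vector_derivative_at_within[OF \<alpha>(1)] has_vector_derivative_const[of "\<beta> t"]] by simp
    from has_real_derivative_monopole[OF this, of n "\<beta>' t"] nz[OF that]
    show ?thesis by (simp add: B_def has_real_derivative_iff_has_vector_derivative)
  qed
  have intB: "integral {0..1} (\<lambda>s. B s t) = 0" if "t \<in> {a..b}" for t
    using integral_unique[OF fundamental_theorem_of_calculus[of 0 1 "\<lambda>s. monopole n (\<alpha> s - \<beta> t) (\<beta>' t)" "\<lambda>s. B s t"]]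
      derB[OF _ that] \<alpha>(3) by simp
  have intA: "integral {a..b} (\<lambda>t. A s t) = monopole n (\<alpha> s - \<beta> b) (\<alpha>' s) - monopole n (\<alpha> s - \<beta> a) (\<alpha>' s)" if "s \<in> {0..1}" for s
    by (rule integral_unique, rule fundamental_theorem_of_calculus[OF ab derA[OF that]])
  have "integral {0..1} (\<lambda>s. gauss_integrand \<alpha> \<alpha>' \<beta> \<beta>' s t) = integral {0..1} (\<lambda>s. A s t)" if "t \<in> {a..b}" for t
  proof -
    have "integral {0..1} (\<lambda>s. gauss_integrand \<alpha> \<alpha>' \<beta> \<beta>' s t) = integral {0..1} (\<lambda>s. A s t + B s t)"
      using split that by (intro Henstock_Kurzweil_Integration.integral_cong) auto
    also have "\<dots> = integral {0..1} (\<lambda>s. A s t) + integral {0..1} (\<lambda>s. B s t)"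
      using slice_t[OF contA that] slice_t[OF contB that]
      by (intro Henstock_Kurzweil_Integration.integral_add integrable_continuous_real)
    finally show ?thesis using intB[OF that] by simp
  qed
  then have "integral {a..b} (\<lambda>t. integral {0..1} (\<lambda>s. gauss_integrand \<alpha> \<alpha>' \<beta> \<beta>' s t))
      = integral {a..b} (\<lambda>t. integral {0..1} (\<lambda>s. A s t))"
    by (rule Henstock_Kurzweil_Integration.integral_cong)
  also have "\<dots> = integral {0..1} (\<lambda>s. integral {a..b} (\<lambda>t. A s t))"
    using integral_swap_continuous[of 0 a 1 b A] contA by (simp add: R_def cbox_Pair_eq)
  also have "\<dots> = integral {0..1} (\<lambda>s. monopole n (\<alpha> s - \<beta> b) (\<alpha>' s) - monopole n (\<alpha> s - \<beta> a) (\<alpha>' s))"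
    using intA by (intro Henstock_Kurzweil_Integration.integral_cong) auto
  also have "\<dots> = integral {0..1} (\<lambda>s. monopole n (\<alpha> s - \<beta> b) (\<alpha>' s)) - integral {0..1} (\<lambda>s. monopole n (\<alpha> s - \<beta> a) (\<alpha>' s))"
  proof (intro Henstock_Kurzweil_Integration.integral_diff integrable_continuous_real)
    show "continuous_on {0..1} (\<lambda>s. monopole n (\<alpha> s - \<beta> b) (\<alpha>' s))" "continuous_on {0..1} (\<lambda>s. monopole n (\<alpha> s - \<beta> a) (\<alpha>' s))"
      unfolding monopole_def using nz ab by (intro continuous_intros cont continuous_on_cross; fastforce)+
  qed
  finally show ?thesis .
qed

section \<open>Parametrized circles and the winding number in their plane\<close>

lemma frame_vector:
  assumes "norm n = 1"
  shows "norm (frame_vector n) = 1" "n \<bullet> frame_vector n = 0"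
proof -
  have "norm (frame_vector n) = 1 \<and> n \<bullet> frame_vector n = 0"
  proof (cases "cross3 (axis 3 1) n = 0")
    case True
    then have "n $ 1 = 0" by (simp add: cross3_def axis_def vec_eq_iff forall_3)
    then show ?thesis using True by (simp add: frame_vector_def inner_axis)
  next
    case False
    then show ?thesis by (simp add: frame_vector_def norm_sgn sgn_div_norm dot_cross_self)
  qed
  then show "norm (frame_vector n) = 1" "n \<bullet> frame_vector n = 0" by auto
qed

definition circle_velocity :: "circle \<Rightarrow> real \<Rightarrow> real^3" where
  "circle_velocity = (\<lambda>(c, r, n) t. (- 2 * pi * r * sin (2 * pi * t)) *\<^sub>R frame_vector n
     + (2 * pi * r * cos (2 * pi * t)) *\<^sub>R cross3 n (frame_vector n))"

lemma circle_path_has_vector_derivative: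
  "(circle_path \<gamma> has_vector_derivative circle_velocity \<gamma> t) (at t)"
proof -
  obtain c r n where \<gamma>: "\<gamma> = (c, r, n)" by (cases \<gamma>)
  have d: "((\<lambda>t. r * cos (2 * pi * t)) has_vector_derivative - 2 * pi * r * sin (2 * pi * t)) (at t)"
     "((\<lambda>t. r * sin (2 * pi * t)) has_vector_derivative 2 * pi * r * cos (2 * pi * t)) (at t)"
    unfolding has_real_derivative_iff_has_vector_derivative[symmetric]
    by (auto intro!: derivative_eq_intros)
  show ?thesis unfolding \<gamma> circle_path_def circle_velocity_def prod.case
    using has_vector_derivative_add[OF has_vector_derivative_add[OF has_vector_derivative_const[of c]
       has_vector_derivative_scaleR[OF d(1)[folded has_real_derivative_iff_has_vector_derivative] has_vector_derivative_const[of "frame_vector n"]]]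
       has_vector_derivative_scaleR[OF d(2)[folded has_real_derivative_iff_has_vector_derivative] has_vector_derivative_const[of "cross3 n (frame_vector n)"]]]
    by simp
qed

lemma continuous_on_circle_velocity: "continuous_on S (circle_velocity \<gamma>)"
  by (cases \<gamma>) (auto simp: circle_velocity_def intro!: continuous_intros)

lemma circle_path_closed: "circle_path \<gamma> 1 = circle_path \<gamma> 0"
  by (cases \<gamma>) (simp add: circle_path_def)

lemma circle_path_in_plane:
  assumes "norm n = 1"
  shows "n \<bullet> (circle_path (c, r, n) s - c) = 0"
  using frame_vector[OF assms] by (simp add: circle_path_def inner_add_right dot_cross_self)

text \<open>For \<open>v\<close> orthogonal to \<open>n\<close>, the potential is the angular form
  of the plane, (n \<times> v) \<bullet> dy / |v|^2. Its integral is 2 pi times the winding number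
  of the circle about \<open>x\<close>, which is 1 inside and 0 outside.\<close>

lemma integral_monopole_circle:
  assumes n: "norm n = 1" and r: "r > 0" and x: "n \<bullet> (x - c) = 0" "dist c x \<noteq> r"
  shows "integral {0..1} (\<lambda>s. monopole n (circle_path (c, r, n) s - x) (circle_velocity (c, r, n) s))
    = 2 * pi * indicator (circle_disk (c, r, n)) x"
    and "circle_path (c, r, n) s \<noteq> x"
proof -
  define f where "f = frame_vector n"
  define g where "g = cross3 n f"
  have f: "norm f = 1" "n \<bullet> f = 0" using frame_vector[OF n] by (auto simp: f_def)
  have inn: "n \<bullet> n = 1" "f \<bullet> f = 1" using n f by (auto simp: norm_eq_1)
  have ng: "cross3 n g = - f" using Lagrange[of n n f] inn f by (simp add: g_def)
  have gg: "g \<bullet> g = 1" unfolding g_def dot_cross using inn f by (simp add: inner_commute)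
  have fg: "f \<bullet> g = 0" "g \<bullet> f = 0" by (simp_all add: g_def dot_cross_self)
  have ngz: "n \<bullet> g = 0" by (simp add: g_def dot_cross_self)
  define \<xi> \<eta> where "\<xi> = (x - c) \<bullet> f" and "\<eta> = (x - c) \<bullet> g"
  \<comment> \<open>Writing \<open>n\<close> as \<open>cross3 f g\<close> and applying the cross
    product with \<open>n\<close> twice resolves \<open>x - c\<close> into its components along
    \<open>f\<close> and \<open>g\<close>.\<close>
  have x_eq: "x - c = \<xi> *\<^sub>R f + \<eta> *\<^sub>R g"
  proof -
    have "cross3 n (cross3 n (x - c)) = - (x - c)" using Lagrange[of n n "x - c"] x(1) inn by simp
    have "cross3 f g = n" using Lagrange[of f n f] inn f by (simp add: g_def inner_commute)
    then have "cross3 (x - c) n = ((x - c) \<bullet> g) *\<^sub>R f - ((x - c) \<bullet> f) *\<^sub>R g"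
      using Lagrange[of "x - c" f g] by simp
    then have "cross3 n (x - c) = \<xi> *\<^sub>R g - \<eta> *\<^sub>R f"
      unfolding cross_skew[of n "x - c"] by (simp add: \<xi>_def \<eta>_def)
    then have "cross3 n (cross3 n (x - c)) = - (\<eta> *\<^sub>R g + \<xi> *\<^sub>R f)"
      by (simp add: Cross3.right_diff_distrib cross_mult_right ng g_def[symmetric])
    have "- (x - c) = - (\<eta> *\<^sub>R g + \<xi> *\<^sub>R f)"
      using \<open>cross3 n (cross3 n (x - c)) = - (x - c)\<close> \<open>cross3 n (cross3 n (x - c)) = - (\<eta> *\<^sub>R g + \<xi> *\<^sub>R f)\<close> by metis
    then show ?thesis unfolding neg_equal_iff_equal by (simp only: add.commute)
  qed
  define w where "w = Complex \<xi> \<eta>"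
  have norm_w: "cmod w = dist c x"
  proof -
    have "(norm (x - c))\<^sup>2 = \<xi>\<^sup>2 + \<eta>\<^sup>2"
      unfolding power2_norm_eq_inner x_eq
      by (simp add: inner_add_left inner_add_right inn gg fg power2_eq_square)
    then show ?thesis
      by (simp add: w_def cmod_def dist_norm norm_minus_commute real_sqrt_unique)
  qed
  define Z where "Z s = circlepath 0 r s - w" for s
  have Re_Z: "Re (Z s) = r * cos (2 * pi * s) - \<xi>" and Im_Z: "Im (Z s) = r * sin (2 * pi * s) - \<eta>" for s
  proof -
    have "circlepath 0 r s = complex_of_real r * cis (2 * pi * s)" by (simp add: circlepath cis_conv_exp mult_ac)
    then show "Re (Z s) = r * cos (2 * pi * s) - \<xi>" "Im (Z s) = r * sin (2 * pi * s) - \<eta>"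
      by (simp_all add: Z_def w_def)
  qed
  have v: "circle_path (c, r, n) s - x = Re (Z s) *\<^sub>R f + Im (Z s) *\<^sub>R g" for s
  proof -
    have "circle_path (c, r, n) s - x = (r * cos (2 * pi * s)) *\<^sub>R f + (r * sin (2 * pi * s)) *\<^sub>R g - (x - c)"
      by (simp add: circle_path_def f_def[symmetric] g_def[symmetric])
    then show ?thesis unfolding x_eq Re_Z Im_Z by (simp add: algebra_simps)
  qed
  have norm_v: "norm (circle_path (c, r, n) s - x) = cmod (Z s)" for s
  proof -
    have "(norm (circle_path (c, r, n) s - x))\<^sup>2 = (Re (Z s))\<^sup>2 + (Im (Z s))\<^sup>2"
      unfolding power2_norm_eq_inner v by (simp add: inner_add_left inner_add_right inn gg fg power2_eq_square)
    then show ?thesis by (simp add: cmod_def real_sqrt_unique)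
  qed
  have w_notin: "w \<notin> path_image (circlepath 0 r)"
    using x(2) norm_w r by (simp add: path_image_circlepath_nonneg)
  \<comment> \<open>In complex notation, with \<open>f\<close> and \<open>g\<close> in the roles of
    1 and i, the angular form is the imaginary part of dz/z.\<close>
  have mono: "monopole n (circle_path (c, r, n) s - x) (circle_velocity (c, r, n) s)
     = Im (1 / (circlepath 0 r s - w) * vector_derivative (circlepath 0 r) (at s within {0..1}))" if s: "s \<in> {0..1}" for s
  proof -
    have nv: "n \<bullet> (circle_path (c, r, n) s - x) = 0" unfolding v by (simp add: inner_add_right f ngz)
    have cr: "cross3 n (circle_path (c, r, n) s - x) = Re (Z s) *\<^sub>R g - Im (Z s) *\<^sub>R f"
      unfolding v by (simp add: cross_add_right cross_mult_right ng g_def[symmetric])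
    have "cross3 n (circle_path (c, r, n) s - x) \<bullet> circle_velocity (c, r, n) s
      = 2 * pi * r * (Re (Z s) * cos (2 * pi * s) + Im (Z s) * sin (2 * pi * s))"
      unfolding cr circle_velocity_def prod.case f_def[symmetric] g_def[symmetric]
      by (simp add: inner_add_right inner_diff_left inn gg fg algebra_simps)
    then have L: "monopole n (circle_path (c, r, n) s - x) (circle_velocity (c, r, n) s)
      = 2 * pi * r * (Re (Z s) * cos (2 * pi * s) + Im (Z s) * sin (2 * pi * s)) / (cmod (Z s))\<^sup>2"
      by (simp add: monopole_def nv norm_v power2_eq_square)
    have d: "vector_derivative (circlepath 0 r) (at s within {0..1}) = Complex (- 2 * pi * r * sin (2 * pi * s)) (2 * pi * r * cos (2 * pi * s))"
      using s by (simp add: vector_derivative_circlepath01 complex_eq_iff Re_exp Im_exp mult.commute mult.left_commute)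
    have "Im (1 / Z s * Complex (- 2 * pi * r * sin (2 * pi * s)) (2 * pi * r * cos (2 * pi * s)))
      = 2 * pi * r * (Re (Z s) * cos (2 * pi * s) + Im (Z s) * sin (2 * pi * s)) / (cmod (Z s))\<^sup>2"
      by (simp add: Re_divide Im_divide cmod_power2 algebra_simps add_divide_distrib)
    then show ?thesis unfolding L d Z_def by simp
  qed
  have "((\<lambda>w'. 1 / (w' - w)) has_contour_integral (2 * pi * \<i> * winding_number (circlepath 0 r) w)) (circlepath 0 r)"
    by (rule has_contour_integral_winding_number) (use w_notin in auto)
  then have "((\<lambda>s. 1 / (circlepath 0 r s - w) * vector_derivative (circlepath 0 r) (at s within {0..1}))
      has_integral (2 * pi * \<i> * winding_number (circlepath 0 r) w)) {0..1}"
    by (simp add: has_contour_integral_def)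
  from has_integral_linear[OF this bounded_linear_Im]
  have "((\<lambda>s. Im (1 / (circlepath 0 r s - w) * vector_derivative (circlepath 0 r) (at s within {0..1})))
      has_integral Im (2 * pi * \<i> * winding_number (circlepath 0 r) w)) {0..1}" by (simp only: o_def)
  then have "((\<lambda>s. monopole n (circle_path (c, r, n) s - x) (circle_velocity (c, r, n) s))
      has_integral Im (2 * pi * \<i> * winding_number (circlepath 0 r) w)) {0..1}"
    by (rule has_integral_eq[rotated]) (simp add: mono)
  moreover have "winding_number (circlepath 0 r) w = indicator (circle_disk (c, r, n)) x"
  proof (cases "dist c x < r")
    case True
    then show ?thesis using norm_w x by (simp add: winding_number_circlepath circle_disk_def inner_commute)
  next
    case False
    have "winding_number (circlepath 0 r) w = 0"
      by (rule winding_number_zero_outside[of _ "cball 0 r"])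
         (use False x(2) r norm_w in \<open>auto simp: path_image_circlepath_nonneg\<close>)
    then show ?thesis using False x(2) by (simp add: circle_disk_def)
  qed
  ultimately show "integral {0..1} (\<lambda>s. monopole n (circle_path (c, r, n) s - x) (circle_velocity (c, r, n) s))
    = 2 * pi * indicator (circle_disk (c, r, n)) x"
    by (simp add: integral_unique indicator_def)
  have "dist c (circle_path (c, r, n) s) = r"
  proof -
    have "(norm (circle_path (c, r, n) s - c))\<^sup>2 = (r * cos (2 * pi * s))\<^sup>2 + (r * sin (2 * pi * s))\<^sup>2"
      unfolding power2_norm_eq_inner circle_path_def prod.case f_def[symmetric] g_def[symmetric]
      by (simp add: inner_add_left inner_add_right inn gg fg power2_eq_square)
    then have "(norm (circle_path (c, r, n) s - c))\<^sup>2 = r\<^sup>2" by (simp add: power_mult_distrib distrib_left[symmetric])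
    then show ?thesis using r by (simp add: dist_norm norm_minus_commute)
  qed
  then show "circle_path (c, r, n) s \<noteq> x" using x(2) by metis
qed

lemma zero_crossing:
  fixes h :: "real \<Rightarrow> real"
  assumes h: "(h has_real_derivative D) (at x)" "h x = 0" "D \<noteq> 0"
  obtains d where "d > 0" "\<And>t. x - d < t \<Longrightarrow> t < x \<Longrightarrow> sgn (h t) = - sgn D" "\<And>t. x < t \<Longrightarrow> t < x + d \<Longrightarrow> sgn (h t) = sgn D"
proof -
  have pos: "\<exists>d>0. \<forall>t. (x - d < t \<and> t < x \<longrightarrow> g t < 0) \<and> (x < t \<and> t < x + d \<longrightarrow> g t > 0)"
    if g: "(g has_real_derivative E) (at x)" "g x = 0" "E > 0" for g :: "real \<Rightarrow> real" and E
  proof -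
    obtain d1 where d1: "d1 > 0" "\<And>k. 0 < k \<Longrightarrow> k < d1 \<Longrightarrow> g x < g (x + k)"
      using DERIV_pos_inc_right[OF g(1,3)] by blast
    obtain d2 where d2: "d2 > 0" "\<And>k. 0 < k \<Longrightarrow> k < d2 \<Longrightarrow> g (x - k) < g x"
      using DERIV_pos_inc_left[OF g(1,3)] by blast
    show ?thesis
    proof (intro exI[of _ "min d1 d2"] conjI allI impI)
      fix t assume "x - min d1 d2 < t \<and> t < x"
      then show "g t < 0" using d2(2)[of "x - t"] g(2) by auto
    next
      fix t assume "x < t \<and> t < x + min d1 d2"
      then show "g t > 0" using d1(2)[of "t - x"] g(2) by auto
    qed (use d1 d2 in auto)
  qed
  consider "D > 0" | "D < 0" using h(3) by linarith
  then show thesis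
  proof cases
    case 1
    from pos[OF h(1,2) 1] that 1 show thesis by (metis sgn_pos sgn_neg)
  next
    case 2
    have "((\<lambda>t. - h t) has_real_derivative - D) (at x)" using h(1) by (rule DERIV_minus)
    from pos[OF this] h(2) 2 obtain d where "d > 0"
      "\<forall>t. (x - d < t \<and> t < x \<longrightarrow> - h t < 0) \<and> (x < t \<and> t < x + d \<longrightarrow> - h t > 0)" by auto
    with that[of d] 2 show thesis by simp
  qed
qed

text \<open>
  Away from the plane of the circle, the \<open>s\<close>-integral of the Gauss integrand is the derivative of the solid
  angle \<open>\<Phi>\<close> of the disk, computed with the monopole potential whose singular ray points away from the
  disk.  At a crossing of the disk, \<open>\<Phi>\<close> jumps by \<open>4 * pi\<close>.  Counting crossings at an end point of
  an interval with weight 1/2 makes the resulting formula additive, so that it extends from short intervals to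
  all intervals.
\<close>

lemma linking_number_circle:
  fixes \<beta> \<beta>' :: "real \<Rightarrow> real^3"
  assumes n: "norm n = 1" and r: "r > 0"
    and \<beta>: "\<And>t. (\<beta> has_vector_derivative \<beta>' t) (at t)" "continuous_on UNIV \<beta>'" "\<And>t. \<beta> (t + 1) = \<beta> t"
    and transversal: "\<And>t. n \<bullet> (\<beta> t - c) = 0 \<Longrightarrow> n \<bullet> \<beta>' t \<noteq> 0 \<and> dist c (\<beta> t) \<noteq> r"
  shows "finite {t\<in>{0..<1}. n \<bullet> (\<beta> t - c) = 0}"
    and "linking_number (circle_path (c, r, n)) \<beta>
      = (\<Sum>t\<in>{t\<in>{0..<1}. \<beta> t \<in> circle_disk (c, r, n)}. sgn (n \<bullet> \<beta>' t))"
proof -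
  define \<alpha> where "\<alpha> = circle_path (c, r, n)"
  define \<alpha>' where "\<alpha>' = circle_velocity (c, r, n)"
  define h where "h t = n \<bullet> (\<beta> t - c)" for t
  define I where "I t = (indicator (circle_disk (c, r, n)) (\<beta> t) :: real)" for t
  define \<Omega> where "\<Omega> m t = integral {0..1} (\<lambda>s. monopole m (\<alpha> s - \<beta> t) (\<alpha>' s))" for m t
  \<comment> \<open>The inner product of this normal with \<open>\<alpha> s - \<beta> t\<close> is
    |h t|, so no chord meets the singular ray. Where \<open>h t = 0\<close>, the normal is 0 and so
    is \<open>\<Phi> t\<close>.\<close>
  define \<Phi> where "\<Phi> t = \<Omega> (- sgn (h t) *\<^sub>R n) t" for t
  define G where "G a b = integral {a..b} (\<lambda>t. integral {0..1} (\<lambda>s. gauss_integrand \<alpha> \<alpha>' \<beta> \<beta>' s t))" for a b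
  define Z where "Z = {t\<in>{0..1}. h t = 0}"
  define j where "j t = I t * sgn (n \<bullet> \<beta>' t)" for t
  \<comment> \<open>The mean of the indicators of (a, b] and [a, b), each of which is additive under
    subdivision.\<close>
  define w where "w a b t = ((if a < t \<and> t \<le> b then 1 else 0) + (if a \<le> t \<and> t < b then 1 else 0)) / (2::real)" for a b t :: real
  have \<alpha>: "\<And>s. (\<alpha> has_vector_derivative \<alpha>' s) (at s)" "continuous_on UNIV \<alpha>'" "\<alpha> 1 = \<alpha> 0"
    by (simp_all add: \<alpha>_def \<alpha>'_def circle_path_has_vector_derivative continuous_on_circle_velocity circle_path_closed)
  have cont1: "continuous_on UNIV \<alpha>" "continuous_on UNIV \<beta>"
    using \<alpha>(1) \<beta>(1) by (meson continuous_at_imp_continuous_on has_vector_derivative_continuous)+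
  have h_der: "(h has_real_derivative n \<bullet> \<beta>' t) (at t)" for t
  proof -
    have "((\<lambda>t. \<beta> t - c) has_vector_derivative \<beta>' t - 0) (at t)"
      by (intro has_vector_derivative_diff \<beta>(1) has_vector_derivative_const)
    from has_real_derivative_inner[OF has_vector_derivative_const this, of n] show ?thesis
      by (simp add: h_def[abs_def])
  qed
  have n_v: "n \<bullet> (\<alpha> s - \<beta> t) = - h t" for s t
  proof -
    have "\<alpha> s - \<beta> t = (\<alpha> s - c) - (\<beta> t - c)" by simp
    then show ?thesis using circle_path_in_plane[OF n, of c r s] by (simp only: inner_diff_right h_def \<alpha>_def)
  qed
  have on_plane: "\<Omega> n t = 2 * pi * I t" "\<alpha> s \<noteq> \<beta> t" if "h t = 0" for s t
    using integral_monopole_circle[OF n r, of "\<beta> t" c] transversal[of t] that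
    by (simp_all add: \<Omega>_def \<alpha>_def \<alpha>'_def I_def h_def)
  \<comment> \<open>On the plane of the circle the potential is odd in \<open>n\<close>, because its
    denominator reduces to |v|^2 there.\<close>
  have \<Omega>_plane: "\<Omega> (\<sigma> *\<^sub>R n) t = 2 * pi * \<sigma> * I t" if "h t = 0" "\<sigma> \<in> {-1, 1}" for \<sigma> t
  proof -
    have "monopole (\<sigma> *\<^sub>R n) (\<alpha> s - \<beta> t) (\<alpha>' s) = \<sigma> * monopole n (\<alpha> s - \<beta> t) (\<alpha>' s)" for s
      using n_v[of s t] that by (simp add: monopole_def cross_mult_left)
    then have "\<Omega> (\<sigma> *\<^sub>R n) t = \<sigma> * \<Omega> n t" by (simp add: \<Omega>_def)
    then show ?thesis using on_plane(1)[OF that(1)] by simp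
  qed
  have neq: "\<alpha> s \<noteq> \<beta> t" for s t
    using on_plane(2)[of t s] n_v[of s t] by (cases "h t = 0") auto
  have G_diff: "G a b = \<Omega> (\<sigma> *\<^sub>R n) b - \<Omega> (\<sigma> *\<^sub>R n) a"
    if "a \<le> b" "\<sigma> \<in> {-1, 1}" "\<And>t. t \<in> {a..b} \<Longrightarrow> \<sigma> * h t \<le> 0" for a b \<sigma>
    unfolding G_def \<Omega>_def
  proof (rule integral_gauss_integrand[OF _ that(1) \<alpha> \<beta>(1,2)])
    show "norm (\<sigma> *\<^sub>R n) = 1" using that(2) n by auto
    fix s t :: real assume "s \<in> {0..1}" "t \<in> {a..b}"
    then have "(\<sigma> *\<^sub>R n) \<bullet> (\<alpha> s - \<beta> t) \<ge> 0" using that(3)[of t] by (simp add: n_v)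
    moreover have "norm (\<alpha> s - \<beta> t) > 0" using neq[of s t] by simp
    ultimately show "\<alpha> s - \<beta> t \<noteq> 0 \<and> norm (\<alpha> s - \<beta> t) + (\<sigma> *\<^sub>R n) \<bullet> (\<alpha> s - \<beta> t) \<noteq> 0"
      using neq[of s t] by (intro conjI) (simp, linarith)
  qed
  have isolated: "\<exists>d>0. \<forall>t. \<bar>t - x\<bar> < d \<longrightarrow> t \<noteq> x \<longrightarrow> h t \<noteq> 0" for x
  proof (cases "h x = 0")
    case True
    then have "n \<bullet> \<beta>' x \<noteq> 0" using transversal[of x] by (simp add: h_def)
    from zero_crossing[OF h_der True this] obtain d where d: "d > 0"
      "\<And>t. x - d < t \<Longrightarrow> t < x \<Longrightarrow> sgn (h t) = - sgn (n \<bullet> \<beta>' x)"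
      "\<And>t. x < t \<Longrightarrow> t < x + d \<Longrightarrow> sgn (h t) = sgn (n \<bullet> \<beta>' x)" by blast
    have "h t \<noteq> 0" if "\<bar>t - x\<bar> < d" "t \<noteq> x" for t
    proof -
      have "sgn (h t) \<noteq> 0" using d(2,3)[of t] that \<open>n \<bullet> \<beta>' x \<noteq> 0\<close>
        by (cases "t < x") (auto simp: abs_less_iff sgn_zero_iff)
      then show ?thesis by auto
    qed
    then show ?thesis using d(1) by blast
  next
    case False
    have "isCont h x" using h_der DERIV_isCont by blast
    then have "\<forall>\<^sub>F t in at x. h t \<noteq> 0" using False by (simp add: isCont_def tendsto_imp_eventually_ne)
    then show ?thesis unfolding eventually_at by (auto simp: dist_real_def)
  qed
  have finZ: "finite Z"
  proof (rule ccontr)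
    assume "infinite Z"
    then obtain x where "x islimpt Z"
      using compact_eq_Bolzano_Weierstrass[of "{0..1::real}"] by (auto simp: Z_def)
    moreover obtain d where "d > 0" "\<And>t. \<bar>t - x\<bar> < d \<Longrightarrow> t \<noteq> x \<Longrightarrow> h t \<noteq> 0" using isolated[of x] by blast
    ultimately show False unfolding islimpt_approachable by (auto simp: Z_def dist_real_def)
  qed
  have sub: "{t\<in>{0..<1}. n \<bullet> (\<beta> t - c) = 0} \<subseteq> Z" by (auto simp: Z_def h_def)
  then show "finite {t\<in>{0..<1}. n \<bullet> (\<beta> t - c) = 0}" using finZ finite_subset by blast
  have w_sum: "(\<Sum>t\<in>Z. w a b t * j t) = w a b x * j x" if "\<And>t. t \<in> {a..b} \<Longrightarrow> t \<noteq> x \<Longrightarrow> h t \<noteq> 0" "h x = 0" "x \<in> {0..1}" for a b x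
  proof -
    have "(\<Sum>t\<in>Z. w a b t * j t) = (\<Sum>t\<in>{x}. w a b t * j t)"
    proof (rule sum.mono_neutral_right[OF finZ])
      show "{x} \<subseteq> Z" using that by (auto simp: Z_def)
      show "\<forall>t\<in>Z - {x}. w a b t * j t = 0"
      proof
        fix t assume "t \<in> Z - {x}"
        then have "t \<notin> {a..b}" using that(1)[of t] by (auto simp: Z_def)
        then have "w a b t = 0" by (auto simp: w_def)
        then show "w a b t * j t = 0" by simp
      qed
    qed
    then show ?thesis by simp
  qed
  have w_zero: "(\<Sum>t\<in>Z. w a b t * j t) = 0" if "\<And>t. t \<in> {a..b} \<Longrightarrow> h t \<noteq> 0" for a b
  proof (rule sum.neutral, rule)
    fix t assume "t \<in> Z"
    then have "t \<notin> {a..b}" using that[of t] by (auto simp: Z_def)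
    then have "w a b t = 0" by (auto simp: w_def)
    then show "w a b t * j t = 0" by simp
  qed
  have cont_inner: "continuous_on UNIV (\<lambda>(s, t). gauss_integrand \<alpha> \<alpha>' \<beta> \<beta>' s t)"
  proof -
    note fst = continuous_on_fst[OF continuous_on_id] and snd = continuous_on_snd[OF continuous_on_id]
    note c = continuous_on_compose2[OF cont1(1) fst subset_UNIV] continuous_on_compose2[OF \<alpha>(2) fst subset_UNIV]
      continuous_on_compose2[OF cont1(2) snd subset_UNIV] continuous_on_compose2[OF \<beta>(2) snd subset_UNIV]
    show ?thesis unfolding gauss_integrand_def split_def
      using neq by (intro continuous_intros continuous_on_cross c) auto
  qed
  have int_G: "(\<lambda>t. integral {0..1} (\<lambda>s. gauss_integrand \<alpha> \<alpha>' \<beta> \<beta>' s t)) integrable_on {a..b}" for a b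
  proof (rule integrable_continuous_real)
    have "continuous_on ({a..b} \<times> cbox 0 1) (\<lambda>(t, s). gauss_integrand \<alpha> \<alpha>' \<beta> \<beta>' s t)"
      using continuous_on_compose2[OF cont_inner continuous_on_Pair[OF continuous_on_snd[OF continuous_on_id]
          continuous_on_fst[OF continuous_on_id]] subset_UNIV, of "{a..b} \<times> cbox 0 1"]
      by (simp add: split_def)
    from integral_continuous_on_param[OF this]
    show "continuous_on {a..b} (\<lambda>t. integral {0..1} (\<lambda>s. gauss_integrand \<alpha> \<alpha>' \<beta> \<beta>' s t))" by simp
  qed
  have G_add: "G a b + G b d = G a d" if "a \<le> b" "b \<le> d" for a b d
    unfolding G_def by (rule Henstock_Kurzweil_Integration.integral_combine[OF that int_G])
  define P where "P a b \<longleftrightarrow> (0 \<le> a \<longrightarrow> a \<le> b \<longrightarrow> b \<le> 1 \<longrightarrow> G a b = \<Phi> b - \<Phi> a + 4 * pi * (\<Sum>t\<in>Z. w a b t * j t))" for a b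
  have "P 0 1"
  proof (rule Bolzano)
    fix a b d assume P: "P a b" "P b d" and le: "a \<le> b" "b \<le> d"
    have "w a d t = w a b t + w b d t" for t using le by (auto simp: w_def)
    then have "(\<Sum>t\<in>Z. w a d t * j t) = (\<Sum>t\<in>Z. w a b t * j t) + (\<Sum>t\<in>Z. w b d t * j t)"
      by (simp add: distrib_right sum.distrib)
    then show "P a d" using P le G_add[OF le] unfolding P_def by (auto simp: algebra_simps)
  next
    fix x :: real assume x: "0 \<le> x" "x \<le> 1"
    show "\<exists>d>0. \<forall>a b. a \<le> x \<and> x \<le> b \<and> b - a < d \<longrightarrow> P a b"
    proof (cases "h x = 0")
      case False
      define \<sigma> where "\<sigma> = - sgn (h x)"
      have \<sigma>: "\<sigma> \<in> {-1, 1}" using False by (auto simp: \<sigma>_def sgn_if)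
      have "isCont h x" using h_der DERIV_isCont by blast
      then obtain d where d: "d > 0" "\<And>t. \<bar>t - x\<bar> < d \<Longrightarrow> \<bar>h t - h x\<bar> < \<bar>h x\<bar>"
        using False unfolding continuous_at_eps_delta dist_real_def by (metis zero_less_abs_iff)
      show ?thesis
      proof (intro exI[of _ d] conjI allI impI)
        fix a b assume ab: "a \<le> x \<and> x \<le> b \<and> b - a < d"
        have sg: "sgn (h t) = sgn (h x)" "h t \<noteq> 0" if "t \<in> {a..b}" for t
        proof -
          have "\<bar>t - x\<bar> < d" using that ab by auto
          from d(2)[OF this] have "h x > 0 \<Longrightarrow> h t > 0" "h x < 0 \<Longrightarrow> h t < 0" by linarith+
          moreover have "h x > 0 \<or> h x < 0" using False by linarith
          ultimately show "sgn (h t) = sgn (h x)" "h t \<noteq> 0" by (auto simp: sgn_if)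
        qed
        have "\<sigma> * h t \<le> 0" if "t \<in> {a..b}" for t
          using sg[OF that] by (auto simp: \<sigma>_def sgn_if split: if_splits)
        from G_diff[OF _ \<sigma> this] ab have "G a b = \<Omega> (\<sigma> *\<^sub>R n) b - \<Omega> (\<sigma> *\<^sub>R n) a" by auto
        moreover have "\<Phi> a = \<Omega> (\<sigma> *\<^sub>R n) a" "\<Phi> b = \<Omega> (\<sigma> *\<^sub>R n) b"
          using sg(1)[of a] sg(1)[of b] ab by (simp_all add: \<Phi>_def \<sigma>_def)
        ultimately show "P a b" using w_zero[of a b] sg(2) by (simp add: P_def)
      qed (fact d(1))
    next
      case True
      define \<sigma> where "\<sigma> = sgn (n \<bullet> \<beta>' x)"
      have nz: "n \<bullet> \<beta>' x \<noteq> 0" using transversal[of x] True by (simp add: h_def)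
      then have \<sigma>: "\<sigma> \<in> {-1, 1}" "- \<sigma> \<in> {-1, 1}" "\<sigma> * \<sigma> = 1" by (auto simp: \<sigma>_def sgn_if)
      from zero_crossing[OF h_der True nz] obtain d where d: "d > 0"
        "\<And>t. x - d < t \<Longrightarrow> t < x \<Longrightarrow> sgn (h t) = - \<sigma>"
        "\<And>t. x < t \<Longrightarrow> t < x + d \<Longrightarrow> sgn (h t) = \<sigma>" unfolding \<sigma>_def by blast
      show ?thesis
      proof (intro exI[of _ d] conjI allI impI)
        fix a b assume ab: "a \<le> x \<and> x \<le> b \<and> b - a < d"
        have left: "\<sigma> * h t \<le> 0" if "t \<in> {a..x}" for t
        proof (cases "t = x")
          case False
          then have "sgn (h t) = - \<sigma>" using d(2)[of t] that ab by auto
          then have "h t = - \<sigma> * \<bar>h t\<bar>" by (metis mult_sgn_abs)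
          then have "\<sigma> * h t = - (\<sigma> * \<sigma>) * \<bar>h t\<bar>" by (metis mult.assoc mult_minus_left mult_minus_right)
          then show ?thesis using \<sigma>(3) by simp
        qed (simp add: True)
        have right: "- \<sigma> * h t \<le> 0" if "t \<in> {x..b}" for t
        proof (cases "t = x")
          case False
          then have "sgn (h t) = \<sigma>" using d(3)[of t] that ab by auto
          then have "h t = \<sigma> * \<bar>h t\<bar>" by (metis mult_sgn_abs)
          then have "\<sigma> * h t = (\<sigma> * \<sigma>) * \<bar>h t\<bar>" by (metis mult.assoc)
          then show ?thesis using \<sigma>(3) by simp
        qed (simp add: True)
        have \<Phi>x: "\<Phi> x = 0" by (simp add: \<Phi>_def True \<Omega>_def monopole_def)
        have jx: "j x = I x * \<sigma>" by (simp add: j_def \<sigma>_def)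
        \<comment> \<open>The one-sided limits of \<Phi> at the crossing are 2 pi j before and -2 pi
          j after it, so each side that is present adds 2 pi j.\<close>
        have L: "G a x = - \<Phi> a + 2 * pi * (if a < x then j x else 0)"
        proof (cases "a < x")
          case lt: True
          then have "\<Phi> a = \<Omega> (\<sigma> *\<^sub>R n) a" using d(2)[of a] ab by (simp add: \<Phi>_def)
          then show ?thesis using G_diff[OF _ \<sigma>(1) left] \<Omega>_plane[OF True \<sigma>(1)] lt by (simp add: jx)
        next
          case False
          then show ?thesis using ab \<Phi>x by (simp add: G_def)
        qed
        have R: "G x b = \<Phi> b + 2 * pi * (if x < b then j x else 0)"
        proof (cases "x < b")
          case lt: True
          then have "\<Phi> b = \<Omega> ((- \<sigma>) *\<^sub>R n) b" using d(3)[of b] ab by (simp add: \<Phi>_def)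
          then show ?thesis using G_diff[OF _ \<sigma>(2) right] \<Omega>_plane[OF True \<sigma>(2)] lt by (simp add: jx)
        next
          case False
          then show ?thesis using ab \<Phi>x by (simp add: G_def)
        qed
        have "h t \<noteq> 0" if "t \<in> {a..b}" "t \<noteq> x" for t
        proof (cases "t < x")
          case True
          then have "sgn (h t) = - \<sigma>" using d(2)[of t] that ab by auto
          then show ?thesis using \<sigma>(1) by auto
        next
          case False
          then have "sgn (h t) = \<sigma>" using d(3)[of t] that ab by auto
          then show ?thesis using \<sigma>(1) by auto
        qed
        then have sum_w: "(\<Sum>t\<in>Z. w a b t * j t) = w a b x * j x" using w_sum[of a b x] True x by auto
        have Gab: "G a x + G x b = G a b" using G_add[of a x b] ab by simp
        have "4 * pi * (w a b x * j x) = 2 * pi * (if a < x then j x else 0) + 2 * pi * (if x < b then j x else 0)"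
          using ab by (simp add: w_def algebra_simps)
        with Gab L R have "G a b = \<Phi> b - \<Phi> a + 4 * pi * (w a b x * j x)" by linarith
        then show "P a b" unfolding P_def sum_w by simp
      qed (fact d(1))
    qed
  qed simp
  then have "G 0 1 = \<Phi> 1 - \<Phi> 0 + 4 * pi * (\<Sum>t\<in>Z. w 0 1 t * j t)" by (simp add: P_def)
  moreover have per: "\<beta> 1 = \<beta> 0" using \<beta>(3)[of 0] by simp
  then have "\<Phi> 1 = \<Phi> 0" by (simp add: \<Phi>_def \<Omega>_def h_def)
  ultimately have G01: "G 0 1 = 4 * pi * (\<Sum>t\<in>Z. w 0 1 t * j t)" by simp
  define Z' where "Z' = {t\<in>{0..<1}. h t = 0}"
  have "\<beta>' 1 = \<beta>' 0"
  proof -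
    have "((\<lambda>t. t + 1) has_vector_derivative 1) (at (0::real))"
      by (auto intro!: derivative_eq_intros)
    from vector_diff_chain_at[OF this \<beta>(1)] have "((\<lambda>t. \<beta> (t + 1)) has_vector_derivative \<beta>' 1) (at 0)"
      by (simp add: o_def)
    then show ?thesis using \<beta>(1)[of 0] unfolding \<beta>(3) by (rule vector_derivative_unique_at)
  qed
  then have j01: "j 1 = j 0" by (simp add: j_def I_def per)
  \<comment> \<open>A crossing at the base point occurs in \<open>Z\<close> both at 0 and at 1, with
    weight 1/2 each; since \<open>j 1 = j 0\<close>, they merge into one crossing of
    \<open>Z'\<close>.\<close>
  have "(\<Sum>t\<in>Z. w 0 1 t * j t) = (\<Sum>t\<in>Z'. j t)"
  proof (cases "h 0 = 0")
    case True
    then have h1: "h 1 = 0" by (simp add: h_def per)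
    define Y where "Y = {t\<in>{0<..<1}. h t = 0}"
    have Z: "Z = insert 0 (insert 1 Y)" "Z' = insert 0 Y" using True h1 by (auto simp: Z_def Z'_def Y_def less_le)
    have finY: "finite Y" using finZ Z(1) by simp
    have "(\<Sum>t\<in>Y. w 0 1 t * j t) = (\<Sum>t\<in>Y. j t)" by (rule sum.cong) (auto simp: Y_def w_def)
    then show ?thesis unfolding Z using finY j01 by (simp add: Y_def w_def)
  next
    case False
    then have "h 1 \<noteq> 0" by (simp add: h_def per)
    then have Z: "Z = Z'" by (auto simp: Z_def Z'_def less_le)
    show ?thesis unfolding Z
    proof (rule sum.cong)
      fix t assume "t \<in> Z'"
      then have "0 < t" "t < 1" using False by (auto simp: Z'_def less_le)
      then show "w 0 1 t * j t = j t" by (simp add: w_def)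
    qed simp
  qed
  also have "\<dots> = (\<Sum>t\<in>{t\<in>{0..<1}. \<beta> t \<in> circle_disk (c, r, n)}. sgn (n \<bullet> \<beta>' t))"
  proof (rule sum.mono_neutral_cong_right)
    show "finite Z'" using finZ by (rule finite_subset[rotated]) (auto simp: Z_def Z'_def)
  qed (auto simp: Z'_def j_def I_def circle_disk_def h_def inner_commute)
  finally have G_sum: "G 0 1 = 4 * pi * (\<Sum>t\<in>{t\<in>{0..<1}. \<beta> t \<in> circle_disk (c, r, n)}. sgn (n \<bullet> \<beta>' t))"
    using G01 by simp
  have vel: "velocity \<alpha> s = \<alpha>' s" "velocity \<beta> t = \<beta>' t" for s t
    using \<alpha>(1) \<beta>(1) by (auto intro: vector_derivative_at)
  have "linking_number \<alpha> \<beta> = 1 / (4 * pi) * (LINT z:{0..1} \<times> {0..1}|lborel. (case z of (s, t) \<Rightarrow> gauss_integrand \<alpha> \<alpha>' \<beta> \<beta>' s t))"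
    unfolding linking_number_def vel gauss_integrand_def ..
  also have "(LINT z:{0..1} \<times> {0..1}|lborel. (case z of (s, t) \<Rightarrow> gauss_integrand \<alpha> \<alpha>' \<beta> \<beta>' s t))
    = integral (cbox (0, 0) (1, 1)) (\<lambda>(s, t). gauss_integrand \<alpha> \<alpha>' \<beta> \<beta>' s t)"
  proof -
    have box: "{0..1} \<times> {0..1} = cbox (0::real, 0::real) (1, 1)" by (simp add: cbox_Pair_eq)
    have "set_integrable lborel ({0..1} \<times> {0..1}) (\<lambda>(s, t). gauss_integrand \<alpha> \<alpha>' \<beta> \<beta>' s t)"
      unfolding set_integrable_def box
      by (rule borel_integrable_compact) (use cont_inner continuous_on_subset in auto)
    from set_borel_integral_eq_integral(2)[OF this] show ?thesis by (simp add: box)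
  qed
  also have "\<dots> = integral {0..1} (\<lambda>s. integral {0..1} (\<lambda>t. gauss_integrand \<alpha> \<alpha>' \<beta> \<beta>' s t))"
    using integral_prod_continuous[of 0 0 1 1 "\<lambda>(s, t). gauss_integrand \<alpha> \<alpha>' \<beta> \<beta>' s t"] continuous_on_subset[OF cont_inner]
    by simp
  also have "\<dots> = G 0 1"
    unfolding G_def using integral_swap_continuous[of 0 0 1 1 "gauss_integrand \<alpha> \<alpha>' \<beta> \<beta>'"] continuous_on_subset[OF cont_inner]
    by simp
  finally show "linking_number (circle_path (c, r, n)) \<beta>
      = (\<Sum>t\<in>{t\<in>{0..<1}. \<beta> t \<in> circle_disk (c, r, n)}. sgn (n \<bullet> \<beta>' t))"
    by (simp add: G_sum \<alpha>_def)
qed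

section \<open>Crossings of the disk of a circle\<close>

lemma sets_sphere_area [measurable_cong, simp]: "sets sphere_area = sets borel"
  by (simp add: sphere_area_def)

lemma nn_integral_sphere_area:
  assumes [measurable]: "F \<in> borel_measurable borel"
  shows "(\<integral>\<^sup>+n. F n \<partial>sphere_area) = (\<integral>\<^sup>+x. 3 * indicator (ball 0 1) x * F (sgn x) \<partial>lborel)"
proof -
  have [measurable]: "ball (0::real^3) 1 \<in> sets borel" by simp
  show ?thesis unfolding sphere_area_def
    by (simp add: nn_integral_distr nn_integral_density)
qed

lemma sigma_finite_sphere_area: "sigma_finite_measure sphere_area"
proof -
  have "emeasure sphere_area (space sphere_area) = (\<integral>\<^sup>+x. 3 * indicator (ball 0 1) x * indicator UNIV (sgn x) \<partial>(lborel :: (real^3) measure))"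
    by (subst nn_integral_sphere_area[symmetric]) (auto simp: sphere_area_def)
  also have "\<dots> < \<infinity>" by (simp add: nn_integral_cmult_indicator emeasure_ball ennreal_mult_less_top)
  finally have "finite_measure sphere_area" by (intro finite_measureI) auto
  then show ?thesis by (simp add: finite_measure_def)
qed

lemma sets_circle_measure [measurable_cong, simp]: "sets circle_measure = sets borel"
proof -
  have "sets circle_measure = sets (borel \<Otimes>\<^sub>M borel \<Otimes>\<^sub>M borel :: circle measure)"
    unfolding circle_measure_def sets_density by (intro sets_pair_measure_cong) auto
  then show ?thesis by (simp only: borel_prod)
qed

lemma space_circle_measure [simp]: "space circle_measure = UNIV"
  using sets_eq_imp_space_eq[OF sets_circle_measure] by simp

text \<open>Centers are innermost, then radii, then directions. The directions are carried by points
  \<open>x\<close> of the unit ball, a domain of full dimension, so that the area formula can later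
  be applied to normals as well as to centers.\<close>

lemma nn_integral_circle_measure:
  assumes F: "F \<in> borel_measurable borel"
  shows "(\<integral>\<^sup>+\<gamma>. F \<gamma> \<partial>circle_measure) = (\<integral>\<^sup>+x. 3 * indicator (ball 0 1) x *
    (\<integral>\<^sup>+r. ennreal (1 / r ^ 4) * (\<integral>\<^sup>+c. F (c, r, sgn x) \<partial>lborel) \<partial>lborel) \<partial>lborel)"
proof -
  interpret S: sigma_finite_measure sphere_area by (rule sigma_finite_sphere_area)
  interpret RS: pair_sigma_finite "lborel :: real measure" sphere_area ..
  interpret CRS: pair_sigma_finite "lborel :: (real^3) measure" "(lborel :: real measure) \<Otimes>\<^sub>M sphere_area"
    by (intro pair_sigma_finite.intro lborel.sigma_finite_measure_axioms RS.sigma_finite_measure_axioms sigma_finite_lborel RS.sigma_finite_measure_axioms)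
  have F': "F \<in> borel_measurable (borel \<Otimes>\<^sub>M borel \<Otimes>\<^sub>M borel)" using F by (simp add: borel_prod)
  note [measurable] = F'
  have [measurable]: "F \<in> borel_measurable (lborel \<Otimes>\<^sub>M lborel \<Otimes>\<^sub>M sphere_area)"
    using F' by (simp cong: measurable_cong_sets sets_pair_measure_cong)
  have "(\<integral>\<^sup>+\<gamma>. F \<gamma> \<partial>circle_measure)
    = (\<integral>\<^sup>+\<gamma>. (case \<gamma> of (c, r, n) \<Rightarrow> ennreal (1 / r ^ 4)) * F \<gamma> \<partial>(lborel \<Otimes>\<^sub>M lborel \<Otimes>\<^sub>M sphere_area))"
    unfolding circle_measure_def by (rule nn_integral_density) measurable
  also have "\<dots> = (\<integral>\<^sup>+z. \<integral>\<^sup>+c. (case (c, z) of (c, r, n) \<Rightarrow> ennreal (1 / r ^ 4)) * F (c, z) \<partial>lborel \<partial>(lborel \<Otimes>\<^sub>M sphere_area))"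
    by (rule CRS.nn_integral_snd[symmetric]) measurable
  also have "\<dots> = (\<integral>\<^sup>+n. \<integral>\<^sup>+r. \<integral>\<^sup>+c. ennreal (1 / r ^ 4) * F (c, r, n) \<partial>lborel \<partial>lborel \<partial>sphere_area)"
    by (subst RS.nn_integral_snd[symmetric]) auto
  also have "\<dots> = (\<integral>\<^sup>+n. \<integral>\<^sup>+r. ennreal (1 / r ^ 4) * (\<integral>\<^sup>+c. F (c, r, n) \<partial>lborel) \<partial>lborel \<partial>sphere_area)"
    by (intro nn_integral_cong nn_integral_cmult) measurable
  also have "\<dots> = (\<integral>\<^sup>+x. 3 * indicator (ball 0 1) x *
    (\<integral>\<^sup>+r. ennreal (1 / r ^ 4) * (\<integral>\<^sup>+c. F (c, r, sgn x) \<partial>lborel) \<partial>lborel) \<partial>lborel)"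
    by (rule nn_integral_sphere_area) measurable
  finally show ?thesis .
qed

section \<open>The area formula in the center, and the counts to which it is applied\<close>

lemma nn_integral_lborel_reflect:
  fixes a :: "'a::euclidean_space"
  assumes [measurable]: "F \<in> borel_measurable borel"
  shows "(\<integral>\<^sup>+x. F (a - x) \<partial>lborel) = (\<integral>\<^sup>+x. F x \<partial>lborel)"
proof -
  have "(lborel :: 'a measure) = density (distr lborel borel (\<lambda>x. a + (- 1) *\<^sub>R x)) (\<lambda>_. ennreal (\<bar>- 1\<bar> ^ DIM('a)))"
    by (rule lborel_affine) simp
  then have "(\<integral>\<^sup>+x. F x \<partial>lborel) = (\<integral>\<^sup>+x. F x \<partial>density (distr lborel borel (\<lambda>x. a + (- 1) *\<^sub>R x)) (\<lambda>_. ennreal (\<bar>- 1\<bar> ^ DIM('a))))"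
    by simp
  also have "\<dots> = (\<integral>\<^sup>+x. F (a - x) \<partial>lborel)" by (simp add: nn_integral_density nn_integral_distr)
  finally show ?thesis by simp
qed

text \<open>For a fixed normal, \<open>n \<bullet> (\<alpha> t - c)\<close> is the height of the
  curve over the plane of the disk, with derivative \<open>n \<bullet> \<alpha>' t\<close>; slices
  are taken along \<open>n\<close>. The variable \<open>y\<close> stands for
  \<open>\<alpha> t - c\<close> before the center is moved along \<open>n\<close> into position, so
  the true center is \<open>\<alpha> t\<close> minus the projection of \<open>y\<close>.\<close>

lemma nn_integral_centers:
  fixes \<alpha> \<alpha>' :: "real \<Rightarrow> real^3" and G :: "real \<Rightarrow> real^3 \<Rightarrow> ennreal"
  assumes n: "norm n = 1"
    and \<alpha>: "\<And>t. (\<alpha> has_vector_derivative \<alpha>' t) (at t)" "continuous_on UNIV \<alpha>'"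
    and [measurable]: "(\<lambda>(t, c). G t c) \<in> borel_measurable (borel \<Otimes>\<^sub>M borel)"
    and S: "(\<lambda>c. \<integral>\<^sup>+t. G t c * indicator {t\<in>{0..<1}. n \<bullet> (\<alpha> t - c) = 0} t \<partial>count_space UNIV) \<in> borel_measurable borel"
  shows "(\<integral>\<^sup>+c. (\<integral>\<^sup>+t. G t c * indicator {t\<in>{0..<1}. n \<bullet> (\<alpha> t - c) = 0} t \<partial>count_space UNIV) \<partial>lborel)
    = (\<integral>\<^sup>+t. indicator {0..<1} t * (\<integral>\<^sup>+y. indicator {0..1} (n \<bullet> y) * ennreal \<bar>n \<bullet> \<alpha>' t\<bar>
        * G t (\<alpha> t - (y - (n \<bullet> y) *\<^sub>R n)) \<partial>lborel) \<partial>lborel)"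
proof -
  have "continuous_on UNIV \<alpha>"
    using \<alpha>(1) by (meson continuous_at_imp_continuous_on has_vector_derivative_continuous)
  then have [measurable]: "\<alpha> \<in> borel_measurable borel" by (rule borel_measurable_continuous_onI)
  have [measurable]: "\<alpha>' \<in> borel_measurable borel" using \<alpha>(2) by (rule borel_measurable_continuous_onI)
  have nn: "n \<bullet> n = 1" using n by (simp add: norm_eq_1)
  have der: "((\<lambda>t. n \<bullet> (\<alpha> t - c)) has_real_derivative n \<bullet> \<alpha>' t) (at t)" for t c
  proof -
    have "((\<lambda>t. \<alpha> t - c) has_vector_derivative \<alpha>' t - 0) (at t)"
      by (intro has_vector_derivative_diff \<alpha>(1) has_vector_derivative_const)
    from has_real_derivative_inner[OF has_vector_derivative_const this, of n] show ?thesis by simp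
  qed
  have "(\<integral>\<^sup>+c. (\<integral>\<^sup>+t. G t c * indicator {t\<in>{0..<1}. n \<bullet> (\<alpha> t - c) = 0} t \<partial>count_space UNIV) \<partial>lborel)
    = (\<integral>\<^sup>+t. indicator {0..<1} t * (\<integral>\<^sup>+c. indicator {0..1} (n \<bullet> (\<alpha> t - c)) * ennreal \<bar>n \<bullet> \<alpha>' t\<bar>
        * G t (c + (n \<bullet> (\<alpha> t - c)) *\<^sub>R n) \<partial>lborel) \<partial>lborel)"
  proof (rule nn_integral_slices[OF open_UNIV _ _ der _ _ _ _ _ S])
    show "n \<bullet> (\<alpha> t - (c + \<tau> *\<^sub>R n)) = 0 \<longleftrightarrow> n \<bullet> (\<alpha> t - c) = \<tau>" for t c \<tau>
      by (simp add: inner_diff_right inner_add_right nn) linarith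
    show "continuous_on UNIV (\<lambda>t. n \<bullet> \<alpha>' t)" using \<alpha>(2) by (intro continuous_intros)
    show "{0..<1::real} \<in> sets borel" by simp
  qed (simp, measurable)
  also have "\<dots> = (\<integral>\<^sup>+t. indicator {0..<1} t * (\<integral>\<^sup>+y. indicator {0..1} (n \<bullet> y) * ennreal \<bar>n \<bullet> \<alpha>' t\<bar>
        * G t (\<alpha> t - (y - (n \<bullet> y) *\<^sub>R n)) \<partial>lborel) \<partial>lborel)"
  proof (rule nn_integral_cong)
    fix t
    have "(\<integral>\<^sup>+c. indicator {0..1} (n \<bullet> (\<alpha> t - c)) * ennreal \<bar>n \<bullet> \<alpha>' t\<bar> * G t (c + (n \<bullet> (\<alpha> t - c)) *\<^sub>R n) \<partial>lborel)
      = (\<integral>\<^sup>+y. indicator {0..1} (n \<bullet> (\<alpha> t - (\<alpha> t - y))) * ennreal \<bar>n \<bullet> \<alpha>' t\<bar> * G t ((\<alpha> t - y) + (n \<bullet> (\<alpha> t - (\<alpha> t - y))) *\<^sub>R n) \<partial>lborel)"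
      by (rule nn_integral_lborel_reflect[symmetric]) measurable
    then show "indicator {0..<1} t * (\<integral>\<^sup>+c. indicator {0..1} (n \<bullet> (\<alpha> t - c)) * ennreal \<bar>n \<bullet> \<alpha>' t\<bar> * G t (c + (n \<bullet> (\<alpha> t - c)) *\<^sub>R n) \<partial>lborel)
      = indicator {0..<1} t * (\<integral>\<^sup>+y. indicator {0..1} (n \<bullet> y) * ennreal \<bar>n \<bullet> \<alpha>' t\<bar> * G t (\<alpha> t - (y - (n \<bullet> y) *\<^sub>R n)) \<partial>lborel)"
      by (simp add: algebra_simps)
  qed
  finally show ?thesis .
qed

text \<open>Counted by the counting measure, so that infinite sets have the value infinity and
  counts are integrals over the parameter. The half-open interval meets each point of a simple
  closed component once.\<close>

definition crossings :: "(real \<Rightarrow> real^3) \<Rightarrow> circle \<Rightarrow> ennreal" where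
  "crossings \<alpha> \<gamma> = emeasure (count_space UNIV) {t\<in>{0..<1}. \<alpha> t \<in> circle_disk \<gamma>}"

text \<open>The value 1 of \<sigma> selects equal signs and -1 opposite signs. The condition
  \<open>\<alpha> s \<noteq> \<beta> t\<close> removes the diagonal when both curves are the same
  component.\<close>

definition crossing_pairs :: "(real \<Rightarrow> real^3) \<Rightarrow> (real \<Rightarrow> real^3) \<Rightarrow> (real \<Rightarrow> real^3) \<Rightarrow> (real \<Rightarrow> real^3) \<Rightarrow> real \<Rightarrow> circle \<Rightarrow> ennreal" where
  "crossing_pairs \<alpha> \<alpha>' \<beta> \<beta>' \<sigma> = (\<lambda>(c, r, n). emeasure (count_space UNIV)
     {(s, t). s \<in> {0..<1} \<and> t \<in> {0..<1} \<and> \<alpha> s \<in> circle_disk (c, r, n) \<and> \<beta> t \<in> circle_disk (c, r, n)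
       \<and> \<alpha> s \<noteq> \<beta> t \<and> \<sigma> * ((n \<bullet> \<alpha>' s) * (n \<bullet> \<beta>' t)) > 0})"

lemma sigma_compact_Collect:
  fixes f g :: "'a::euclidean_space \<Rightarrow> real"
  assumes "continuous_on UNIV f" "continuous_on UNIV g"
  shows "sigma_compact {x. f x \<le> g x}" "sigma_compact {x. f x < g x}" "sigma_compact {x. f x = g x}" "sigma_compact {x. f x \<noteq> g x}"
  by (rule closed_imp_sigma_compact[OF closed_Collect_le[OF assms]] open_imp_sigma_compact[OF open_Collect_less[OF assms]]
      closed_imp_sigma_compact[OF closed_Collect_eq[OF assms]] open_imp_sigma_compact[OF open_Collect_neq[OF assms]])+

lemma continuous_on_curve:
  fixes \<alpha> :: "real \<Rightarrow> 'b::topological_space"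
  assumes "continuous_on UNIV \<alpha>" "continuous_on UNIV f"
  shows "continuous_on UNIV (\<lambda>z. \<alpha> (f z))"
  using continuous_on_compose2[OF assms] by simp

lemma borel_measurable_crossings:
  assumes \<alpha>: "continuous_on UNIV \<alpha>"
  shows "crossings \<alpha> \<in> borel_measurable borel"
proof -
  have "sigma_compact {z :: circle \<times> real. 0 \<le> snd z \<and> snd z < 1 \<and> (\<alpha> (snd z) - fst (fst z)) \<bullet> snd (snd (fst z)) = 0
     \<and> dist (fst (fst z)) (\<alpha> (snd z)) \<le> fst (snd (fst z))}"
    by (intro sigma_compact_Collect_conj sigma_compact_Collect continuous_intros continuous_on_curve[OF \<alpha>])
  from borel_measurable_card_fibre[OF this] show ?thesis
    unfolding crossings_def[abs_def] circle_disk_def by (simp add: split_def)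
qed

lemma borel_measurable_crossing_pairs:
  assumes c: "continuous_on UNIV \<alpha>" "continuous_on UNIV \<alpha>'" "continuous_on UNIV \<beta>" "continuous_on UNIV \<beta>'"
  shows "crossing_pairs \<alpha> \<alpha>' \<beta> \<beta>' \<sigma> \<in> borel_measurable borel"
proof -
  note cs = c[THEN continuous_on_curve]
  have "sigma_compact {z :: circle \<times> (real \<times> real). 0 \<le> fst (snd z) \<and> fst (snd z) < 1 \<and> 0 \<le> snd (snd z) \<and> snd (snd z) < 1
     \<and> (\<alpha> (fst (snd z)) - fst (fst z)) \<bullet> snd (snd (fst z)) = 0 \<and> dist (fst (fst z)) (\<alpha> (fst (snd z))) \<le> fst (snd (fst z))
     \<and> (\<beta> (snd (snd z)) - fst (fst z)) \<bullet> snd (snd (fst z)) = 0 \<and> dist (fst (fst z)) (\<beta> (snd (snd z))) \<le> fst (snd (fst z))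
     \<and> dist (\<alpha> (fst (snd z))) (\<beta> (snd (snd z))) \<noteq> 0
     \<and> 0 < \<sigma> * ((snd (snd (fst z)) \<bullet> \<alpha>' (fst (snd z))) * (snd (snd (fst z)) \<bullet> \<beta>' (snd (snd z))))}"
    by (intro sigma_compact_Collect_conj sigma_compact_Collect continuous_intros cs)
  from borel_measurable_card_fibre[OF this] show ?thesis
    unfolding crossing_pairs_def circle_disk_def by (simp add: split_def conj_ac)
qed

section \<open>Pairs of crossings\<close>

text \<open>
  The second crossing of a pair: \<open>p\<close> and \<open>u\<close> are the position and the tangent vector of the first one, \<open>x\<close> is
  a normal vector and \<open>p - z\<close> is the center.
\<close>

definition second_crossings :: "(real \<Rightarrow> real^3) \<Rightarrow> (real \<Rightarrow> real^3) \<Rightarrow> real \<Rightarrow> real^3 \<Rightarrow> real^3 \<Rightarrow> real^3 \<Rightarrow> real \<Rightarrow> real^3 \<Rightarrow> ennreal" where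
  "second_crossings \<beta> \<beta>' \<sigma> x z p r u = emeasure (count_space UNIV)
     {t\<in>{0..<1}. x \<bullet> (\<beta> t - p) = 0 \<and> norm (\<beta> t - p + z) \<le> r \<and> \<beta> t \<noteq> p \<and> \<sigma> * ((x \<bullet> u) * (x \<bullet> \<beta>' t)) > 0}"

lemma measurable_second_crossings:
  assumes c: "continuous_on UNIV \<beta>" "continuous_on UNIV \<beta>'"
    and [measurable]: "f1 \<in> borel_measurable M" "f2 \<in> borel_measurable M" "f3 \<in> borel_measurable M" "f4 \<in> borel_measurable M" "f5 \<in> borel_measurable M"
  shows "(\<lambda>\<omega>. second_crossings \<beta> \<beta>' \<sigma> (f1 \<omega>) (f2 \<omega>) (f3 \<omega>) (f4 \<omega>) (f5 \<omega>)) \<in> borel_measurable M"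
proof -
  note cs = c[THEN continuous_on_curve]
  have "sigma_compact {q :: ((real^3) \<times> (real^3) \<times> (real^3) \<times> real \<times> (real^3)) \<times> real. 0 \<le> snd q \<and> snd q < 1
     \<and> fst (fst q) \<bullet> (\<beta> (snd q) - fst (snd (snd (fst q)))) = 0
     \<and> norm (\<beta> (snd q) - fst (snd (snd (fst q))) + fst (snd (fst q))) \<le> fst (snd (snd (snd (fst q))))
     \<and> dist (\<beta> (snd q)) (fst (snd (snd (fst q)))) \<noteq> 0
     \<and> 0 < \<sigma> * ((fst (fst q) \<bullet> snd (snd (snd (snd (fst q))))) * (fst (fst q) \<bullet> \<beta>' (snd q)))}"
    by (intro sigma_compact_Collect_conj sigma_compact_Collect continuous_intros cs)
  from borel_measurable_card_fibre[OF this]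
  have [measurable]: "(\<lambda>(x, z, p, r, u). second_crossings \<beta> \<beta>' \<sigma> x z p r u) \<in> borel_measurable (borel \<Otimes>\<^sub>M borel \<Otimes>\<^sub>M borel \<Otimes>\<^sub>M borel \<Otimes>\<^sub>M borel)"
    unfolding second_crossings_def by (simp add: split_def borel_prod conj_ac)
  have "(\<lambda>\<omega>. (\<lambda>(x, z, p, r, u). second_crossings \<beta> \<beta>' \<sigma> x z p r u) (f1 \<omega>, f2 \<omega>, f3 \<omega>, f4 \<omega>, f5 \<omega>)) \<in> borel_measurable M"
    by measurable
  then show ?thesis by simp
qed

text \<open>Pairs are counted by summing, over the first crossing, the number of second ones; the
  sum has the form required by \<open>nn_integral_centers\<close>, with the second count as part of
  the weight.\<close>

lemma nn_integral_centers_crossing_pairs: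
  assumes n: "norm n = 1"
    and \<alpha>: "\<And>t. (\<alpha> has_vector_derivative \<alpha>' t) (at t)" "continuous_on UNIV \<alpha>'"
    and \<beta>: "continuous_on UNIV \<beta>" "continuous_on UNIV \<beta>'"
  shows "(\<integral>\<^sup>+c. crossing_pairs \<alpha> \<alpha>' \<beta> \<beta>' \<sigma> (c, r, n) \<partial>lborel)
    = (\<integral>\<^sup>+s. indicator {0..<1} s * (\<integral>\<^sup>+y. indicator {0..1} (n \<bullet> y) * ennreal \<bar>n \<bullet> \<alpha>' s\<bar>
        * (indicator {..r} (norm (y - (n \<bullet> y) *\<^sub>R n)) * second_crossings \<beta> \<beta>' \<sigma> n (y - (n \<bullet> y) *\<^sub>R n) (\<alpha> s) r (\<alpha>' s)) \<partial>lborel) \<partial>lborel)"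
proof -
  have c\<alpha>: "continuous_on UNIV \<alpha>"
    using \<alpha>(1) by (meson continuous_at_imp_continuous_on has_vector_derivative_continuous)
  then have [measurable]: "\<alpha> \<in> borel_measurable borel" by (rule borel_measurable_continuous_onI)
  have [measurable]: "\<alpha>' \<in> borel_measurable borel" using \<alpha>(2) by (rule borel_measurable_continuous_onI)
  note [measurable] = measurable_second_crossings[OF \<beta>] borel_measurable_crossing_pairs[OF c\<alpha> \<alpha>(2) \<beta>]
  define G where "G s c = indicator {..r} (norm (\<alpha> s - c)) * second_crossings \<beta> \<beta>' \<sigma> n (\<alpha> s - c) (\<alpha> s) r (\<alpha>' s)" for s c
  have [measurable]: "(\<lambda>(s, c). G s c) \<in> borel_measurable (borel \<Otimes>\<^sub>M borel)" unfolding G_def by measurable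
  have pairs: "crossing_pairs \<alpha> \<alpha>' \<beta> \<beta>' \<sigma> (c, r, n) = (\<integral>\<^sup>+s. G s c * indicator {s\<in>{0..<1}. n \<bullet> (\<alpha> s - c) = 0} s \<partial>count_space UNIV)" for c
  proof -
    define A where "A = {(s, t). s \<in> {0..<1} \<and> t \<in> {0..<1} \<and> \<alpha> s \<in> circle_disk (c, r, n) \<and> \<beta> t \<in> circle_disk (c, r, n)
       \<and> \<alpha> s \<noteq> \<beta> t \<and> \<sigma> * ((n \<bullet> \<alpha>' s) * (n \<bullet> \<beta>' t)) > 0}"
    have "crossing_pairs \<alpha> \<alpha>' \<beta> \<beta>' \<sigma> (c, r, n) = (\<integral>\<^sup>+z. indicator A z \<partial>count_space UNIV)"
      by (simp add: crossing_pairs_def A_def)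
    also have "\<dots> = (\<integral>\<^sup>+s. \<integral>\<^sup>+t. indicator A (s, t) \<partial>count_space UNIV \<partial>count_space UNIV)"
      by (rule nn_integral_fst_count_space[symmetric])
    also have "\<dots> = (\<integral>\<^sup>+s. G s c * indicator {s\<in>{0..<1}. n \<bullet> (\<alpha> s - c) = 0} s \<partial>count_space UNIV)"
    proof (rule nn_integral_cong)
      fix s
      have fib: "(\<integral>\<^sup>+t. indicator A (s, t) \<partial>count_space UNIV) = emeasure (count_space UNIV) {t. (s, t) \<in> A}"
      proof -
        have "(\<integral>\<^sup>+t. indicator A (s, t) \<partial>count_space UNIV) = (\<integral>\<^sup>+t. indicator {t. (s, t) \<in> A} t \<partial>count_space UNIV)"
          by (intro nn_integral_cong) (simp add: indicator_def)
        then show ?thesis by simp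
      qed
      show "(\<integral>\<^sup>+t. indicator A (s, t) \<partial>count_space UNIV) = G s c * indicator {s\<in>{0..<1}. n \<bullet> (\<alpha> s - c) = 0} s"
      proof (cases "s \<in> {0..<1} \<and> n \<bullet> (\<alpha> s - c) = 0 \<and> norm (\<alpha> s - c) \<le> r")
        case True
        \<comment> \<open>As the first point lies in the plane of the disk, the plane condition on
          the second one no longer involves the center: it says that the normal is orthogonal to the
          chord.\<close>
        have "n \<bullet> (\<beta> t - \<alpha> s) = n \<bullet> (\<beta> t - c)" for t using True by (simp add: inner_diff_right)
        then have "{t. (s, t) \<in> A} = {t\<in>{0..<1}. n \<bullet> (\<beta> t - \<alpha> s) = 0 \<and> norm (\<beta> t - \<alpha> s + (\<alpha> s - c)) \<le> r \<and> \<beta> t \<noteq> \<alpha> s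
            \<and> \<sigma> * ((n \<bullet> \<alpha>' s) * (n \<bullet> \<beta>' t)) > 0}"
          using True by (auto simp: A_def circle_disk_def dist_norm norm_minus_commute inner_commute)
        then show ?thesis using True unfolding fib by (simp add: G_def second_crossings_def)
      next
        case False
        then have "{t. (s, t) \<in> A} = {}"
          by (auto simp: A_def circle_disk_def dist_norm norm_minus_commute inner_commute)
        then show ?thesis using False unfolding fib by (auto simp: G_def indicator_def)
      qed
    qed
    finally show ?thesis .
  qed
  have "(\<lambda>c. crossing_pairs \<alpha> \<alpha>' \<beta> \<beta>' \<sigma> (c, r, n)) \<in> borel_measurable borel"
    by (intro measurable_compose[OF _ borel_measurable_crossing_pairs[OF c\<alpha> \<alpha>(2) \<beta>]] borel_measurable_continuous_onI continuous_intros)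
  then have "(\<integral>\<^sup>+c. crossing_pairs \<alpha> \<alpha>' \<beta> \<beta>' \<sigma> (c, r, n) \<partial>lborel)
     = (\<integral>\<^sup>+s. indicator {0..<1} s * (\<integral>\<^sup>+y. indicator {0..1} (n \<bullet> y) * ennreal \<bar>n \<bullet> \<alpha>' s\<bar>
        * G s (\<alpha> s - (y - (n \<bullet> y) *\<^sub>R n)) \<partial>lborel) \<partial>lborel)"
    unfolding pairs by (intro nn_integral_centers[OF n \<alpha>]) measurable
  then show ?thesis by (simp add: G_def)
qed

section \<open>The mean number of crossings\<close>

lemma nn_integral_disk_centers:
  fixes n :: "real^3"
  assumes n: "norm n = 1" and r: "r \<ge> 0"
  shows "(\<integral>\<^sup>+y. indicator {0..1} (n \<bullet> y) * indicator {..r} (norm (y - (n \<bullet> y) *\<^sub>R n)) \<partial>lborel) = ennreal (pi * r\<^sup>2)"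
proof -
  obtain f1 f2 where f: "orthonormal_pair f1 f2" "cross3 f1 f2 = n" using n by (rule obtain_orthonormal_pair)
  have nn: "n \<bullet> n = 1" using n by (simp add: norm_eq_1)
  define g where "g x = (indicator {..r} (norm x) :: ennreal)" for x :: "real^3"
  have [measurable]: "g \<in> borel_measurable borel" unfolding g_def by measurable
  have "(\<integral>\<^sup>+y. indicator {0..1} (n \<bullet> y) * indicator {..r} (norm (y - (n \<bullet> y) *\<^sub>R n)) \<partial>lborel)
    = (\<integral>\<^sup>+x. indicator {0..1} (- (x \<bullet> n) / (- n \<bullet> n)) * g (x + (- (x \<bullet> n) / (- n \<bullet> n)) *\<^sub>R (- n)) \<partial>lborel)"
    by (intro nn_integral_cong) (simp add: nn g_def inner_commute)
  also have "\<dots> = ennreal (\<bar>- n \<bullet> n\<bar> / norm n) * (\<integral>\<^sup>+a. \<integral>\<^sup>+b. g (a *\<^sub>R f1 + b *\<^sub>R f2) \<partial>lborel \<partial>lborel)"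
    using f nn n by (intro nn_integral_slab_projection) auto
  also have "\<dots> = (\<integral>\<^sup>+a. \<integral>\<^sup>+b. indicator (cball (0 :: real \<times> real) r) (a, b) \<partial>lborel \<partial>lborel)"
    using n nn by (simp add: g_def norm_orthonormal_pair[OF f(1)] norm_Pair indicator_def)
  also have "\<dots> = (\<integral>\<^sup>+z. indicator (cball (0 :: real \<times> real) r) z \<partial>(lborel \<Otimes>\<^sub>M lborel))"
    by (rule lborel.nn_integral_fst) (simp only: lborel_prod, intro borel_measurable_indicator, simp)
  also have "\<dots> = ennreal (pi * r\<^sup>2)"
    using r by (simp add: lborel_prod emeasure_cball unit_ball_vol_2 power2_eq_square)
  finally show ?thesis .
qed

lemma nn_integral_inverse_square_greaterThan:
  assumes "\<epsilon> > 0"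
  shows "(\<integral>\<^sup>+r. indicator {\<epsilon><..} r * ennreal (1 / r\<^sup>2) \<partial>lborel) = ennreal (1 / \<epsilon>)"
proof -
  have lim: "((\<lambda>r::real. - 1 / r) \<longlongrightarrow> 0) at_top" by real_asymp
  have "(\<integral>\<^sup>+r. indicator {\<epsilon><..} r * ennreal (1 / r\<^sup>2) \<partial>lborel) = (\<integral>\<^sup>+r. ennreal (1 / r\<^sup>2) * indicator {\<epsilon>..} r \<partial>lborel)"
    by (intro nn_integral_cong_AE, use AE_lborel_singleton[of \<epsilon>] in eventually_elim) (auto simp: indicator_def)
  also have "\<dots> = ennreal (0 - (- 1 / \<epsilon>))"
  proof (rule nn_integral_FTC_atLeast[OF _ _ _ lim])
    fix r assume "\<epsilon> \<le> r"
    then have "r \<noteq> 0" using assms by simp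
    then show "((\<lambda>r. - 1 / r) has_real_derivative 1 / r\<^sup>2) (at r)"
      by (auto intro!: derivative_eq_intros simp: power2_eq_square)
  qed auto
  finally show ?thesis by simp
qed

lemma measurable_circles_above [measurable]: "circles_above \<epsilon> \<in> sets borel"
  and measurable_circles [measurable]: "circles \<in> sets borel"
proof -
  have "open {\<gamma> :: circle. fst (snd \<gamma>) > \<epsilon>}" for \<epsilon> by (intro open_Collect_less continuous_intros)
  moreover have "closed {\<gamma> :: circle. norm (snd (snd \<gamma>)) = 1}" by (intro closed_Collect_eq continuous_intros)
  moreover have "open {\<gamma> :: circle. fst (snd \<gamma>) > 0}" by (intro open_Collect_less continuous_intros)
  moreover have "circles = {\<gamma>. fst (snd \<gamma>) > 0} \<inter> {\<gamma>. norm (snd (snd \<gamma>)) = 1}" by (auto simp: circles_def)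
  moreover have "circles_above \<epsilon> = circles \<inter> {\<gamma>. fst (snd \<gamma>) > \<epsilon>}" by (auto simp: circles_above_def)
  ultimately show "circles_above \<epsilon> \<in> sets borel" "circles \<in> sets borel"
    by (metis borel_open borel_closed sets.Int)+
qed

text \<open>The constant arises in three steps. For a given normal and radius, the centers
  contribute the area pi r^2 times |n \<bullet> \<alpha>'|; the radii give pi/\<epsilon>, since
  r^2/r^4 integrates to 1/\<epsilon>; and the integral of |n \<bullet> \<alpha>'| over the sphere is
  3 times 2 pi/3 times |\<alpha>'|.\<close>

lemma nn_integral_crossings:
  assumes \<epsilon>: "\<epsilon> > 0"
    and \<alpha>: "\<And>t. (\<alpha> has_vector_derivative \<alpha>' t) (at t)" "continuous_on UNIV \<alpha>'"
  shows "(\<integral>\<^sup>+\<gamma>. indicator (circles_above \<epsilon>) \<gamma> * crossings \<alpha> \<gamma> \<partial>circle_measure)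
    = ennreal (2 * pi\<^sup>2 / \<epsilon>) * (\<integral>\<^sup>+t. indicator {0..<1} t * ennreal (norm (\<alpha>' t)) \<partial>lborel)"
proof -
  have c\<alpha>: "continuous_on UNIV \<alpha>"
    using \<alpha>(1) by (meson continuous_at_imp_continuous_on has_vector_derivative_continuous)
  then have [measurable]: "\<alpha> \<in> borel_measurable borel" by (rule borel_measurable_continuous_onI)
  have [measurable]: "\<alpha>' \<in> borel_measurable borel" using \<alpha>(2) by (rule borel_measurable_continuous_onI)
  note [measurable] = borel_measurable_crossings[OF c\<alpha>]
  have [measurable]: "ball (0::real^3) 1 \<in> sets borel" by simp
  define L where "L x = (\<integral>\<^sup>+t. indicator {0..<1} t * ennreal \<bar>sgn x \<bullet> \<alpha>' t\<bar> \<partial>lborel)" for x :: "real^3"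
  have [measurable]: "L \<in> borel_measurable borel" unfolding L_def by measurable
  have centers: "(\<integral>\<^sup>+c. crossings \<alpha> (c, r, sgn x) \<partial>lborel) = ennreal (pi * r\<^sup>2) * L x" if "x \<noteq> 0" "r > 0" for r x
  proof -
    define n where "n = sgn x"
    have n: "norm n = 1" using that by (simp add: n_def norm_sgn)
    define G where "G t c = (indicator {..r} (norm (\<alpha> t - c)) :: ennreal)" for t c
    have [measurable]: "(\<lambda>(t, c). G t c) \<in> borel_measurable (borel \<Otimes>\<^sub>M borel)" unfolding G_def by measurable
    have eq: "crossings \<alpha> (c, r, n) = (\<integral>\<^sup>+t. G t c * indicator {t\<in>{0..<1}. n \<bullet> (\<alpha> t - c) = 0} t \<partial>count_space UNIV)" for c
    proof -
      have "(\<integral>\<^sup>+t. G t c * indicator {t\<in>{0..<1}. n \<bullet> (\<alpha> t - c) = 0} t \<partial>count_space UNIV)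
        = (\<integral>\<^sup>+t. indicator {t\<in>{0..<1}. \<alpha> t \<in> circle_disk (c, r, n)} t \<partial>count_space UNIV)"
        by (intro nn_integral_cong) (auto simp: G_def indicator_def circle_disk_def dist_norm norm_minus_commute inner_commute)
      then show ?thesis by (simp add: crossings_def)
    qed
    have "(\<lambda>c. crossings \<alpha> (c, r, n)) \<in> borel_measurable borel"
      by (intro measurable_compose[OF _ borel_measurable_crossings[OF c\<alpha>]] borel_measurable_continuous_onI continuous_intros)
    then have "(\<integral>\<^sup>+c. crossings \<alpha> (c, r, n) \<partial>lborel) = (\<integral>\<^sup>+t. indicator {0..<1} t * (\<integral>\<^sup>+y. indicator {0..1} (n \<bullet> y) * ennreal \<bar>n \<bullet> \<alpha>' t\<bar>
        * G t (\<alpha> t - (y - (n \<bullet> y) *\<^sub>R n)) \<partial>lborel) \<partial>lborel)"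
      unfolding eq by (intro nn_integral_centers[OF n \<alpha>]) measurable
    also have "\<dots> = (\<integral>\<^sup>+t. ennreal (pi * r\<^sup>2) * (indicator {0..<1} t * ennreal \<bar>n \<bullet> \<alpha>' t\<bar>) \<partial>lborel)"
    proof (rule nn_integral_cong)
      fix t
      have "(\<integral>\<^sup>+y. indicator {0..1} (n \<bullet> y) * ennreal \<bar>n \<bullet> \<alpha>' t\<bar> * G t (\<alpha> t - (y - (n \<bullet> y) *\<^sub>R n)) \<partial>lborel)
        = (\<integral>\<^sup>+y. ennreal \<bar>n \<bullet> \<alpha>' t\<bar> * (indicator {0..1} (n \<bullet> y) * indicator {..r} (norm (y - (n \<bullet> y) *\<^sub>R n))) \<partial>lborel)"
        by (simp add: G_def mult_ac)
      also have "\<dots> = ennreal \<bar>n \<bullet> \<alpha>' t\<bar> * ennreal (pi * r\<^sup>2)"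
        using that(2) by (subst nn_integral_cmult) (simp_all add: nn_integral_disk_centers[OF n])
      finally show "indicator {0..<1} t * (\<integral>\<^sup>+y. indicator {0..1} (n \<bullet> y) * ennreal \<bar>n \<bullet> \<alpha>' t\<bar> * G t (\<alpha> t - (y - (n \<bullet> y) *\<^sub>R n)) \<partial>lborel)
        = ennreal (pi * r\<^sup>2) * (indicator {0..<1} t * ennreal \<bar>n \<bullet> \<alpha>' t\<bar>)" by (simp add: mult_ac)
    qed
    also have "\<dots> = ennreal (pi * r\<^sup>2) * L x"
      unfolding L_def n_def by (rule nn_integral_cmult) measurable
    finally show ?thesis by (simp add: n_def)
  qed
  have radii: "(\<integral>\<^sup>+r. ennreal (1 / r ^ 4) * (\<integral>\<^sup>+c. indicator (circles_above \<epsilon>) (c, r, sgn x) * crossings \<alpha> (c, r, sgn x) \<partial>lborel) \<partial>lborel)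
    = ennreal (pi / \<epsilon>) * L x" if "x \<noteq> 0" for x
  proof -
    have "(\<integral>\<^sup>+r. ennreal (1 / r ^ 4) * (\<integral>\<^sup>+c. indicator (circles_above \<epsilon>) (c, r, sgn x) * crossings \<alpha> (c, r, sgn x) \<partial>lborel) \<partial>lborel)
      = (\<integral>\<^sup>+r. (ennreal pi * L x) * (indicator {\<epsilon><..} r * ennreal (1 / r\<^sup>2)) \<partial>lborel)"
    proof (rule nn_integral_cong)
      fix r :: real
      show "ennreal (1 / r ^ 4) * (\<integral>\<^sup>+c. indicator (circles_above \<epsilon>) (c, r, sgn x) * crossings \<alpha> (c, r, sgn x) \<partial>lborel)
        = (ennreal pi * L x) * (indicator {\<epsilon><..} r * ennreal (1 / r\<^sup>2))"
      proof (cases "r > \<epsilon>")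
        case True
        then have ind: "indicator (circles_above \<epsilon>) (c, r, sgn x) = (1::ennreal)" for c
          using \<epsilon> that by (simp add: circles_above_def circles_def norm_sgn)
        have "r > 0" using True \<epsilon> by simp
        then have "ennreal (1 / r ^ 4) * ennreal (pi * r\<^sup>2) = ennreal pi * ennreal (1 / r\<^sup>2)"
          by (simp add: ennreal_mult'[symmetric] power_numeral_reduce field_simps)
        then show ?thesis using True \<open>r > 0\<close> unfolding ind
          by (simp add: centers[OF that] mult.assoc[symmetric]) (simp add: mult_ac)
      next
        case False
        then have "indicator (circles_above \<epsilon>) (c, r, sgn x) = (0::ennreal)" for c by (simp add: circles_above_def)
        then show ?thesis using False by simp
      qed
    qed
    also have "\<dots> = (ennreal pi * L x) * ennreal (1 / \<epsilon>)"
      by (subst nn_integral_cmult) (simp_all add: nn_integral_inverse_square_greaterThan[OF \<epsilon>])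
    also have "\<dots> = ennreal (pi / \<epsilon>) * L x"
      using \<epsilon> ennreal_mult'[of pi "1 / \<epsilon>"] by (simp add: mult_ac)
    finally show ?thesis .
  qed
  have "(\<integral>\<^sup>+\<gamma>. indicator (circles_above \<epsilon>) \<gamma> * crossings \<alpha> \<gamma> \<partial>circle_measure)
    = (\<integral>\<^sup>+x. 3 * indicator (ball 0 1) x * (\<integral>\<^sup>+r. ennreal (1 / r ^ 4) *
      (\<integral>\<^sup>+c. indicator (circles_above \<epsilon>) (c, r, sgn x) * crossings \<alpha> (c, r, sgn x) \<partial>lborel) \<partial>lborel) \<partial>lborel)"
    by (rule nn_integral_circle_measure) measurable
  also have "\<dots> = (\<integral>\<^sup>+x. 3 * indicator (ball 0 1) x * (ennreal (pi / \<epsilon>) * L x) \<partial>lborel)"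
    by (intro nn_integral_cong_AE, use AE_lborel_singleton[of "0::real^3"] in eventually_elim) (simp add: radii)
  also have "\<dots> = (\<integral>\<^sup>+x. (\<integral>\<^sup>+t. ennreal (3 * pi / \<epsilon>) * (indicator {0..<1} t * (indicator (ball 0 1) x * ennreal \<bar>sgn x \<bullet> \<alpha>' t\<bar>)) \<partial>lborel) \<partial>lborel)"
  proof (rule nn_integral_cong)
    fix x :: "real^3"
    have c: "3 * ennreal (pi / \<epsilon>) = ennreal (3 * pi / \<epsilon>)" using ennreal_mult'[of 3 "pi / \<epsilon>"] by simp
    have "(\<integral>\<^sup>+t. ennreal (3 * pi / \<epsilon>) * (indicator {0..<1} t * (indicator (ball 0 1) x * ennreal \<bar>sgn x \<bullet> \<alpha>' t\<bar>)) \<partial>lborel)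
      = (\<integral>\<^sup>+t. (ennreal (3 * pi / \<epsilon>) * indicator (ball 0 1) x) * (indicator {0..<1} t * ennreal \<bar>sgn x \<bullet> \<alpha>' t\<bar>) \<partial>lborel)"
      by (simp add: mult_ac)
    also have "\<dots> = (ennreal (3 * pi / \<epsilon>) * indicator (ball 0 1) x) * L x"
      unfolding L_def by (rule nn_integral_cmult) measurable
    finally have A: "(\<integral>\<^sup>+t. ennreal (3 * pi / \<epsilon>) * (indicator {0..<1} t * (indicator (ball 0 1) x * ennreal \<bar>sgn x \<bullet> \<alpha>' t\<bar>)) \<partial>lborel)
      = (ennreal (3 * pi / \<epsilon>) * indicator (ball 0 1) x) * L x" .
    show "3 * indicator (ball 0 1) x * (ennreal (pi / \<epsilon>) * L x)
      = (\<integral>\<^sup>+t. ennreal (3 * pi / \<epsilon>) * (indicator {0..<1} t * (indicator (ball 0 1) x * ennreal \<bar>sgn x \<bullet> \<alpha>' t\<bar>)) \<partial>lborel)"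
      unfolding A unfolding c[symmetric] by (simp only: ac_simps)
  qed
  also have "\<dots> = (\<integral>\<^sup>+t. (\<integral>\<^sup>+x. ennreal (3 * pi / \<epsilon>) * (indicator {0..<1} t * (indicator (ball 0 1) x * ennreal \<bar>sgn x \<bullet> \<alpha>' t\<bar>)) \<partial>lborel) \<partial>lborel)"
    by (rule lborel_pair.Fubini') measurable
  also have "\<dots> = (\<integral>\<^sup>+t. ennreal (2 * pi\<^sup>2 / \<epsilon>) * (indicator {0..<1} t * ennreal (norm (\<alpha>' t))) \<partial>lborel)"
  proof (rule nn_integral_cong)
    fix t
    have c: "ennreal (3 * pi / \<epsilon>) * ennreal (2 * pi / 3 * norm (\<alpha>' t)) = ennreal (2 * pi\<^sup>2 / \<epsilon>) * ennreal (norm (\<alpha>' t))"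
      using \<epsilon> by (simp add: ennreal_mult'[symmetric] power2_eq_square)
    show "(\<integral>\<^sup>+x. ennreal (3 * pi / \<epsilon>) * (indicator {0..<1} t * (indicator (ball 0 1) x * ennreal \<bar>sgn x \<bullet> \<alpha>' t\<bar>)) \<partial>lborel)
      = ennreal (2 * pi\<^sup>2 / \<epsilon>) * (indicator {0..<1} t * ennreal (norm (\<alpha>' t)))"
      using c by (cases "t \<in> {0..<1}") (simp_all add: nn_integral_cmult nn_integral_ball_abs_inner_sgn)
  qed
  also have "\<dots> = ennreal (2 * pi\<^sup>2 / \<epsilon>) * (\<integral>\<^sup>+t. indicator {0..<1} t * ennreal (norm (\<alpha>' t)) \<partial>lborel)"
    by (rule nn_integral_cmult) measurable
  finally show ?thesis .
qed

section \<open>Projection of normals to the plane orthogonal to a chord\<close>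

lemma pred_atMost [measurable (raw)]:
  fixes f g :: "'a \<Rightarrow> real"
  assumes [measurable]: "f \<in> borel_measurable M" "g \<in> borel_measurable M"
  shows "Measurable.pred M (\<lambda>x. f x \<in> {..g x})"
  unfolding atMost_iff by measurable

text \<open>A direction that is transversal to \<open>w\<close> and takes only three values:
  \<open>nn_integral_slices\<close> needs a fixed direction, while no single one need be transversal
  to all chords.\<close>

definition transversal_axis :: "real^3 \<Rightarrow> real^3" where
  "transversal_axis w = (if w $ 1 \<noteq> 0 then axis 1 1 else if w $ 2 \<noteq> 0 then axis 2 1 else axis 3 1)"

lemma transversal_axis_inner: "w \<noteq> 0 \<Longrightarrow> transversal_axis w \<bullet> w \<noteq> 0"
  by (auto simp: transversal_axis_def inner_axis vec_eq_iff forall_3 inner_commute[of "axis _ _"])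

lemma measurable_transversal_axis [measurable]: "transversal_axis \<in> borel_measurable borel"
  unfolding transversal_axis_def[abs_def] by measurable

text \<open>The multiple of the axis that has to be added to \<open>x\<close> in order to reach the
  plane orthogonal to \<open>w\<close>.\<close>

definition axis_coord :: "real^3 \<Rightarrow> real^3 \<Rightarrow> real" where
  "axis_coord w x = - (x \<bullet> w) / (transversal_axis w \<bullet> w)"

definition axis_proj :: "real^3 \<Rightarrow> real^3 \<Rightarrow> real^3" where
  "axis_proj w x = x + axis_coord w x *\<^sub>R transversal_axis w"

lemma axis_proj_inner: "w \<noteq> 0 \<Longrightarrow> axis_proj w x \<bullet> w = 0"
  using transversal_axis_inner[of w] by (simp add: axis_proj_def axis_coord_def inner_add_left inner_diff_left)

lemma measurable_axis_coord [measurable (raw)]: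
  assumes [measurable]: "f \<in> borel_measurable M" "g \<in> borel_measurable M"
  shows "(\<lambda>x. axis_coord (f x) (g x)) \<in> borel_measurable M"
  unfolding axis_coord_def by measurable

lemma measurable_axis_proj [measurable (raw)]:
  assumes [measurable]: "f \<in> borel_measurable M" "g \<in> borel_measurable M"
  shows "(\<lambda>x. axis_proj (f x) (g x)) \<in> borel_measurable M"
  unfolding axis_proj_def by measurable

text \<open>The area formula is now applied to the condition
  \<open>x \<bullet> (\<beta> t - p) = 0\<close> on the normal. For an axis \<open>e\<close>, the
  line through \<open>x\<close> in the direction \<open>e\<close> meets the plane orthogonal to the
  chord \<open>w t\<close> at \<open>- (x \<bullet> w t) / (e \<bullet> w t)\<close>, which plays
  the role of \<open>f t x\<close> in \<open>nn_integral_slices\<close>. The parameters are split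
  according to their axis, and the three formulas are added.\<close>

lemma nn_integral_second_crossings:
  fixes \<beta> \<beta>' :: "real \<Rightarrow> real^3" and \<Theta> :: "real^3 \<Rightarrow> ennreal" and z :: "real^3 \<Rightarrow> real^3"
  assumes \<beta>: "\<And>t. (\<beta> has_vector_derivative \<beta>' t) (at t)" "continuous_on UNIV \<beta>'"
    and [measurable]: "\<Theta> \<in> borel_measurable borel" "z \<in> borel_measurable borel"
  shows "(\<integral>\<^sup>+x. \<Theta> x * second_crossings \<beta> \<beta>' \<sigma> x (z x) p r u \<partial>lborel)
    = (\<integral>\<^sup>+t. indicator {0..<1} t * indicator (- {p}) (\<beta> t) * (\<integral>\<^sup>+x. indicator {0..1} (axis_coord (\<beta> t - p) x)
        * ennreal (\<bar>axis_proj (\<beta> t - p) x \<bullet> \<beta>' t\<bar> / \<bar>transversal_axis (\<beta> t - p) \<bullet> (\<beta> t - p)\<bar>)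
        * (\<Theta> (axis_proj (\<beta> t - p) x) * indicator {..r} (norm (\<beta> t - p + z (axis_proj (\<beta> t - p) x)))
          * indicator {0<..} (\<sigma> * ((axis_proj (\<beta> t - p) x \<bullet> u) * (axis_proj (\<beta> t - p) x \<bullet> \<beta>' t)))) \<partial>lborel) \<partial>lborel)"
proof -
  have c\<beta>: "continuous_on UNIV \<beta>"
    using \<beta>(1) by (meson continuous_at_imp_continuous_on has_vector_derivative_continuous)
  then have [measurable]: "\<beta> \<in> borel_measurable borel" by (rule borel_measurable_continuous_onI)
  have [measurable]: "\<beta>' \<in> borel_measurable borel" using \<beta>(2) by (rule borel_measurable_continuous_onI)
  note cs = c\<beta>[THEN continuous_on_curve] \<beta>(2)[THEN continuous_on_curve]
  define w where "w t = \<beta> t - p" for t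
  have [measurable]: "w \<in> borel_measurable borel" unfolding w_def by measurable
  define \<E> :: "(real^3) set" where "\<E> = {axis 1 1, axis 2 1, axis 3 1}"
  have fin: "finite \<E>" by (simp add: \<E>_def)
  define T where "T e = {t\<in>{0..<1}. w t \<noteq> 0 \<and> transversal_axis (w t) = e}" for e
  have [measurable]: "T e \<in> sets borel" for e unfolding T_def by measurable
  define G where "G t x = \<Theta> x * indicator {..r} (norm (w t + z x)) * indicator {0<..} (\<sigma> * ((x \<bullet> u) * (x \<bullet> \<beta>' t)))" for t x
  have G_meas[measurable]: "(\<lambda>(t, x). G t x) \<in> borel_measurable (borel \<Otimes>\<^sub>M borel)" unfolding G_def by measurable
  \<comment> \<open>Each parameter with a nonzero chord belongs to exactly one of the sets
    \<open>T e\<close>.\<close>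
  have T_sum: "(\<Sum>e\<in>\<E>. indicator (T e) t * F e) = indicator {0..<1} t * indicator (- {p}) (\<beta> t) * F (transversal_axis (w t))"
    for t and F :: "real^3 \<Rightarrow> ennreal"
  proof -
    have "(\<Sum>e\<in>\<E>. indicator (T e) t * F e) = (\<Sum>e\<in>{transversal_axis (w t)}. indicator (T e) t * F e)"
      by (rule sum.mono_neutral_right[OF fin]) (auto simp: T_def \<E>_def transversal_axis_def)
    then show ?thesis by (auto simp: T_def w_def indicator_def)
  qed
  have slice: "(\<integral>\<^sup>+x. (\<integral>\<^sup>+t. G t x * indicator {t\<in>T e. x \<bullet> w t = 0} t \<partial>count_space UNIV) \<partial>lborel)
    = (\<integral>\<^sup>+t. indicator (T e) t * (\<integral>\<^sup>+x. indicator {0..1} (- (x \<bullet> w t) / (e \<bullet> w t))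
        * ennreal \<bar>- ((x + (- (x \<bullet> w t) / (e \<bullet> w t)) *\<^sub>R e) \<bullet> \<beta>' t) / (e \<bullet> w t)\<bar>
        * G t (x + (- (x \<bullet> w t) / (e \<bullet> w t)) *\<^sub>R e) \<partial>lborel) \<partial>lborel)"
    and slice_meas: "(\<lambda>x. (\<integral>\<^sup>+t. G t x * indicator {t\<in>T e. x \<bullet> w t = 0} t \<partial>count_space UNIV)) \<in> borel_measurable borel"
    if e: "e \<in> \<E>" for e
  proof -
    \<comment> \<open>The open set on which the axis is transversal and the quotient is
      differentiable; \<open>T e\<close> is a Borel subset.\<close>
    define U where "U = {t. e \<bullet> w t \<noteq> 0}"
    have cw: "continuous_on UNIV w" unfolding w_def by (intro continuous_intros c\<beta>)
    have U: "open U" unfolding U_def by (intro open_Collect_neq continuous_intros cw)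
    have TU: "T e \<subseteq> U" using transversal_axis_inner by (auto simp: T_def U_def)
    \<comment> \<open>\<open>z\<close> is merely Borel, so the fibre count is first taken with an
      independent variable \<open>y\<close> in place of \<open>z x\<close>; the composition with the
      Borel map \<open>x \<mapsto> (x, z x)\<close> comes afterwards.\<close>
    define A where "A x y = emeasure (count_space UNIV) {t\<in>T e. x \<bullet> w t = 0 \<and> norm (w t + y) \<le> r \<and> \<sigma> * ((x \<bullet> u) * (x \<bullet> \<beta>' t)) > 0}" for x y
    have "sigma_compact {q :: ((real^3) \<times> (real^3)) \<times> real. snd q \<in> T e \<and> fst (fst q) \<bullet> w (snd q) = 0
        \<and> norm (w (snd q) + snd (fst q)) \<le> r \<and> 0 < \<sigma> * ((fst (fst q) \<bullet> u) * (fst (fst q) \<bullet> \<beta>' (snd q)))}"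
    proof (rule sigma_compact_Collect_conj)
      have ne: "axis 1 1 \<noteq> (axis 2 1 :: real^3)" "axis 1 1 \<noteq> (axis 3 1 :: real^3)" "axis 2 1 \<noteq> (axis 3 1 :: real^3)"
        by (simp_all add: axis_eq_axis)
      have nzw: "w t \<noteq> 0 \<longleftrightarrow> w t $ 1 \<noteq> 0 \<or> w t $ 2 \<noteq> 0 \<or> w t $ 3 \<noteq> 0" for t
        by (simp add: vec_eq_iff forall_3)
      consider "e = axis 1 1" | "e = axis 2 1" | "e = axis 3 1" using e by (auto simp: \<E>_def)
      then show "sigma_compact {q :: ((real^3) \<times> (real^3)) \<times> real. snd q \<in> T e}"
      proof cases
        case 1
        have "t \<in> T e \<longleftrightarrow> 0 \<le> t \<and> t < 1 \<and> w t $ 1 \<noteq> 0" for t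
          unfolding T_def transversal_axis_def 1 mem_Collect_eq nzw using ne by simp
        then show ?thesis
          by (simp only:) (intro sigma_compact_Collect_conj sigma_compact_Collect continuous_intros continuous_on_curve[OF cw])
      next
        case 2
        have "t \<in> T e \<longleftrightarrow> 0 \<le> t \<and> t < 1 \<and> w t $ 1 = 0 \<and> w t $ 2 \<noteq> 0" for t
          unfolding T_def transversal_axis_def 2 mem_Collect_eq nzw using ne by simp
        then show ?thesis
          by (simp only:) (intro sigma_compact_Collect_conj sigma_compact_Collect continuous_intros continuous_on_curve[OF cw])
      next
        case 3
        have "t \<in> T e \<longleftrightarrow> 0 \<le> t \<and> t < 1 \<and> w t $ 1 = 0 \<and> w t $ 2 = 0 \<and> w t $ 3 \<noteq> 0" for t
          unfolding T_def transversal_axis_def 3 mem_Collect_eq nzw using ne by auto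
        then show ?thesis
          by (simp only:) (intro sigma_compact_Collect_conj sigma_compact_Collect continuous_intros continuous_on_curve[OF cw])
      qed
      show "sigma_compact {q :: ((real^3) \<times> (real^3)) \<times> real. fst (fst q) \<bullet> w (snd q) = 0
        \<and> norm (w (snd q) + snd (fst q)) \<le> r \<and> 0 < \<sigma> * ((fst (fst q) \<bullet> u) * (fst (fst q) \<bullet> \<beta>' (snd q)))}"
        by (intro sigma_compact_Collect_conj sigma_compact_Collect continuous_intros continuous_on_curve[OF cw] cs)
    qed
    from borel_measurable_card_fibre[OF this]
    have A_meas: "(\<lambda>(x, y). A x y) \<in> borel_measurable (borel \<Otimes>\<^sub>M borel)" by (simp add: A_def split_def borel_prod)
    have "(\<lambda>x. (\<lambda>(x, y). A x y) (x, z x)) \<in> borel_measurable borel"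
      by (rule measurable_compose[OF _ A_meas]) measurable
    then have [measurable]: "(\<lambda>x. A x (z x)) \<in> borel_measurable borel" by simp
    have count: "(\<integral>\<^sup>+t. G t x * indicator {t\<in>T e. x \<bullet> w t = 0} t \<partial>count_space UNIV) = \<Theta> x * A x (z x)" for x
    proof -
      have "(\<integral>\<^sup>+t. G t x * indicator {t\<in>T e. x \<bullet> w t = 0} t \<partial>count_space UNIV)
        = (\<integral>\<^sup>+t. \<Theta> x * indicator {t\<in>T e. x \<bullet> w t = 0 \<and> norm (w t + z x) \<le> r \<and> \<sigma> * ((x \<bullet> u) * (x \<bullet> \<beta>' t)) > 0} t \<partial>count_space UNIV)"
        by (intro nn_integral_cong) (auto simp: G_def indicator_def)
      then show ?thesis by (simp add: nn_integral_cmult_indicator A_def)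
    qed
    show S: "(\<lambda>x. (\<integral>\<^sup>+t. G t x * indicator {t\<in>T e. x \<bullet> w t = 0} t \<partial>count_space UNIV)) \<in> borel_measurable borel"
      unfolding count by measurable
    have der_w: "((\<lambda>t. x \<bullet> w t) has_real_derivative x \<bullet> \<beta>' t) (at t)" for x t
    proof -
      have "(w has_vector_derivative \<beta>' t - 0) (at t)"
        unfolding w_def by (intro has_vector_derivative_diff \<beta>(1) has_vector_derivative_const)
      from has_real_derivative_inner[OF has_vector_derivative_const this, of x] show ?thesis by simp
    qed
    show "(\<integral>\<^sup>+x. (\<integral>\<^sup>+t. G t x * indicator {t\<in>T e. x \<bullet> w t = 0} t \<partial>count_space UNIV) \<partial>lborel)
    = (\<integral>\<^sup>+t. indicator (T e) t * (\<integral>\<^sup>+x. indicator {0..1} (- (x \<bullet> w t) / (e \<bullet> w t))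
        * ennreal \<bar>- ((x + (- (x \<bullet> w t) / (e \<bullet> w t)) *\<^sub>R e) \<bullet> \<beta>' t) / (e \<bullet> w t)\<bar>
        * G t (x + (- (x \<bullet> w t) / (e \<bullet> w t)) *\<^sub>R e) \<partial>lborel) \<partial>lborel)"
    proof (rule nn_integral_slices[OF U _ TU _ _ _ _ G_meas _ S])
      show "T e \<in> sets borel" by measurable
      show "((\<lambda>t. - (x \<bullet> w t) / (e \<bullet> w t)) has_real_derivative
          - ((x + (- (x \<bullet> w t) / (e \<bullet> w t)) *\<^sub>R e) \<bullet> \<beta>' t) / (e \<bullet> w t)) (at t)" if "t \<in> U" for x t
      proof -
        have nz: "e \<bullet> w t \<noteq> 0" using that by (simp add: U_def)
        have "((\<lambda>t. - (x \<bullet> w t) / (e \<bullet> w t)) has_real_derivative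
          (- (x \<bullet> \<beta>' t) * (e \<bullet> w t) - - (x \<bullet> w t) * (e \<bullet> \<beta>' t)) / ((e \<bullet> w t) * (e \<bullet> w t))) (at t)"
          by (rule DERIV_divide[OF DERIV_minus[OF der_w] der_w nz])
        \<comment> \<open>The numerator of the quotient rule is \<open>- (e \<bullet> w t)\<close>
          times the inner product of \<open>\<beta>' t\<close> with the projection of
          \<open>x\<close> along \<open>e\<close>.\<close>
        moreover have "(- (x \<bullet> \<beta>' t) * (e \<bullet> w t) - - (x \<bullet> w t) * (e \<bullet> \<beta>' t)) / ((e \<bullet> w t) * (e \<bullet> w t))
          = - ((x + (- (x \<bullet> w t) / (e \<bullet> w t)) *\<^sub>R e) \<bullet> \<beta>' t) / (e \<bullet> w t)"
          using nz by (simp add: inner_add_left inner_diff_left field_simps)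
        ultimately show ?thesis by simp
      qed
      show "continuous_on U (\<lambda>t. - ((x + (- (x \<bullet> w t) / (e \<bullet> w t)) *\<^sub>R e) \<bullet> \<beta>' t) / (e \<bullet> w t))" for x
        by (intro continuous_intros continuous_on_subset[OF cw] continuous_on_subset[OF \<beta>(2)]) (auto simp: U_def)
      show "(x + \<tau> *\<^sub>R e) \<bullet> w t = 0 \<longleftrightarrow> - (x \<bullet> w t) / (e \<bullet> w t) = \<tau>" if "t \<in> T e" for t x \<tau>
      proof -
        have nz: "e \<bullet> w t \<noteq> 0" using that TU by (auto simp: U_def)
        have "(x + \<tau> *\<^sub>R e) \<bullet> w t = x \<bullet> w t + \<tau> * (e \<bullet> w t)" by (simp add: inner_add_left)
        then show ?thesis unfolding nonzero_divide_eq_eq[OF nz] by auto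
      qed
      show "(\<lambda>(t, x). - (x \<bullet> w t) / (e \<bullet> w t)) \<in> borel_measurable (borel \<Otimes>\<^sub>M borel)"
        "(\<lambda>(t, x). - ((x + (- (x \<bullet> w t) / (e \<bullet> w t)) *\<^sub>R e) \<bullet> \<beta>' t) / (e \<bullet> w t)) \<in> borel_measurable (borel \<Otimes>\<^sub>M borel)"
        by measurable
    qed
  qed
  have "(\<integral>\<^sup>+x. \<Theta> x * second_crossings \<beta> \<beta>' \<sigma> x (z x) p r u \<partial>lborel)
    = (\<integral>\<^sup>+x. (\<Sum>e\<in>\<E>. \<integral>\<^sup>+t. G t x * indicator {t\<in>T e. x \<bullet> w t = 0} t \<partial>count_space UNIV) \<partial>lborel)"
  proof (rule nn_integral_cong)
    fix x
    let ?Z = "{t\<in>{0..<1}. x \<bullet> (\<beta> t - p) = 0 \<and> norm (\<beta> t - p + z x) \<le> r \<and> \<beta> t \<noteq> p \<and> \<sigma> * ((x \<bullet> u) * (x \<bullet> \<beta>' t)) > 0}"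
    have "\<Theta> x * second_crossings \<beta> \<beta>' \<sigma> x (z x) p r u = (\<integral>\<^sup>+t. \<Theta> x * indicator ?Z t \<partial>count_space UNIV)"
      by (simp add: second_crossings_def nn_integral_cmult_indicator)
    also have "\<dots> = (\<integral>\<^sup>+t. (\<Sum>e\<in>\<E>. G t x * indicator {t\<in>T e. x \<bullet> w t = 0} t) \<partial>count_space UNIV)"
    proof (rule nn_integral_cong)
      fix t
      have "(\<Sum>e\<in>\<E>. G t x * indicator {t\<in>T e. x \<bullet> w t = 0} t) = (\<Sum>e\<in>\<E>. indicator (T e) t * (G t x * indicator {0} (x \<bullet> w t)))"
        by (intro sum.cong) (auto simp: indicator_def)
      also have "\<dots> = indicator {0..<1} t * indicator (- {p}) (\<beta> t) * (G t x * indicator {0} (x \<bullet> w t))" by (rule T_sum)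
      also have "\<dots> = \<Theta> x * indicator ?Z t" by (auto simp: G_def w_def indicator_def)
      finally show "\<Theta> x * indicator ?Z t = (\<Sum>e\<in>\<E>. G t x * indicator {t\<in>T e. x \<bullet> w t = 0} t)" by simp
    qed
    also have "\<dots> = (\<Sum>e\<in>\<E>. \<integral>\<^sup>+t. G t x * indicator {t\<in>T e. x \<bullet> w t = 0} t \<partial>count_space UNIV)"
      by (rule nn_integral_sum) simp
    finally show "\<Theta> x * second_crossings \<beta> \<beta>' \<sigma> x (z x) p r u
      = (\<Sum>e\<in>\<E>. \<integral>\<^sup>+t. G t x * indicator {t\<in>T e. x \<bullet> w t = 0} t \<partial>count_space UNIV)" .
  qed
  also have "\<dots> = (\<Sum>e\<in>\<E>. \<integral>\<^sup>+x. (\<integral>\<^sup>+t. G t x * indicator {t\<in>T e. x \<bullet> w t = 0} t \<partial>count_space UNIV) \<partial>lborel)"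
    by (rule nn_integral_sum) (simp add: slice_meas)
  also have "\<dots> = (\<Sum>e\<in>\<E>. \<integral>\<^sup>+t. indicator (T e) t * (\<integral>\<^sup>+x. indicator {0..1} (- (x \<bullet> w t) / (e \<bullet> w t))
        * ennreal \<bar>- ((x + (- (x \<bullet> w t) / (e \<bullet> w t)) *\<^sub>R e) \<bullet> \<beta>' t) / (e \<bullet> w t)\<bar>
        * G t (x + (- (x \<bullet> w t) / (e \<bullet> w t)) *\<^sub>R e) \<partial>lborel) \<partial>lborel)"
    by (intro sum.cong slice refl)
  also have "\<dots> = (\<integral>\<^sup>+t. (\<Sum>e\<in>\<E>. indicator (T e) t * (\<integral>\<^sup>+x. indicator {0..1} (- (x \<bullet> w t) / (e \<bullet> w t))
        * ennreal \<bar>- ((x + (- (x \<bullet> w t) / (e \<bullet> w t)) *\<^sub>R e) \<bullet> \<beta>' t) / (e \<bullet> w t)\<bar>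
        * G t (x + (- (x \<bullet> w t) / (e \<bullet> w t)) *\<^sub>R e) \<partial>lborel)) \<partial>lborel)"
    by (rule nn_integral_sum[symmetric]) measurable
  finally show ?thesis
    unfolding T_sum by (simp add: G_def w_def axis_coord_def axis_proj_def abs_divide)
qed

text \<open>After the centers, the normals \<open>x\<close> are integrated with \<open>s\<close>,
  \<open>r\<close> and the slab variable \<open>y\<close> fixed; hence the exchanges of integrals.
  Once both crossings are parametrized, \<open>r\<close> and \<open>y\<close> run over all disks
  that have a given normal and contain two given points, and
  \<open>nn_integral_disks_through_two_points\<close> contributes the factor 8/(3|w|).\<close>

lemma nn_integral_crossing_pairs:
  fixes \<alpha> \<alpha>' \<beta> \<beta>' :: "real \<Rightarrow> real^3"
  assumes \<alpha>: "\<And>t. (\<alpha> has_vector_derivative \<alpha>' t) (at t)" "continuous_on UNIV \<alpha>'"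
    and \<beta>: "\<And>t. (\<beta> has_vector_derivative \<beta>' t) (at t)" "continuous_on UNIV \<beta>'"
  shows "(\<integral>\<^sup>+\<gamma>. indicator circles \<gamma> * crossing_pairs \<alpha> \<alpha>' \<beta> \<beta>' \<sigma> \<gamma> \<partial>circle_measure)
    = (\<integral>\<^sup>+s. \<integral>\<^sup>+t. indicator {0..<1} s * indicator {0..<1} t * indicator (- {0}) (\<beta> t - \<alpha> s) *
        (\<integral>\<^sup>+x. indicator {0..1} (axis_coord (\<beta> t - \<alpha> s) x)
          * ennreal (\<bar>axis_proj (\<beta> t - \<alpha> s) x \<bullet> \<beta>' t\<bar> / \<bar>transversal_axis (\<beta> t - \<alpha> s) \<bullet> (\<beta> t - \<alpha> s)\<bar>)
          * (3 * indicator (ball 0 1) (axis_proj (\<beta> t - \<alpha> s) x) * ennreal \<bar>sgn (axis_proj (\<beta> t - \<alpha> s) x) \<bullet> \<alpha>' s\<bar>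
            * indicator {0<..} (\<sigma> * ((axis_proj (\<beta> t - \<alpha> s) x \<bullet> \<alpha>' s) * (axis_proj (\<beta> t - \<alpha> s) x \<bullet> \<beta>' t)))
            * ennreal (8 / (3 * norm (\<beta> t - \<alpha> s)))) \<partial>lborel) \<partial>lborel \<partial>lborel)"
proof -
  have c\<alpha>: "continuous_on UNIV \<alpha>"
    using \<alpha>(1) by (meson continuous_at_imp_continuous_on has_vector_derivative_continuous)
  then have [measurable]: "\<alpha> \<in> borel_measurable borel" by (rule borel_measurable_continuous_onI)
  have [measurable]: "\<alpha>' \<in> borel_measurable borel" using \<alpha>(2) by (rule borel_measurable_continuous_onI)
  have c\<beta>: "continuous_on UNIV \<beta>"
    using \<beta>(1) by (meson continuous_at_imp_continuous_on has_vector_derivative_continuous)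
  then have [measurable]: "\<beta> \<in> borel_measurable borel" by (rule borel_measurable_continuous_onI)
  have [measurable]: "\<beta>' \<in> borel_measurable borel" using \<beta>(2) by (rule borel_measurable_continuous_onI)
  note [measurable] = borel_measurable_crossing_pairs[OF c\<alpha> \<alpha>(2) c\<beta> \<beta>(2)]
  note [measurable (raw)] = measurable_second_crossings[OF c\<beta> \<beta>(2)]
  have [measurable]: "ball (0::real^3) 1 \<in> sets borel" by simp
  define z where "z x y = y - (sgn x \<bullet> y) *\<^sub>R sgn x" for x y :: "real^3"
  have [measurable (raw)]: "(\<lambda>\<omega>. z (f \<omega>) (g \<omega>)) \<in> borel_measurable M"
    if [measurable]: "f \<in> borel_measurable M" "g \<in> borel_measurable M" for f g and M :: "'m measure"
    unfolding z_def by measurable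
  \<comment> \<open>Everything in the integrand except the count of second crossings, as a function
    of the normal \<open>x\<close>.\<close>
  define \<Theta> where "\<Theta> s r y x = (3 * indicator (ball 0 1) x * ennreal \<bar>sgn x \<bullet> \<alpha>' s\<bar> * (indicator {0<..} r * ennreal (1 / r ^ 4) *
     indicator {0..1} (sgn x \<bullet> y) * indicator {..r} (norm (z x y))) :: ennreal)" for s r and x y :: "real^3"
  have \<Theta>_meas[measurable (raw)]: "(\<lambda>\<omega>. \<Theta> (f1 \<omega>) (f2 \<omega>) (f3 \<omega>) (f4 \<omega>)) \<in> borel_measurable M"
    if [measurable]: "f1 \<in> borel_measurable M" "f2 \<in> borel_measurable M" "f3 \<in> borel_measurable M" "f4 \<in> borel_measurable M"
    for f1 f2 f3 f4 and M :: "'m measure"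
    unfolding \<Theta>_def by measurable
  define I where "I s = (indicator {0..<1} s :: ennreal)" for s :: real
  have [measurable]: "I \<in> borel_measurable borel" unfolding I_def by measurable
  define C where "C s r y x = \<Theta> s r y x * second_crossings \<beta> \<beta>' \<sigma> x (z x y) (\<alpha> s) r (\<alpha>' s)" for s r x y
  have [measurable (raw)]: "(\<lambda>\<omega>. C (f1 \<omega>) (f2 \<omega>) (f3 \<omega>) (f4 \<omega>)) \<in> borel_measurable M"
    if [measurable]: "f1 \<in> borel_measurable M" "f2 \<in> borel_measurable M" "f3 \<in> borel_measurable M" "f4 \<in> borel_measurable M"
    for f1 f2 f3 f4 and M :: "'m measure"
    unfolding C_def by measurable
  have "(\<integral>\<^sup>+\<gamma>. indicator circles \<gamma> * crossing_pairs \<alpha> \<alpha>' \<beta> \<beta>' \<sigma> \<gamma> \<partial>circle_measure)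
    = (\<integral>\<^sup>+x. 3 * indicator (ball 0 1) x * (\<integral>\<^sup>+r. ennreal (1 / r ^ 4) *
      (\<integral>\<^sup>+c. indicator circles (c, r, sgn x) * crossing_pairs \<alpha> \<alpha>' \<beta> \<beta>' \<sigma> (c, r, sgn x) \<partial>lborel) \<partial>lborel) \<partial>lborel)"
    by (rule nn_integral_circle_measure) measurable
  also have "\<dots> = (\<integral>\<^sup>+x. \<integral>\<^sup>+r. \<integral>\<^sup>+s. I s * (\<integral>\<^sup>+y. C s r y x \<partial>lborel) \<partial>lborel \<partial>lborel \<partial>lborel)"
  proof (intro nn_integral_cong_AE, use AE_lborel_singleton[of "0::real^3"] in eventually_elim)
    fix x :: "real^3" assume "x \<noteq> 0"
    then have n: "norm (sgn x) = 1" by (simp add: norm_sgn)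
    have "3 * indicator (ball 0 1) x * (\<integral>\<^sup>+r. ennreal (1 / r ^ 4) *
      (\<integral>\<^sup>+c. indicator circles (c, r, sgn x) * crossing_pairs \<alpha> \<alpha>' \<beta> \<beta>' \<sigma> (c, r, sgn x) \<partial>lborel) \<partial>lborel)
      = (\<integral>\<^sup>+r. 3 * indicator (ball 0 1) x * (ennreal (1 / r ^ 4) *
      (\<integral>\<^sup>+c. indicator circles (c, r, sgn x) * crossing_pairs \<alpha> \<alpha>' \<beta> \<beta>' \<sigma> (c, r, sgn x) \<partial>lborel)) \<partial>lborel)"
      by (rule nn_integral_cmult[symmetric]) measurable
    also have "\<dots> = (\<integral>\<^sup>+r. \<integral>\<^sup>+s. I s * (\<integral>\<^sup>+y. C s r y x \<partial>lborel) \<partial>lborel \<partial>lborel)"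
    proof (rule nn_integral_cong)
      fix r :: real
      define k where "k = (3 * indicator (ball 0 1) x * (ennreal (1 / r ^ 4) * indicator {0<..} r) :: ennreal)"
      have "indicator circles (c, r, sgn x) = (indicator {0<..} r :: ennreal)" for c
        using n by (simp add: circles_def indicator_def)
      then have "3 * indicator (ball 0 1) x * (ennreal (1 / r ^ 4) *
          (\<integral>\<^sup>+c. indicator circles (c, r, sgn x) * crossing_pairs \<alpha> \<alpha>' \<beta> \<beta>' \<sigma> (c, r, sgn x) \<partial>lborel))
        = k * (\<integral>\<^sup>+c. crossing_pairs \<alpha> \<alpha>' \<beta> \<beta>' \<sigma> (c, r, sgn x) \<partial>lborel)"
        by (simp add: nn_integral_cmult k_def mult_ac)
      also have "\<dots> = k * (\<integral>\<^sup>+s. I s * (\<integral>\<^sup>+y. indicator {0..1} (sgn x \<bullet> y) * ennreal \<bar>sgn x \<bullet> \<alpha>' s\<bar>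
          * (indicator {..r} (norm (z x y)) * second_crossings \<beta> \<beta>' \<sigma> (sgn x) (z x y) (\<alpha> s) r (\<alpha>' s)) \<partial>lborel) \<partial>lborel)"
        unfolding z_def I_def by (subst nn_integral_centers_crossing_pairs[OF n \<alpha> c\<beta> \<beta>(2)]) simp
      also have "\<dots> = (\<integral>\<^sup>+s. k * (I s * (\<integral>\<^sup>+y. indicator {0..1} (sgn x \<bullet> y) * ennreal \<bar>sgn x \<bullet> \<alpha>' s\<bar>
          * (indicator {..r} (norm (z x y)) * second_crossings \<beta> \<beta>' \<sigma> (sgn x) (z x y) (\<alpha> s) r (\<alpha>' s)) \<partial>lborel)) \<partial>lborel)"
        by (rule nn_integral_cmult[symmetric]) measurable
      also have "\<dots> = (\<integral>\<^sup>+s. I s * (\<integral>\<^sup>+y. C s r y x \<partial>lborel) \<partial>lborel)"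
      proof (rule nn_integral_cong)
        fix s
        \<comment> \<open>The conditions on the second crossing are invariant under positive
          multiples of the normal, so \<open>sgn x\<close> may be replaced by the variable of
          integration \<open>x\<close>.\<close>
        have sc: "second_crossings \<beta> \<beta>' \<sigma> (sgn x) (z x y) (\<alpha> s) r (\<alpha>' s) = second_crossings \<beta> \<beta>' \<sigma> x (z x y) (\<alpha> s) r (\<alpha>' s)" for y
        proof -
          have x: "x = norm x *\<^sub>R sgn x" "norm x > 0" using \<open>x \<noteq> 0\<close> by (simp_all add: sgn_div_norm)
          have 1: "sgn x \<bullet> v = 0 \<longleftrightarrow> x \<bullet> v = 0" for v using x(2) by (simp add: sgn_div_norm)
          have 2: "0 < \<sigma> * ((sgn x \<bullet> a) * (sgn x \<bullet> b)) \<longleftrightarrow> 0 < \<sigma> * ((x \<bullet> a) * (x \<bullet> b))" for a b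
          proof -
            have "\<sigma> * ((x \<bullet> a) * (x \<bullet> b)) = (norm x)\<^sup>2 * (\<sigma> * ((sgn x \<bullet> a) * (sgn x \<bullet> b)))"
              by (subst (1 2) x(1)) (simp add: power2_eq_square)
            moreover have "0 < (norm x)\<^sup>2" using x(2) by simp
            ultimately show ?thesis by (metis mult_pos_pos zero_less_mult_pos)
          qed
          show ?thesis by (simp only: second_crossings_def 1 2)
        qed
        have "k * (\<integral>\<^sup>+y. indicator {0..1} (sgn x \<bullet> y) * ennreal \<bar>sgn x \<bullet> \<alpha>' s\<bar>
          * (indicator {..r} (norm (z x y)) * second_crossings \<beta> \<beta>' \<sigma> (sgn x) (z x y) (\<alpha> s) r (\<alpha>' s)) \<partial>lborel)
          = (\<integral>\<^sup>+y. k * (indicator {0..1} (sgn x \<bullet> y) * ennreal \<bar>sgn x \<bullet> \<alpha>' s\<bar>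
          * (indicator {..r} (norm (z x y)) * second_crossings \<beta> \<beta>' \<sigma> (sgn x) (z x y) (\<alpha> s) r (\<alpha>' s))) \<partial>lborel)"
          by (rule nn_integral_cmult[symmetric]) measurable
        also have "\<dots> = (\<integral>\<^sup>+y. C s r y x \<partial>lborel)"
          unfolding sc by (rule nn_integral_cong) (simp only: C_def \<Theta>_def k_def ac_simps)
        finally show "k * (I s * (\<integral>\<^sup>+y. indicator {0..1} (sgn x \<bullet> y) * ennreal \<bar>sgn x \<bullet> \<alpha>' s\<bar>
          * (indicator {..r} (norm (z x y)) * second_crossings \<beta> \<beta>' \<sigma> (sgn x) (z x y) (\<alpha> s) r (\<alpha>' s)) \<partial>lborel))
          = I s * (\<integral>\<^sup>+y. C s r y x \<partial>lborel)" by (simp only: mult.left_commute[of k])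
      qed
      finally show "3 * indicator (ball 0 1) x * (ennreal (1 / r ^ 4) *
          (\<integral>\<^sup>+c. indicator circles (c, r, sgn x) * crossing_pairs \<alpha> \<alpha>' \<beta> \<beta>' \<sigma> (c, r, sgn x) \<partial>lborel))
        = (\<integral>\<^sup>+s. I s * (\<integral>\<^sup>+y. C s r y x \<partial>lborel) \<partial>lborel)" .
    qed
    finally show "3 * indicator (ball 0 1) x * (\<integral>\<^sup>+r. ennreal (1 / r ^ 4) *
      (\<integral>\<^sup>+c. indicator circles (c, r, sgn x) * crossing_pairs \<alpha> \<alpha>' \<beta> \<beta>' \<sigma> (c, r, sgn x) \<partial>lborel) \<partial>lborel)
      = (\<integral>\<^sup>+r. \<integral>\<^sup>+s. I s * (\<integral>\<^sup>+y. C s r y x \<partial>lborel) \<partial>lborel \<partial>lborel)" .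
  qed
  \<comment> \<open>From here on, \<open>x\<close> is moved past \<open>s\<close>, \<open>r\<close>
    and \<open>y\<close> to the innermost place.\<close>
  also have "\<dots> = (\<integral>\<^sup>+x. \<integral>\<^sup>+s. \<integral>\<^sup>+r. I s * (\<integral>\<^sup>+y. C s r y x \<partial>lborel) \<partial>lborel \<partial>lborel \<partial>lborel)"
    by (rule nn_integral_cong, rule lborel_pair.Fubini') measurable
  also have "\<dots> = (\<integral>\<^sup>+s. \<integral>\<^sup>+x. \<integral>\<^sup>+r. I s * (\<integral>\<^sup>+y. C s r y x \<partial>lborel) \<partial>lborel \<partial>lborel \<partial>lborel)"
    by (rule lborel_pair.Fubini') measurable
  also have "\<dots> = (\<integral>\<^sup>+s. \<integral>\<^sup>+r. \<integral>\<^sup>+x. I s * (\<integral>\<^sup>+y. C s r y x \<partial>lborel) \<partial>lborel \<partial>lborel \<partial>lborel)"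
    by (rule nn_integral_cong, rule lborel_pair.Fubini') measurable
  also have "\<dots> = (\<integral>\<^sup>+s. \<integral>\<^sup>+r. I s * (\<integral>\<^sup>+y. \<integral>\<^sup>+x. C s r y x \<partial>lborel \<partial>lborel) \<partial>lborel \<partial>lborel)"
  proof (intro nn_integral_cong)
    fix s r :: real
    have "(\<integral>\<^sup>+x. I s * (\<integral>\<^sup>+y. C s r y x \<partial>lborel) \<partial>lborel) = I s * (\<integral>\<^sup>+x. \<integral>\<^sup>+y. C s r y x \<partial>lborel \<partial>lborel)"
      by (rule nn_integral_cmult) measurable
    also have "(\<integral>\<^sup>+x. \<integral>\<^sup>+y. C s r y x \<partial>lborel \<partial>lborel) = (\<integral>\<^sup>+y. \<integral>\<^sup>+x. C s r y x \<partial>lborel \<partial>lborel)"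
      by (rule lborel_pair.Fubini') measurable
    finally show "(\<integral>\<^sup>+x. I s * (\<integral>\<^sup>+y. C s r y x \<partial>lborel) \<partial>lborel) = I s * (\<integral>\<^sup>+y. \<integral>\<^sup>+x. C s r y x \<partial>lborel \<partial>lborel)" .
  qed
  also have "\<dots> = (\<integral>\<^sup>+s. \<integral>\<^sup>+t. indicator {0..<1} s * indicator {0..<1} t * indicator (- {0}) (\<beta> t - \<alpha> s) *
        (\<integral>\<^sup>+x. indicator {0..1} (axis_coord (\<beta> t - \<alpha> s) x)
          * ennreal (\<bar>axis_proj (\<beta> t - \<alpha> s) x \<bullet> \<beta>' t\<bar> / \<bar>transversal_axis (\<beta> t - \<alpha> s) \<bullet> (\<beta> t - \<alpha> s)\<bar>)
          * (3 * indicator (ball 0 1) (axis_proj (\<beta> t - \<alpha> s) x) * ennreal \<bar>sgn (axis_proj (\<beta> t - \<alpha> s) x) \<bullet> \<alpha>' s\<bar>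
            * indicator {0<..} (\<sigma> * ((axis_proj (\<beta> t - \<alpha> s) x \<bullet> \<alpha>' s) * (axis_proj (\<beta> t - \<alpha> s) x \<bullet> \<beta>' t)))
            * ennreal (8 / (3 * norm (\<beta> t - \<alpha> s)))) \<partial>lborel) \<partial>lborel \<partial>lborel)"
  proof (rule nn_integral_cong)
    fix s
    define w where "w t = \<beta> t - \<alpha> s" for t
    have [measurable]: "w \<in> borel_measurable borel" unfolding w_def by measurable
    define X where "X t x = axis_proj (w t) x" for t x
    have [measurable (raw)]: "(\<lambda>\<omega>. X (f \<omega>) (g \<omega>)) \<in> borel_measurable M"
      if [measurable]: "f \<in> borel_measurable M" "g \<in> borel_measurable M" for f g and M :: "'m measure"
      unfolding X_def by measurable
    define J where "J t = (indicator {0..<1} t * indicator (- {\<alpha> s}) (\<beta> t) :: ennreal)" for t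
    have [measurable]: "J \<in> borel_measurable borel" unfolding J_def by measurable
    define P where "P t x = (indicator {0..1} (axis_coord (w t) x) * ennreal (\<bar>X t x \<bullet> \<beta>' t\<bar> / \<bar>transversal_axis (w t) \<bullet> w t\<bar>) :: ennreal)" for t x
    have [measurable (raw)]: "(\<lambda>\<omega>. P (f \<omega>) (g \<omega>)) \<in> borel_measurable M"
      if [measurable]: "f \<in> borel_measurable M" "g \<in> borel_measurable M" for f g and M :: "'m measure"
      unfolding P_def by measurable
    define H where "H t x = (indicator {0<..} (\<sigma> * ((X t x \<bullet> \<alpha>' s) * (X t x \<bullet> \<beta>' t))) :: ennreal)" for t x
    have [measurable (raw)]: "(\<lambda>\<omega>. H (f \<omega>) (g \<omega>)) \<in> borel_measurable M"
      if [measurable]: "f \<in> borel_measurable M" "g \<in> borel_measurable M" for f g and M :: "'m measure"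
      unfolding H_def by measurable
    define D where "D t x r y = P t x * (\<Theta> s r y (X t x) * indicator {..r} (norm (w t + z (X t x) y)) * H t x)" for t x r y
    have [measurable (raw)]: "(\<lambda>\<omega>. D (f1 \<omega>) (f2 \<omega>) (f3 \<omega>) (f4 \<omega>)) \<in> borel_measurable M"
      if [measurable]: "f1 \<in> borel_measurable M" "f2 \<in> borel_measurable M" "f3 \<in> borel_measurable M" "f4 \<in> borel_measurable M"
      for f1 f2 f3 f4 and M :: "'m measure"
      unfolding D_def by measurable
    have "(\<integral>\<^sup>+x. C s r y x \<partial>lborel) = (\<integral>\<^sup>+t. J t * (\<integral>\<^sup>+x. D t x r y \<partial>lborel) \<partial>lborel)" for r y
      unfolding C_def J_def D_def P_def H_def X_def w_def
      by (rule nn_integral_second_crossings[OF \<beta>]) measurable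
    then have "(\<integral>\<^sup>+r. I s * (\<integral>\<^sup>+y. \<integral>\<^sup>+x. C s r y x \<partial>lborel \<partial>lborel) \<partial>lborel)
      = I s * (\<integral>\<^sup>+r. \<integral>\<^sup>+y. \<integral>\<^sup>+t. J t * (\<integral>\<^sup>+x. D t x r y \<partial>lborel) \<partial>lborel \<partial>lborel \<partial>lborel)"
      by (simp add: nn_integral_cmult)
    \<comment> \<open>The parameter \<open>t\<close> moves outside; then \<open>r\<close> and
      \<open>y\<close> move inside, where the normal \<open>X t x\<close> is fixed.\<close>
    also have "(\<integral>\<^sup>+r. \<integral>\<^sup>+y. \<integral>\<^sup>+t. J t * (\<integral>\<^sup>+x. D t x r y \<partial>lborel) \<partial>lborel \<partial>lborel \<partial>lborel)
      = (\<integral>\<^sup>+r. \<integral>\<^sup>+t. \<integral>\<^sup>+y. J t * (\<integral>\<^sup>+x. D t x r y \<partial>lborel) \<partial>lborel \<partial>lborel \<partial>lborel)"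
      by (rule nn_integral_cong, rule lborel_pair.Fubini') measurable
    also have "\<dots> = (\<integral>\<^sup>+t. \<integral>\<^sup>+r. \<integral>\<^sup>+y. J t * (\<integral>\<^sup>+x. D t x r y \<partial>lborel) \<partial>lborel \<partial>lborel \<partial>lborel)"
      by (rule lborel_pair.Fubini') measurable
    also have "\<dots> = (\<integral>\<^sup>+t. J t * (\<integral>\<^sup>+x. P t x * (3 * indicator (ball 0 1) (X t x) * ennreal \<bar>sgn (X t x) \<bullet> \<alpha>' s\<bar> * H t x
        * ennreal (8 / (3 * norm (w t)))) \<partial>lborel) \<partial>lborel)"
    proof (rule nn_integral_cong)
      fix t
      have "(\<integral>\<^sup>+r. \<integral>\<^sup>+y. J t * (\<integral>\<^sup>+x. D t x r y \<partial>lborel) \<partial>lborel \<partial>lborel) = J t * (\<integral>\<^sup>+r. \<integral>\<^sup>+y. \<integral>\<^sup>+x. D t x r y \<partial>lborel \<partial>lborel \<partial>lborel)"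
        by (simp add: nn_integral_cmult)
      also have "(\<integral>\<^sup>+r. \<integral>\<^sup>+y. \<integral>\<^sup>+x. D t x r y \<partial>lborel \<partial>lborel \<partial>lborel) = (\<integral>\<^sup>+r. \<integral>\<^sup>+x. \<integral>\<^sup>+y. D t x r y \<partial>lborel \<partial>lborel \<partial>lborel)"
        by (rule nn_integral_cong, rule lborel_pair.Fubini') measurable
      also have "\<dots> = (\<integral>\<^sup>+x. \<integral>\<^sup>+r. \<integral>\<^sup>+y. D t x r y \<partial>lborel \<partial>lborel \<partial>lborel)"
        by (rule lborel_pair.Fubini') measurable
      also have "J t * \<dots> = J t * (\<integral>\<^sup>+x. P t x * (3 * indicator (ball 0 1) (X t x) * ennreal \<bar>sgn (X t x) \<bullet> \<alpha>' s\<bar> * H t x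
        * ennreal (8 / (3 * norm (w t)))) \<partial>lborel)"
      proof (cases "\<beta> t = \<alpha> s")
        case False
        then have w: "w t \<noteq> 0" by (simp add: w_def)
        have "(\<integral>\<^sup>+r. \<integral>\<^sup>+y. D t x r y \<partial>lborel \<partial>lborel) = P t x * (3 * indicator (ball 0 1) (X t x) * ennreal \<bar>sgn (X t x) \<bullet> \<alpha>' s\<bar> * H t x
          * ennreal (8 / (3 * norm (w t))))" for x
        proof (cases "X t x = 0")
          case True
          \<comment> \<open>A zero vector determines no plane, but then the factor |X \<bullet>
            \<beta>'| in \<open>P\<close> vanishes.\<close>
          then show ?thesis by (simp add: D_def P_def)
        next
          case nz: False
          then have n: "norm (sgn (X t x)) = 1" by (simp add: norm_sgn)
          have perp: "sgn (X t x) \<bullet> w t = 0" using axis_proj_inner[OF w, of x] by (simp add: X_def sgn_div_norm)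
          define k where "k = P t x * (3 * indicator (ball 0 1) (X t x) * ennreal \<bar>sgn (X t x) \<bullet> \<alpha>' s\<bar> * H t x)"
          have "D t x r y = k * (indicator {0<..} r * ennreal (1 / r ^ 4) * indicator {0..1} (sgn (X t x) \<bullet> y)
            * indicator {..r} (norm (y - (sgn (X t x) \<bullet> y) *\<^sub>R sgn (X t x))) * indicator {..r} (norm (w t + (y - (sgn (X t x) \<bullet> y) *\<^sub>R sgn (X t x)))))" for r y
            by (simp only: D_def k_def \<Theta>_def z_def ac_simps)
          then have "(\<integral>\<^sup>+r. \<integral>\<^sup>+y. D t x r y \<partial>lborel \<partial>lborel) = k * (\<integral>\<^sup>+r. \<integral>\<^sup>+y. indicator {0<..} r * ennreal (1 / r ^ 4) * indicator {0..1} (sgn (X t x) \<bullet> y)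
            * indicator {..r} (norm (y - (sgn (X t x) \<bullet> y) *\<^sub>R sgn (X t x))) * indicator {..r} (norm (w t + (y - (sgn (X t x) \<bullet> y) *\<^sub>R sgn (X t x)))) \<partial>lborel \<partial>lborel)"
            by (simp add: nn_integral_cmult)
          also have "\<dots> = k * ennreal (8 / (3 * norm (w t)))"
            by (simp only: nn_integral_disks_through_two_points[OF n w perp])
          finally show ?thesis by (simp add: k_def mult_ac)
        qed
        then show ?thesis by simp
      qed (simp add: J_def)
      finally show "(\<integral>\<^sup>+r. \<integral>\<^sup>+y. J t * (\<integral>\<^sup>+x. D t x r y \<partial>lborel) \<partial>lborel \<partial>lborel) = J t * (\<integral>\<^sup>+x. P t x * (3 * indicator (ball 0 1) (X t x) * ennreal \<bar>sgn (X t x) \<bullet> \<alpha>' s\<bar> * H t x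
        * ennreal (8 / (3 * norm (w t)))) \<partial>lborel)" .
    qed
    also have "I s * \<dots> = (\<integral>\<^sup>+t. I s * (J t * (\<integral>\<^sup>+x. P t x * (3 * indicator (ball 0 1) (X t x) * ennreal \<bar>sgn (X t x) \<bullet> \<alpha>' s\<bar> * H t x
        * ennreal (8 / (3 * norm (w t)))) \<partial>lborel)) \<partial>lborel)"
      by (rule nn_integral_cmult[symmetric]) measurable
    finally have F: "(\<integral>\<^sup>+r. I s * (\<integral>\<^sup>+y. \<integral>\<^sup>+x. C s r y x \<partial>lborel \<partial>lborel) \<partial>lborel)
      = (\<integral>\<^sup>+t. I s * (J t * (\<integral>\<^sup>+x. P t x * (3 * indicator (ball 0 1) (X t x) * ennreal \<bar>sgn (X t x) \<bullet> \<alpha>' s\<bar> * H t x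
        * ennreal (8 / (3 * norm (w t)))) \<partial>lborel)) \<partial>lborel)" .
    have J: "J t = indicator {0..<1} t * indicator (- {0}) (\<beta> t - \<alpha> s)" for t by (simp add: J_def indicator_def)
    show "(\<integral>\<^sup>+r. I s * (\<integral>\<^sup>+y. \<integral>\<^sup>+x. C s r y x \<partial>lborel \<partial>lborel) \<partial>lborel)
      = (\<integral>\<^sup>+t. indicator {0..<1} s * indicator {0..<1} t * indicator (- {0}) (\<beta> t - \<alpha> s) *
        (\<integral>\<^sup>+x. indicator {0..1} (axis_coord (\<beta> t - \<alpha> s) x)
          * ennreal (\<bar>axis_proj (\<beta> t - \<alpha> s) x \<bullet> \<beta>' t\<bar> / \<bar>transversal_axis (\<beta> t - \<alpha> s) \<bullet> (\<beta> t - \<alpha> s)\<bar>)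
          * (3 * indicator (ball 0 1) (axis_proj (\<beta> t - \<alpha> s) x) * ennreal \<bar>sgn (axis_proj (\<beta> t - \<alpha> s) x) \<bullet> \<alpha>' s\<bar>
            * indicator {0<..} (\<sigma> * ((axis_proj (\<beta> t - \<alpha> s) x \<bullet> \<alpha>' s) * (axis_proj (\<beta> t - \<alpha> s) x \<bullet> \<beta>' t)))
            * ennreal (8 / (3 * norm (\<beta> t - \<alpha> s)))) \<partial>lborel) \<partial>lborel)"
      unfolding F by (simp only: I_def J P_def H_def X_def w_def mult.assoc)
  qed
  finally show ?thesis .
qed

section \<open>The densities of pairs of crossings\<close>

text \<open>
  The density, with respect to the parameters, of the measure of the circles whose disk meets two curves with
  tangent vectors \<open>u\<close> and \<open>v\<close> at points that differ by \<open>w\<close>, where \<open>\<sigma>\<close> is the product of the signs of the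
  two crossings.
\<close>

definition pair_density :: "real \<Rightarrow> real^3 \<Rightarrow> real^3 \<Rightarrow> real^3 \<Rightarrow> ennreal" where
  "pair_density \<sigma> u v w = indicator (- {0}) w * (\<integral>\<^sup>+x. indicator {0..1} (axis_coord w x)
     * ennreal (\<bar>axis_proj w x \<bullet> v\<bar> / \<bar>transversal_axis w \<bullet> w\<bar>)
     * (3 * indicator (ball 0 1) (axis_proj w x) * ennreal \<bar>sgn (axis_proj w x) \<bullet> u\<bar>
       * indicator {0<..} (\<sigma> * ((axis_proj w x \<bullet> u) * (axis_proj w x \<bullet> v)))
       * ennreal (8 / (3 * norm w))) \<partial>lborel)"

lemma measurable_pair_density [measurable (raw)]:
  assumes [measurable]: "f1 \<in> borel_measurable M" "f2 \<in> borel_measurable M" "f3 \<in> borel_measurable M"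
  shows "(\<lambda>\<omega>. pair_density \<sigma> (f1 \<omega>) (f2 \<omega>) (f3 \<omega>)) \<in> borel_measurable M"
proof -
  have [measurable]: "ball (0::real^3) 1 \<in> sets borel" by simp
  show ?thesis unfolding pair_density_def by measurable
qed

text \<open>The slab integral becomes an integral over the plane orthogonal to \<open>w\<close>, and
  the axis \<open>e\<close> cancels: the projection gives |e \<bullet> w|/|w|, the density 1/|e
  \<bullet> w|. What remains is \<open>8 / d\<^sup>2\<close> times the integral over the unit disk
  of the positive part of \<sigma> (z \<bullet> u') (z \<bullet> v')/|z|, where \<open>u'\<close>
  and \<open>v'\<close> are the components of \<open>u\<close> and \<open>v\<close> in the plane.
  The difference between \<sigma> = 1 and \<sigma> = -1 is the full integral, known from
  \<open>has_bochner_integral_disk_product\<close>; the sum is the integral of the absolute value,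
  bounded by Cauchy-Schwarz.\<close>

lemma pair_density_eq:
  fixes u v w :: "real^3"
  assumes w: "w \<noteq> 0"
  obtains p q where "0 \<le> p" "0 \<le> q" "pair_density 1 u v w = ennreal p" "pair_density (- 1) u v w = ennreal q"
    "p - q = 8 * pi / 3 * (cross3 u w \<bullet> cross3 v w) / norm w ^ 4"
    "p + q \<le> 16 * pi / 3 * (norm (cross3 u w) * norm (cross3 v w)) / norm w ^ 4"
proof -
  define d where "d = norm w"
  have d: "d > 0" using w by (simp add: d_def)
  define n where "n = sgn w"
  have n: "norm n = 1" "w = d *\<^sub>R n" using w by (auto simp: n_def d_def norm_sgn sgn_div_norm)
  obtain f1 f2 where f: "orthonormal_pair f1 f2" "cross3 f1 f2 = n" using n(1) by (rule obtain_orthonormal_pair)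
  define e where "e = transversal_axis w"
  have ew: "e \<bullet> w \<noteq> 0" using transversal_axis_inner[OF w] by (simp add: e_def)
  define u' v' where "u' = (u \<bullet> f1, u \<bullet> f2)" and "v' = (v \<bullet> f1, v \<bullet> f2)"
  have ff: "f1 \<bullet> f1 = 1" "f2 \<bullet> f2 = 1" "f1 \<bullet> f2 = 0" "f2 \<bullet> f1 = 0"
    using f(1) by (auto simp: orthonormal_pair_def norm_eq_1 inner_commute)
  \<comment> \<open>The cross product with \<open>w\<close> rotates the component in the plane by a
    right angle and scales it by \<open>d\<close>, so inner products are multiplied by
    \<open>d\<^sup>2\<close>.\<close>
  have cross_w: "cross3 y w \<bullet> cross3 y' w = d\<^sup>2 * ((y \<bullet> f1, y \<bullet> f2) \<bullet> (y' \<bullet> f1, y' \<bullet> f2))" for y y'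
  proof -
    have c: "cross3 y w = d *\<^sub>R ((y \<bullet> f2) *\<^sub>R f1 - (y \<bullet> f1) *\<^sub>R f2)" for y
      using Lagrange[of y f1 f2] by (simp add: n(2) f(2)[symmetric] cross_mult_right)
    show ?thesis unfolding c
      by (simp add: inner_diff_left inner_diff_right ff power2_eq_square algebra_simps)
  qed
  have norm_cross: "norm (cross3 y w) = d * norm (y \<bullet> f1, y \<bullet> f2)" for y
    using cross_w[of y y] d by (simp add: norm_eq_sqrt_inner[of "cross3 y w"] norm_eq_sqrt_inner[of "(y \<bullet> f1, y \<bullet> f2)"] real_sqrt_mult)
  have [measurable]: "ball (0::real \<times> real) 1 \<in> sets borel" "ball (0::real^3) 1 \<in> sets borel" by simp_all
  define P where "P z = (z \<bullet> u') * (z \<bullet> v') / norm z * indicator (ball 0 1) z" for z :: "real \<times> real"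
  have hb: "has_bochner_integral lborel P (pi / 3 * (u' \<bullet> v'))"
    using has_bochner_integral_disk_product[of "fst u'" "snd u'" "fst v'" "snd v'"]
    by (simp add: P_def[abs_def] inner_prod_def)
  then have int: "integrable lborel P" "integral\<^sup>L lborel P = pi / 3 * (u' \<bullet> v')" by (auto simp: has_bochner_integral_iff)
  then have [measurable]: "P \<in> borel_measurable borel" using borel_measurable_integrable[OF int(1)] by simp
  define I where "I \<sigma> = (\<integral>z. max 0 (\<sigma> * P z) \<partial>lborel)" for \<sigma> :: real
  have int_max: "integrable lborel (\<lambda>z. max 0 (\<sigma> * P z))" for \<sigma> :: real
    using int(1) by (intro integrable_max) auto
  have I_nn: "(\<integral>\<^sup>+z. ennreal (max 0 (\<sigma> * P z)) \<partial>lborel) = ennreal (I \<sigma>)" "I \<sigma> \<ge> 0" for \<sigma>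
    unfolding I_def using int_max by (auto intro: nn_integral_eq_integral)
  have I_diff: "I 1 - I (- 1) = pi / 3 * (u' \<bullet> v')"
  proof -
    have "I 1 - I (- 1) = (\<integral>z. max 0 (1 * P z) - max 0 (- 1 * P z) \<partial>lborel)"
      unfolding I_def by (rule Bochner_Integration.integral_diff[symmetric]) (rule int_max)+
    also have "\<dots> = integral\<^sup>L lborel P" by (rule Bochner_Integration.integral_cong) (auto simp: max_def)
    finally show ?thesis by (simp add: int)
  qed
  have I_sum: "I 1 + I (- 1) \<le> norm u' * norm v' * (2 * pi / 3)"
  proof -
    have "I 1 + I (- 1) = (\<integral>z. max 0 (1 * P z) + max 0 (- 1 * P z) \<partial>lborel)"
      unfolding I_def by (rule Bochner_Integration.integral_add[symmetric]) (rule int_max)+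
    also have "\<dots> \<le> (\<integral>z. (norm u' * norm v') * (norm z * indicator (ball 0 1) z) \<partial>(lborel :: (real \<times> real) measure))"
    proof (rule integral_mono)
      show "integrable lborel (\<lambda>z. max 0 (1 * P z) + max 0 (- 1 * P z))" by (intro Bochner_Integration.integrable_add int_max)
      show "integrable lborel (\<lambda>z::real \<times> real. (norm u' * norm v') * (norm z * indicator (ball 0 1) z))"
        using has_bochner_integral_norm_disk by (intro integrable_mult_right) (auto simp: has_bochner_integral_iff)
      fix z :: "real \<times> real"
      have "\<bar>(z \<bullet> u') * (z \<bullet> v')\<bar> \<le> (norm z * norm u') * (norm z * norm v')"
        unfolding abs_mult by (intro mult_mono Cauchy_Schwarz_ineq2) auto
      then have "\<bar>(z \<bullet> u') * (z \<bullet> v')\<bar> / norm z \<le> norm u' * norm v' * norm z"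
        by (cases "z = 0") (simp_all add: divide_le_eq mult_ac)
      then have "\<bar>P z\<bar> \<le> (norm u' * norm v') * (norm z * indicator (ball 0 1) z)"
        by (auto simp: P_def indicator_def abs_mult mult_ac)
      then show "max 0 (1 * P z) + max 0 (- 1 * P z) \<le> (norm u' * norm v') * (norm z * indicator (ball 0 1) z)"
        by (simp add: max_def abs_if split: if_splits)
    qed
    also have "\<dots> = norm u' * norm v' * (2 * pi / 3)"
      using has_bochner_integral_norm_disk by (simp add: has_bochner_integral_iff)
    finally show ?thesis .
  qed
  have eval: "pair_density \<sigma> u v w = ennreal (8 / d\<^sup>2 * I \<sigma>)" if \<sigma>: "\<sigma> \<in> {-1, 1}" for \<sigma>
  proof -
    define g where "g X = ennreal (\<bar>X \<bullet> v\<bar> / \<bar>e \<bullet> w\<bar>) * (3 * indicator (ball 0 1) X * ennreal \<bar>sgn X \<bullet> u\<bar>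
       * indicator {0<..} (\<sigma> * ((X \<bullet> u) * (X \<bullet> v))) * ennreal (8 / (3 * norm w)))" for X :: "real^3"
    have [measurable]: "g \<in> borel_measurable borel" unfolding g_def by measurable
    have "pair_density \<sigma> u v w = (\<integral>\<^sup>+x. indicator {0..1} (- (x \<bullet> w) / (e \<bullet> w)) * g (x + (- (x \<bullet> w) / (e \<bullet> w)) *\<^sub>R e) \<partial>lborel)"
      using w unfolding pair_density_def g_def axis_coord_def axis_proj_def e_def by (simp add: mult.assoc)
    also have "\<dots> = ennreal (\<bar>e \<bullet> w\<bar> / norm w) * (\<integral>\<^sup>+a. \<integral>\<^sup>+b. g (a *\<^sub>R f1 + b *\<^sub>R f2) \<partial>lborel \<partial>lborel)"
    proof (rule nn_integral_slab_projection[OF f(1) _ ew])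
      show "w = norm w *\<^sub>R cross3 f1 f2" using n(2) f(2) d_def by metis
    qed measurable
    also have "(\<integral>\<^sup>+a. \<integral>\<^sup>+b. g (a *\<^sub>R f1 + b *\<^sub>R f2) \<partial>lborel \<partial>lborel)
      = (\<integral>\<^sup>+a. \<integral>\<^sup>+b. ennreal (8 / (d * \<bar>e \<bullet> w\<bar>)) * ennreal (max 0 (\<sigma> * P (a, b))) \<partial>lborel \<partial>lborel)"
    proof (intro nn_integral_cong)
      fix a b
      define X where "X = a *\<^sub>R f1 + b *\<^sub>R f2"
      have nX: "norm X = norm (a, b)" by (simp add: X_def norm_orthonormal_pair[OF f(1)] norm_Pair)
      have Xu: "X \<bullet> u = (a, b) \<bullet> u'" "X \<bullet> v = (a, b) \<bullet> v'"
        by (simp_all add: X_def u'_def v'_def inner_add_left inner_add_right inner_commute)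
      have su: "\<bar>sgn X \<bullet> u\<bar> = \<bar>X \<bullet> u\<bar> / norm X" by (cases "X = 0") (simp_all add: sgn_div_norm abs_mult divide_inverse mult.commute)
      have mx: "(if 0 < \<sigma> * ((X \<bullet> u) * (X \<bullet> v)) then \<bar>X \<bullet> v\<bar> * (\<bar>X \<bullet> u\<bar> / norm X) else 0) = max 0 (\<sigma> * ((X \<bullet> u) * (X \<bullet> v) / norm X))"
      proof -
        have abs: "\<bar>X \<bullet> v\<bar> * (\<bar>X \<bullet> u\<bar> / norm X) = \<bar>\<sigma> * ((X \<bullet> u) * (X \<bullet> v))\<bar> / norm X"
          using \<sigma> by (auto simp: abs_mult mult.commute)
        show ?thesis
        proof (cases "0 < \<sigma> * ((X \<bullet> u) * (X \<bullet> v))")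
          case True
          then have "0 \<le> \<sigma> * ((X \<bullet> u) * (X \<bullet> v)) / norm X" by (intro divide_nonneg_nonneg) simp_all
          then show ?thesis unfolding abs using True by (simp add: max_def)
        next
          case False
          then have "\<sigma> * ((X \<bullet> u) * (X \<bullet> v)) / norm X \<le> 0" by (intro divide_nonpos_nonneg) simp_all
          then show ?thesis using False by (simp add: max_def)
        qed
      qed
      have three: "3 * ennreal y = ennreal (3 * y)" for y using ennreal_mult'[of 3 y] by simp
      show "g (a *\<^sub>R f1 + b *\<^sub>R f2) = ennreal (8 / (d * \<bar>e \<bullet> w\<bar>)) * ennreal (max 0 (\<sigma> * P (a, b)))"
      proof (cases "norm X < 1 \<and> 0 < \<sigma> * ((X \<bullet> u) * (X \<bullet> v))")
        case True
        have "g X = ennreal (\<bar>X \<bullet> v\<bar> / \<bar>e \<bullet> w\<bar>) * (3 * ennreal (\<bar>X \<bullet> u\<bar> / norm X) * ennreal (8 / (3 * d)))"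
          using True by (simp add: g_def su d_def)
        also have "\<dots> = ennreal (\<bar>X \<bullet> v\<bar> / \<bar>e \<bullet> w\<bar> * (3 * (\<bar>X \<bullet> u\<bar> / norm X) * (8 / (3 * d))))"
          using d by (simp add: three ennreal_mult'[symmetric])
        also have "\<bar>X \<bullet> v\<bar> / \<bar>e \<bullet> w\<bar> * (3 * (\<bar>X \<bullet> u\<bar> / norm X) * (8 / (3 * d))) = 8 / (d * \<bar>e \<bullet> w\<bar>) * (\<bar>X \<bullet> v\<bar> * (\<bar>X \<bullet> u\<bar> / norm X))"
          by (simp add: mult_ac)
        also have "\<bar>X \<bullet> v\<bar> * (\<bar>X \<bullet> u\<bar> / norm X) = max 0 (\<sigma> * P (a, b))"
          using mx True by (simp add: P_def nX Xu)
        finally have gX: "g X = ennreal (8 / (d * \<bar>e \<bullet> w\<bar>) * max 0 (\<sigma> * P (a, b)))" .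
        show ?thesis unfolding X_def[symmetric] gX by (rule ennreal_mult') (use d in simp)
      next
        case False
        then have "max 0 (\<sigma> * P (a, b)) = 0" using mx by (auto simp: P_def nX Xu indicator_def)
        moreover have "g X = 0" using False by (auto simp: g_def)
        ultimately show ?thesis by (simp add: X_def[symmetric])
      qed
    qed
    also have "\<dots> = (\<integral>\<^sup>+z. ennreal (8 / (d * \<bar>e \<bullet> w\<bar>)) * ennreal (max 0 (\<sigma> * P z)) \<partial>(lborel \<Otimes>\<^sub>M lborel))"
      by (rule lborel.nn_integral_fst) (simp only: lborel_prod, measurable)
    also have "\<dots> = ennreal (8 / (d * \<bar>e \<bullet> w\<bar>)) * ennreal (I \<sigma>)"
      by (simp add: lborel_prod nn_integral_cmult I_nn)
    also have "ennreal (\<bar>e \<bullet> w\<bar> / norm w) * \<dots> = ennreal (8 / d\<^sup>2 * I \<sigma>)"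
      using ew d I_nn(2)[of \<sigma>] by (simp add: ennreal_mult'[symmetric] d_def[symmetric] power2_eq_square)
    finally show ?thesis .
  qed
  show thesis
  proof (rule that[of "8 / d\<^sup>2 * I 1" "8 / d\<^sup>2 * I (- 1)"])
    show "8 / d\<^sup>2 * I 1 - 8 / d\<^sup>2 * I (- 1) = 8 * pi / 3 * (cross3 u w \<bullet> cross3 v w) / norm w ^ 4"
    proof -
      have "8 / d\<^sup>2 * I 1 - 8 / d\<^sup>2 * I (- 1) = 8 / d\<^sup>2 * (pi / 3 * (u' \<bullet> v'))"
        unfolding I_diff[symmetric] by (simp add: right_diff_distrib)
      also have "u' \<bullet> v' = (cross3 u w \<bullet> cross3 v w) / d\<^sup>2"
        using cross_w[of u v] d by (simp add: u'_def v'_def)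
      finally show ?thesis by (simp add: d_def power_numeral_reduce)
    qed
    show "8 / d\<^sup>2 * I 1 + 8 / d\<^sup>2 * I (- 1) \<le> 16 * pi / 3 * (norm (cross3 u w) * norm (cross3 v w)) / norm w ^ 4"
    proof -
      have "8 / d\<^sup>2 * I 1 + 8 / d\<^sup>2 * I (- 1) = 8 / d\<^sup>2 * (I 1 + I (- 1))" by (simp add: distrib_left)
      also have "\<dots> \<le> 8 / d\<^sup>2 * (norm u' * norm v' * (2 * pi / 3))" by (intro mult_left_mono I_sum) simp
      also have "norm u' = norm (cross3 u w) / d" using norm_cross[of u] d by (simp add: u'_def)
      also have "norm v' = norm (cross3 v w) / d" using norm_cross[of v] d by (simp add: v'_def)
      finally show ?thesis by (simp add: d_def power_numeral_reduce mult_ac)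
    qed
  qed (use I_nn eval in auto)
qed

text \<open>The cross products with the chord are the oriented normals of the two planes: their
  lengths yield the sines, and the angle between them is the plane angle. In degenerate cases both
  sides are 0, as division by 0 yields 0.\<close>

lemma torsion_density_eq:
  "torsion_density p u q v * norm u * norm v = (cross3 u (q - p) \<bullet> cross3 v (q - p)) / norm (q - p) ^ 4"
proof -
  define w where "w = q - p"
  have cs: "\<bar>a \<bullet> b / (norm a * norm b)\<bar> \<le> 1" for a b :: "real^3"
  proof (cases "a = 0 \<or> b = 0")
    case False
    then show ?thesis using Cauchy_Schwarz_ineq2[of a b] by (simp add: abs_mult)
  qed auto
  have sin: "sin (vec_angle u w) * norm u * norm w = norm (cross3 u w)" if "u \<noteq> 0" "w \<noteq> 0" for u
  proof -
    have "(sin (vec_angle u w) * norm u * norm w)\<^sup>2 = (1 - (u \<bullet> w / (norm u * norm w))\<^sup>2) * (norm u * norm w)\<^sup>2"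
      using cs[of u w] by (simp add: vec_angle_def sin_arccos_abs power_mult_distrib abs_square_le_1)
    also have "\<dots> = (norm u * norm w)\<^sup>2 - (u \<bullet> w)\<^sup>2"
      using that by (simp add: left_diff_distrib power_divide power_mult_distrib)
    also have "\<dots> = (norm (cross3 u w))\<^sup>2" using norm_cross_dot[of u w] by simp
    finally have "\<bar>sin (vec_angle u w) * norm u * norm w\<bar> = \<bar>norm (cross3 u w)\<bar>" by (auto simp: power2_eq_iff)
    moreover have "sin (vec_angle u w) \<ge> 0" using cs[of u w] by (simp add: vec_angle_def sin_arccos_abs abs_square_le_1)
    ultimately show ?thesis by simp
  qed
  have cos: "cos (plane_angle u v w) * (norm (cross3 u w) * norm (cross3 v w)) = cross3 u w \<bullet> cross3 v w"
  proof (cases "cross3 u w = 0 \<or> cross3 v w = 0")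
    case False
    then show ?thesis using cs[of "cross3 u w" "cross3 v w"] by (simp add: plane_angle_def vec_angle_def cos_arccos_abs)
  qed auto
  show ?thesis
  proof (cases "u = 0 \<or> v = 0 \<or> w = 0")
    case True
    then show ?thesis by (auto simp: torsion_density_def w_def)
  next
    case False
    then have nz: "norm u \<noteq> 0" "norm v \<noteq> 0" "norm w \<noteq> 0" by auto
    have "torsion_density p u q v * norm u * norm v
      = cos (plane_angle u v w) * ((sin (vec_angle u w) * norm u * norm w) * (sin (vec_angle v w) * norm v * norm w)) / norm w ^ 4"
      using nz by (simp add: torsion_density_def w_def[symmetric] power_numeral_reduce)
    then show ?thesis using sin[of u] sin[of v] cos False by (simp add: w_def)
  qed
qed

section \<open>Circles in general position\<close>

text \<open>Tangential intersections with the plane of the circle, and intersections with the circle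
  itself: what the hypotheses of \<open>linking_number_circle\<close> exclude.\<close>

definition bad_crossings :: "(real \<Rightarrow> real^3) \<Rightarrow> (real \<Rightarrow> real^3) \<Rightarrow> circle \<Rightarrow> ennreal" where
  "bad_crossings \<alpha> \<alpha>' = (\<lambda>(c, r, n). emeasure (count_space UNIV)
     {t\<in>{0..<1}. n \<bullet> (\<alpha> t - c) = 0 \<and> (n \<bullet> \<alpha>' t = 0 \<or> dist c (\<alpha> t) = r)})"

text \<open>In the area formula for the centers, tangential crossings have the weight
  \<open>\<bar>n \<bullet> \<alpha>' t\<bar> = 0\<close>, and the centers at distance exactly
  \<open>r\<close> from a crossing form a circle in a plane, hence a null set.\<close>

lemma AE_bad_crossings:
  assumes \<alpha>: "\<And>t. (\<alpha> has_vector_derivative \<alpha>' t) (at t)" "continuous_on UNIV \<alpha>'"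
  shows "AE \<gamma> in circle_measure. \<gamma> \<in> circles \<longrightarrow> bad_crossings \<alpha> \<alpha>' \<gamma> = 0"
proof -
  have c\<alpha>: "continuous_on UNIV \<alpha>"
    using \<alpha>(1) by (meson continuous_at_imp_continuous_on has_vector_derivative_continuous)
  then have [measurable]: "\<alpha> \<in> borel_measurable borel" by (rule borel_measurable_continuous_onI)
  have [measurable]: "\<alpha>' \<in> borel_measurable borel" using \<alpha>(2) by (rule borel_measurable_continuous_onI)
  note cs = c\<alpha>[THEN continuous_on_curve] \<alpha>(2)[THEN continuous_on_curve]
  \<comment> \<open>The disjunction is expressed by a vanishing product, a single closed
    condition.\<close>
  have sc: "sigma_compact {z :: circle \<times> real. 0 \<le> snd z \<and> snd z < 1 \<and> snd (snd (fst z)) \<bullet> (\<alpha> (snd z) - fst (fst z)) = 0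
     \<and> (snd (snd (fst z)) \<bullet> \<alpha>' (snd z)) * (dist (fst (fst z)) (\<alpha> (snd z)) - fst (snd (fst z))) = 0}"
    by (intro sigma_compact_Collect_conj sigma_compact_Collect continuous_intros cs)
  have B[measurable]: "bad_crossings \<alpha> \<alpha>' \<in> borel_measurable borel"
    using borel_measurable_card_fibre[OF sc] by (simp add: bad_crossings_def split_def conj_ac)
  have zero: "(\<integral>\<^sup>+c. bad_crossings \<alpha> \<alpha>' (c, r, n) \<partial>lborel) = 0" if n: "norm n = 1" and r: "r > 0" for n r
  proof -
    define G where "G t c = (if n \<bullet> \<alpha>' t = 0 \<or> norm (\<alpha> t - c) = r then 1 else 0 :: ennreal)" for t c
    have [measurable]: "(\<lambda>(t, c). G t c) \<in> borel_measurable (borel \<Otimes>\<^sub>M borel)" unfolding G_def by measurable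
    have eq: "bad_crossings \<alpha> \<alpha>' (c, r, n) = (\<integral>\<^sup>+t. G t c * indicator {t\<in>{0..<1}. n \<bullet> (\<alpha> t - c) = 0} t \<partial>count_space UNIV)" for c
    proof -
      have "(\<integral>\<^sup>+t. G t c * indicator {t\<in>{0..<1}. n \<bullet> (\<alpha> t - c) = 0} t \<partial>count_space UNIV)
        = (\<integral>\<^sup>+t. indicator {t\<in>{0..<1}. n \<bullet> (\<alpha> t - c) = 0 \<and> (n \<bullet> \<alpha>' t = 0 \<or> dist c (\<alpha> t) = r)} t \<partial>count_space UNIV)"
        by (intro nn_integral_cong) (auto simp: G_def indicator_def dist_norm norm_minus_commute)
      then show ?thesis by (simp add: bad_crossings_def)
    qed
    have "(\<lambda>c. bad_crossings \<alpha> \<alpha>' (c, r, n)) \<in> borel_measurable borel"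
      by (intro measurable_compose[OF _ B] borel_measurable_continuous_onI continuous_intros)
    then have "(\<integral>\<^sup>+c. bad_crossings \<alpha> \<alpha>' (c, r, n) \<partial>lborel) = (\<integral>\<^sup>+t. indicator {0..<1} t * (\<integral>\<^sup>+y. indicator {0..1} (n \<bullet> y) * ennreal \<bar>n \<bullet> \<alpha>' t\<bar>
        * G t (\<alpha> t - (y - (n \<bullet> y) *\<^sub>R n)) \<partial>lborel) \<partial>lborel)"
      unfolding eq by (intro nn_integral_centers[OF n \<alpha>]) measurable
    also have "\<dots> = (\<integral>\<^sup>+t. 0 \<partial>(lborel :: real measure))"
    proof (rule nn_integral_cong)
      fix t
      obtain f1 f2 where f: "orthonormal_pair f1 f2" "cross3 f1 f2 = n" using n by (rule obtain_orthonormal_pair)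
      have nn: "n \<bullet> n = 1" using n by (simp add: norm_eq_1)
      define g where "g x = (indicator {r} (norm x) :: ennreal)" for x :: "real^3"
      have [measurable]: "g \<in> borel_measurable borel" unfolding g_def by measurable
      have "(\<integral>\<^sup>+y. indicator {0..1} (n \<bullet> y) * ennreal \<bar>n \<bullet> \<alpha>' t\<bar> * G t (\<alpha> t - (y - (n \<bullet> y) *\<^sub>R n)) \<partial>lborel)
        = (\<integral>\<^sup>+x. ennreal \<bar>n \<bullet> \<alpha>' t\<bar> * (indicator {0..1} (- (x \<bullet> n) / (- n \<bullet> n)) * g (x + (- (x \<bullet> n) / (- n \<bullet> n)) *\<^sub>R (- n))) \<partial>lborel)"
        by (intro nn_integral_cong) (auto simp: nn g_def G_def inner_commute indicator_def)
      also have "\<dots> = ennreal \<bar>n \<bullet> \<alpha>' t\<bar> * (\<integral>\<^sup>+x. indicator {0..1} (- (x \<bullet> n) / (- n \<bullet> n)) * g (x + (- (x \<bullet> n) / (- n \<bullet> n)) *\<^sub>R (- n)) \<partial>lborel)"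
        by (rule nn_integral_cmult) measurable
      also have "(\<integral>\<^sup>+x. indicator {0..1} (- (x \<bullet> n) / (- n \<bullet> n)) * g (x + (- (x \<bullet> n) / (- n \<bullet> n)) *\<^sub>R (- n)) \<partial>lborel)
        = ennreal (\<bar>- n \<bullet> n\<bar> / norm n) * (\<integral>\<^sup>+a. \<integral>\<^sup>+b. g (a *\<^sub>R f1 + b *\<^sub>R f2) \<partial>lborel \<partial>lborel)"
        using f nn n by (intro nn_integral_slab_projection) auto
      also have "(\<integral>\<^sup>+a. \<integral>\<^sup>+b. g (a *\<^sub>R f1 + b *\<^sub>R f2) \<partial>lborel \<partial>lborel)
        = (\<integral>\<^sup>+a. \<integral>\<^sup>+b. indicator (sphere (0 :: real \<times> real) r) (a, b) \<partial>lborel \<partial>lborel)"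
        by (simp add: g_def norm_orthonormal_pair[OF f(1)] norm_Pair indicator_def)
      also have "\<dots> = (\<integral>\<^sup>+z. indicator (sphere (0 :: real \<times> real) r) z \<partial>(lborel \<Otimes>\<^sub>M lborel))"
        by (rule lborel.nn_integral_fst) (simp only: lborel_prod, intro borel_measurable_indicator, simp)
      also have "\<dots> = 0"
      proof -
        have "emeasure lborel (sphere (0 :: real \<times> real) r) = 0"
          using negligible_sphere[of "0 :: real \<times> real" r] by (simp add: negligible_iff_null_sets null_sets_def)
        then show ?thesis by (simp add: lborel_prod)
      qed
      finally show "indicator {0..<1} t * (\<integral>\<^sup>+y. indicator {0..1} (n \<bullet> y) * ennreal \<bar>n \<bullet> \<alpha>' t\<bar> * G t (\<alpha> t - (y - (n \<bullet> y) *\<^sub>R n)) \<partial>lborel) = 0"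
        by simp
    qed
    finally show ?thesis by simp
  qed
  have "(\<integral>\<^sup>+\<gamma>. indicator circles \<gamma> * bad_crossings \<alpha> \<alpha>' \<gamma> \<partial>circle_measure)
    = (\<integral>\<^sup>+x. 3 * indicator (ball 0 1) x * (\<integral>\<^sup>+r. ennreal (1 / r ^ 4) *
      (\<integral>\<^sup>+c. indicator circles (c, r, sgn x) * bad_crossings \<alpha> \<alpha>' (c, r, sgn x) \<partial>lborel) \<partial>lborel) \<partial>lborel)"
    by (rule nn_integral_circle_measure) measurable
  also have "\<dots> = 0"
  proof -
    have "(\<integral>\<^sup>+c. indicator circles (c, r, sgn x) * bad_crossings \<alpha> \<alpha>' (c, r, sgn x) \<partial>lborel) = 0" for r x
    proof (cases "r > 0 \<and> norm (sgn x) = 1")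
      case True
      then show ?thesis using zero[of "sgn x" r] by (simp add: circles_def)
    qed (auto simp: circles_def)
    then show ?thesis by simp
  qed
  finally have "AE \<gamma> in circle_measure. indicator circles \<gamma> * bad_crossings \<alpha> \<alpha>' \<gamma> = 0"
    by (subst (asm) nn_integral_0_iff_AE) (auto, measurable)
  then show ?thesis by eventually_elim (auto simp: indicator_def)
qed

section \<open>Chords and tangents of a closed curve\<close>

lemma closed_C2_curveD:
  assumes K: "closed_C2_curve K"
  shows "(K i has_vector_derivative velocity (K i) t) (at t)"
    and "continuous_on UNIV (velocity (K i))"
    and "K i (t + 1) = K i t"
    and "velocity (K i) t \<noteq> 0"
    and "continuous_on UNIV (K i)"
    and "\<exists>A. (\<forall>t. (velocity (K i) has_vector_derivative A t) (at t)) \<and> continuous_on UNIV A"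
proof -
  from K obtain \<alpha>' A where A: "\<And>t. (K i has_vector_derivative \<alpha>' t) (at t)" "\<And>t. (\<alpha>' has_vector_derivative A t) (at t)"
    "continuous_on UNIV A"
    unfolding closed_C2_curve_def C2_path_def by metis
  have v: "velocity (K i) x = \<alpha>' x" for x using A(1) by (rule vector_derivative_at)
  show "(K i has_vector_derivative velocity (K i) t) (at t)"
    "\<exists>A. (\<forall>t. (velocity (K i) has_vector_derivative A t) (at t)) \<and> continuous_on UNIV A"
    unfolding v using A by auto
  show "continuous_on UNIV (velocity (K i))" "continuous_on UNIV (K i)"
    unfolding v using A by (meson continuous_at_imp_continuous_on has_vector_derivative_continuous)+
  show "K i (t + 1) = K i t" "velocity (K i) t \<noteq> 0" using K by (auto simp: closed_C2_curve_def)
qed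

lemma closed_C2_curve_inj:
  assumes "closed_C2_curve K" "s \<in> {0..<1}" "t \<in> {0..<1}"
  shows "K i s = K j t \<longleftrightarrow> i = j \<and> s = t"
  using assms inj_onD[of "\<lambda>(i, t). K i t" "UNIV \<times> {0..<1}" "(i, s)" "(j, t)"]
  by (auto simp: closed_C2_curve_def)

lemma norm_cross3_le: "norm (cross3 a b) \<le> norm a * norm b"
proof -
  have "(norm (cross3 a b))\<^sup>2 \<le> (norm a * norm b)\<^sup>2" using norm_cross_dot[of a b] zero_le_power2[of "a \<bullet> b"] by linarith
  then show ?thesis by (rule power2_le_imp_le) simp
qed

text \<open>By Taylor expansion, the chord is \<open>h *\<^sub>R \<alpha>' s\<close> plus a
  remainder of order h^2. The cross product with \<open>\<alpha>' s\<close> kills the linear part,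
  while the chord itself is at least of order |h|, because the speed is bounded below.\<close>

lemma tangent_cross_bound_near:
  fixes \<alpha> \<alpha>' A :: "real \<Rightarrow> real^3"
  assumes \<alpha>: "\<And>t. (\<alpha> has_vector_derivative \<alpha>' t) (at t)" and A: "\<And>t. (\<alpha>' has_vector_derivative A t) (at t)" "continuous_on UNIV A"
    and nz: "\<And>t. \<alpha>' t \<noteq> 0"
  obtains \<delta> B where "\<delta> > 0" "\<And>s t. s \<in> {0..1} \<Longrightarrow> \<bar>t - s\<bar> \<le> \<delta> \<Longrightarrow> norm (cross3 (\<alpha>' s) (\<alpha> t - \<alpha> s)) \<le> B * (norm (\<alpha> t - \<alpha> s))\<^sup>2"
proof -
  have c\<alpha>': "continuous_on S \<alpha>'" for S
    using A(1) by (meson continuous_at_imp_continuous_on has_vector_derivative_continuous)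
  have "bounded (A ` {-1..2})"
    by (intro compact_imp_bounded compact_continuous_image continuous_on_subset[OF A(2)]) auto
  then obtain C where C: "C > 0" "\<And>x. x \<in> {-1..2} \<Longrightarrow> norm (A x) \<le> C" unfolding bounded_pos by blast
  have "bounded (\<alpha>' ` {0..1})" by (intro compact_imp_bounded compact_continuous_image c\<alpha>') auto
  then obtain M where M: "M > 0" "\<And>x. x \<in> {0..1} \<Longrightarrow> norm (\<alpha>' x) \<le> M" unfolding bounded_pos by blast
  obtain x0 where x0: "x0 \<in> {0..1}" "\<And>x. x \<in> {0..1} \<Longrightarrow> norm (\<alpha>' x0) \<le> norm (\<alpha>' x)"
    using continuous_attains_inf[OF compact_Icc _ continuous_on_norm[OF c\<alpha>'], of 0 1] by auto
  define m where "m = norm (\<alpha>' x0)"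
  have m: "m > 0" using nz by (simp add: m_def)
  \<comment> \<open>The bound \<open>m / (6 * C)\<close> makes the remainder
    \<open>3 * C * h\<^sup>2\<close> at most half of \<open>m * \<bar>h\<bar>\<close>; the bound 1
    keeps the segment inside \<open>{-1..2}\<close>, where \<open>C\<close> bounds
    \<open>A\<close>.\<close>
  define \<delta> where "\<delta> = min 1 (m / (6 * C))"
  have \<delta>: "\<delta> > 0" "\<delta> \<le> 1" using m C by (auto simp: \<delta>_def)
  have main: "norm (cross3 (\<alpha>' s) (\<alpha> t - \<alpha> s)) \<le> 3 * C * M * (4 / m\<^sup>2) * (norm (\<alpha> t - \<alpha> s))\<^sup>2" if s: "s \<in> {0..1}" and t: "\<bar>t - s\<bar> \<le> \<delta>" for s t
  proof -
    have seg: "closed_segment s t \<subseteq> {-1..2}" using s t \<delta>(2) by (auto simp: closed_segment_eq_real_ivl split: if_splits)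
    \<comment> \<open>Of the factor \<open>3 * C\<close>, the part \<open>2 * C\<close> bounds the
      variation of \<open>A\<close>, and \<open>C\<close> bounds \<open>A s\<close> itself.\<close>
    have lip: "norm (\<alpha>' x - \<alpha>' s) \<le> 3 * C * \<bar>t - s\<bar>" if x: "x \<in> closed_segment s t" for x
    proof -
      have sub: "closed_segment s x \<subseteq> {-1..2}" using seg x s by (auto simp: closed_segment_eq_real_ivl split: if_splits)
      have "norm (\<alpha>' x - \<alpha>' s - (x - s) *\<^sub>R A s) \<le> norm (x - s) * (2 * C)"
      proof (rule vector_differentiable_bound_linearization[OF has_vector_derivative_at_within[OF A(1)] sub])
        show "norm (A y - A s) \<le> 2 * C" if "y \<in> {-1..2}" for y
          using norm_triangle_ineq4[of "A y" "A s"] C(2)[OF that] C(2)[of s] s by auto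
      qed (use s in auto)
      moreover have "norm ((x - s) *\<^sub>R A s) \<le> \<bar>x - s\<bar> * C" using C(2)[of s] s by (auto intro!: mult_left_mono)
      ultimately have "norm (\<alpha>' x - \<alpha>' s) \<le> 3 * C * \<bar>x - s\<bar>"
        using norm_triangle_ineq[of "\<alpha>' x - \<alpha>' s - (x - s) *\<^sub>R A s" "(x - s) *\<^sub>R A s"]
        by (simp add: mult_ac)
      also have "\<dots> \<le> 3 * C * \<bar>t - s\<bar>"
        using x C(1) by (intro mult_left_mono) (auto simp: closed_segment_eq_real_ivl split: if_splits)
      finally show ?thesis .
    qed
    define h where "h = t - s"
    define w where "w = \<alpha> t - \<alpha> s"
    define R where "R = w - h *\<^sub>R \<alpha>' s"
    have R: "norm R \<le> 3 * C * h\<^sup>2"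
    proof -
      have "norm (\<alpha> t - \<alpha> s - (t - s) *\<^sub>R \<alpha>' s) \<le> norm (t - s) * (3 * C * \<bar>t - s\<bar>)"
        by (rule vector_differentiable_bound_linearization[OF has_vector_derivative_at_within[OF \<alpha>] subset_refl lip]) auto
      then show ?thesis by (simp add: R_def w_def h_def power2_eq_square mult_ac)
    qed
    have "cross3 (\<alpha>' s) w = cross3 (\<alpha>' s) R"
      by (simp add: R_def Cross3.right_diff_distrib cross_mult_right)
    then have "norm (cross3 (\<alpha>' s) w) \<le> M * (3 * C * h\<^sup>2)"
      using norm_cross3_le[of "\<alpha>' s" R] mult_mono[OF M(2)[OF s] R] M(1) by simp
    also have "\<dots> \<le> M * (3 * C * (4 / m\<^sup>2 * (norm w)\<^sup>2))"
    proof -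
      have "\<bar>h\<bar> * m \<le> norm (h *\<^sub>R \<alpha>' s)" using x0(2)[OF s] by (auto simp: m_def intro!: mult_left_mono)
      also have "\<dots> \<le> norm w + norm R" using norm_triangle_ineq4[of w R] by (simp add: R_def)
      also have "norm R \<le> \<bar>h\<bar> * (m / 2)"
      proof -
        have "3 * C * \<bar>h\<bar> \<le> 3 * C * (m / (6 * C))" using t C(1) by (intro mult_left_mono) (auto simp: h_def \<delta>_def)
        then have "3 * C * \<bar>h\<bar> \<le> m / 2" using C(1) by simp
        then have "\<bar>h\<bar> * (3 * C * \<bar>h\<bar>) \<le> \<bar>h\<bar> * (m / 2)" by (intro mult_left_mono) auto
        moreover have "\<bar>h\<bar> * (3 * C * \<bar>h\<bar>) = 3 * C * h\<^sup>2" by (simp add: power2_eq_square)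
        ultimately show ?thesis using R by linarith
      qed
      finally have "\<bar>h\<bar> * (m / 2) \<le> norm w" by (simp add: field_simps)
      then have "\<bar>h\<bar> \<le> 2 / m * norm w" using m by (simp add: field_simps)
      then have "\<bar>h\<bar>\<^sup>2 \<le> (2 / m * norm w)\<^sup>2" by (intro power_mono) auto
      then have "h\<^sup>2 \<le> 4 / m\<^sup>2 * (norm w)\<^sup>2" by (simp add: power_mult_distrib power_divide)
      then show ?thesis using M(1) C(1) by (intro mult_left_mono) auto
    qed
    finally show ?thesis by (simp add: w_def mult_ac)
  qed
  show thesis using that[OF \<delta>(1) main] .
qed

text \<open>Parameters of one component that are close modulo the period are covered by
  \<open>tangent_cross_bound_near\<close>. The remaining pairs form a compact set, on which the
  chord length has a positive lower bound \<open>c\<close> because the curve is embedded; there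
  \<open>M / c\<close> is a suitable constant.\<close>

lemma tangent_cross_bound:
  fixes K :: "'i::finite \<Rightarrow> real \<Rightarrow> real^3"
  assumes K: "closed_C2_curve K"
  obtains B where "\<And>i j s t. s \<in> {0..1} \<Longrightarrow> t \<in> {0..1} \<Longrightarrow> norm (cross3 (velocity (K i) s) (K j t - K i s)) \<le> B * (norm (K j t - K i s))\<^sup>2"
proof -
  note D = closed_C2_curveD[OF K]
  have "\<exists>B. \<forall>s\<in>{0..1}. \<forall>t\<in>{0..1}. norm (cross3 (velocity (K i) s) (K j t - K i s)) \<le> B * (norm (K j t - K i s))\<^sup>2" for i j
  proof -
    obtain A where A: "\<And>t. (velocity (K i) has_vector_derivative A t) (at t)" "continuous_on UNIV A" using D(6) by blast
    obtain \<delta> B1 where near: "\<delta> > 0" "\<And>s t. s \<in> {0..1} \<Longrightarrow> \<bar>t - s\<bar> \<le> \<delta> \<Longrightarrow> norm (cross3 (velocity (K i) s) (K i t - K i s)) \<le> B1 * (norm (K i t - K i s))\<^sup>2"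
      using tangent_cross_bound_near[OF D(1) A D(4)] by blast
    have "bounded (velocity (K i) ` {0..1})"
      by (intro compact_imp_bounded compact_continuous_image continuous_on_subset[OF D(2)]) auto
    then obtain M where M: "M > 0" "\<And>x. x \<in> {0..1} \<Longrightarrow> norm (velocity (K i) x) \<le> M" unfolding bounded_pos by blast
    \<comment> \<open>Closeness is tested modulo 1; for parameters in [0, 1] the shifts by 0, 1 and
      -1 suffice.\<close>
    define F where "F = {z \<in> {0..1} \<times> {0..1}. i \<noteq> j \<or> (\<delta> \<le> \<bar>snd z - fst z\<bar> \<and> \<delta> \<le> \<bar>snd z + 1 - fst z\<bar> \<and> \<delta> \<le> \<bar>snd z - 1 - fst z\<bar>)}"
    have "compact F"
    proof (cases "i = j")
      case True
      have "F = ({0..1} \<times> {0..1}) \<inter> ({z. \<delta> \<le> \<bar>snd z - fst z\<bar>} \<inter> {z. \<delta> \<le> \<bar>snd z + 1 - fst z\<bar>} \<inter> {z. \<delta> \<le> \<bar>snd z - 1 - fst z\<bar>})"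
        using True by (auto simp: F_def)
      then show ?thesis
        by (auto intro!: compact_Int_closed compact_Times closed_Int closed_Collect_le continuous_intros)
    next
      case False
      then have "F = {0..1} \<times> {0..1}" by (auto simp: F_def)
      then show ?thesis by (auto intro: compact_Times)
    qed
    have nz: "K j (snd z) - K i (fst z) \<noteq> 0" if z: "z \<in> F" for z
    proof
      assume eq0: "K j (snd z) - K i (fst z) = 0"
      \<comment> \<open>Injectivity is stated on the half-open interval, so the parameter 1 is
        replaced by 0.\<close>
      define fr :: "real \<Rightarrow> real" where "fr x = (if x = 1 then 0 else x)" for x
      have fr: "K k (fr x) = K k x" for k x using D(3)[of k 0] by (simp add: fr_def)
      have "fr (fst z) \<in> {0..<1}" "fr (snd z) \<in> {0..<1}" using z by (auto simp: fr_def F_def)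
      moreover have "K i (fr (fst z)) = K j (fr (snd z))" using eq0 by (simp add: fr)
      ultimately have "i = j" "fr (fst z) = fr (snd z)" using closed_C2_curve_inj[OF K] by blast+
      then show False using z near(1) by (auto simp: F_def fr_def split: if_splits)
    qed
    have "\<exists>c>0. \<forall>z\<in>F. c \<le> norm (K j (snd z) - K i (fst z))"
    proof (cases "F = {}")
      case False
      have "continuous_on F (\<lambda>z. norm (K j (snd z) - K i (fst z)))"
        by (intro continuous_intros continuous_on_subset[OF continuous_on_curve[OF D(5)]]) auto
      then obtain z0 where "z0 \<in> F" "\<forall>z\<in>F. norm (K j (snd z0) - K i (fst z0)) \<le> norm (K j (snd z) - K i (fst z))"
        using continuous_attains_inf[OF \<open>compact F\<close> False] by blast
      then show ?thesis using nz[of z0] by (intro exI[of _ "norm (K j (snd z0) - K i (fst z0))"]) auto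
    qed (auto intro: exI[of _ 1])
    then obtain c where c: "c > 0" "\<And>z. z \<in> F \<Longrightarrow> c \<le> norm (K j (snd z) - K i (fst z))" by blast
    show ?thesis
    proof (intro exI[of _ "max B1 (M / c)"] ballI)
      fix s t :: real assume s: "s \<in> {0..1}" and t: "t \<in> {0..1}"
      define w where "w = K j t - K i s"
      show "norm (cross3 (velocity (K i) s) (K j t - K i s)) \<le> max B1 (M / c) * (norm (K j t - K i s))\<^sup>2"
      proof (cases "(s, t) \<in> F")
        case True
        have "norm (cross3 (velocity (K i) s) w) \<le> M * norm w"
          using norm_cross3_le[of "velocity (K i) s" w] mult_right_mono[OF M(2)[OF s] norm_ge_zero[of w]] by linarith
        also have "\<dots> \<le> M * norm w * (norm w / c)"
        proof -
          have "1 \<le> norm w / c" using c(1) c(2)[OF True] by (simp add: w_def)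
          then show ?thesis using mult_left_mono[of 1 "norm w / c" "M * norm w"] M(1) by simp
        qed
        also have "\<dots> = M / c * (norm w)\<^sup>2" by (simp add: power2_eq_square)
        also have "\<dots> \<le> max B1 (M / c) * (norm w)\<^sup>2" by (intro mult_right_mono) auto
        finally show ?thesis by (simp add: w_def)
      next
        case False
        then have ij: "i = j" using s t by (auto simp: F_def)
        have "\<exists>t'. K i t' = K i t \<and> \<bar>t' - s\<bar> \<le> \<delta>"
        proof -
          have "\<bar>t - s\<bar> \<le> \<delta> \<or> \<bar>t + 1 - s\<bar> \<le> \<delta> \<or> \<bar>t - 1 - s\<bar> \<le> \<delta>" using False s t ij by (auto simp: F_def)
          moreover have "K i (t + 1) = K i t" "K i (t - 1) = K i t" using D(3)[of i t] D(3)[of i "t - 1"] by auto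
          ultimately show ?thesis by blast
        qed
        then obtain t' where "K i t' = K i t" "\<bar>t' - s\<bar> \<le> \<delta>" by blast
        then have "norm (cross3 (velocity (K i) s) (K j t - K i s)) \<le> B1 * (norm (K j t - K i s))\<^sup>2"
          using near(2)[OF s, of t'] ij by simp
        also have "\<dots> \<le> max B1 (M / c) * (norm (K j t - K i s))\<^sup>2" by (intro mult_right_mono) auto
        finally show ?thesis .
      qed
    qed
  qed
  then obtain B where B: "\<And>i j s t. s \<in> {0..1} \<Longrightarrow> t \<in> {0..1} \<Longrightarrow> norm (cross3 (velocity (K i) s) (K j t - K i s)) \<le> B i j * (norm (K j t - K i s))\<^sup>2"
    by metis
  show thesis
  proof (rule that[of "\<Sum>i\<in>UNIV. \<Sum>j\<in>UNIV. \<bar>B i j\<bar>"])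
    fix i j and s t :: real assume st: "s \<in> {0..1}" "t \<in> {0..1}"
    have "B i j \<le> (\<Sum>j\<in>UNIV. \<bar>B i j\<bar>)"
      using member_le_sum[of j UNIV "\<lambda>j. \<bar>B i j\<bar>"] by simp
    also have "\<dots> \<le> (\<Sum>i\<in>UNIV. \<Sum>j\<in>UNIV. \<bar>B i j\<bar>)"
      by (rule member_le_sum) (auto intro: sum_nonneg)
    finally show "norm (cross3 (velocity (K i) s) (K j t - K i s)) \<le> (\<Sum>i\<in>UNIV. \<Sum>j\<in>UNIV. \<bar>B i j\<bar>) * (norm (K j t - K i s))\<^sup>2"
      using B[OF st, of i j] by (meson mult_right_mono order_trans zero_le_power2)
  qed
qed

section \<open>Circles and closed curves\<close>

lemma has_bochner_integral_enn2real:
  assumes [measurable]: "f \<in> borel_measurable M" and f: "(\<integral>\<^sup>+x. f x \<partial>M) = ennreal a" "0 \<le> a"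
  shows "has_bochner_integral M (\<lambda>x. enn2real (f x)) a"
proof -
  have "AE x in M. f x \<noteq> \<infinity>" using f by (intro nn_integral_noteq_infinite) auto
  then have "(\<integral>\<^sup>+x. ennreal (enn2real (f x)) \<partial>M) = (\<integral>\<^sup>+x. f x \<partial>M)"
    by (intro nn_integral_cong_AE) (auto simp: less_top)
  then show ?thesis using f by (intro has_bochner_integral_nn_integral) auto
qed

lemma measurable_disk_intersections:
  fixes K :: "'i::finite \<Rightarrow> real \<Rightarrow> real^3"
  assumes K: "closed_C2_curve K"
  shows "(\<lambda>\<gamma>. disk_intersections \<gamma> K) \<in> borel_measurable borel"
proof -
  note D = closed_C2_curveD[OF K]
  have sc_range: "sigma_compact (range (K i))" for i
    by (intro sigma_compact_image closed_imp_sigma_compact closed_UNIV D(5))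
  have tr: "sigma_compact (curve_trace K)"
    unfolding curve_trace_def by (intro sigma_compact_UN_countable sc_range) auto
  obtain C :: "nat \<Rightarrow> (real^3) set" where C: "\<And>n. compact (C n)" "curve_trace K = (\<Union>n. C n)"
    using tr unfolding sigma_compact_def by blast
  have "{z :: circle \<times> (real^3). snd z \<in> curve_trace K} = (\<Union>n. {z. snd z \<in> C n})" using C(2) by auto
  moreover have "closed {z :: circle \<times> (real^3). snd z \<in> C n}" for n
  proof -
    have "closed (snd -` C n :: (circle \<times> (real^3)) set)"
      by (intro closed_vimage compact_imp_closed C continuous_intros)
    then show ?thesis by (simp add: vimage_def)
  qed
  ultimately have "sigma_compact {z :: circle \<times> (real^3). snd z \<in> curve_trace K}"
    by (simp only:) (intro sigma_compact_UN_countable closed_imp_sigma_compact, auto)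
  then have "sigma_compact {z :: circle \<times> (real^3). snd z \<in> curve_trace K \<and> (snd z - fst (fst z)) \<bullet> snd (snd (fst z)) = 0
      \<and> dist (fst (fst z)) (snd z) \<le> fst (snd (fst z))}"
    by (rule sigma_compact_Collect_conj) (intro sigma_compact_Collect_conj sigma_compact_Collect continuous_intros)
  from borel_measurable_card_fibre[OF this]
  have [measurable]: "(\<lambda>\<gamma>. emeasure (count_space UNIV) (curve_trace K \<inter> circle_disk \<gamma>)) \<in> borel_measurable borel"
    by (simp add: circle_disk_def split_def Int_def)
  \<comment> \<open>For an infinite intersection both sides are 0, by the conventions for
    \<open>card\<close> and for \<open>enn2real\<close> of infinity.\<close>
  have "disk_intersections \<gamma> K = enn2real (emeasure (count_space UNIV) (curve_trace K \<inter> circle_disk \<gamma>))" for \<gamma>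
    by (cases "finite (curve_trace K \<inter> circle_disk \<gamma>)") (simp_all add: disk_intersections_def)
  then show ?thesis by simp
qed

lemma measurable_cross3 [measurable (raw)]:
  assumes [measurable]: "f \<in> borel_measurable M" "g \<in> borel_measurable M"
  shows "(\<lambda>x. cross3 (f x) (g x)) \<in> borel_measurable M"
proof -
  have "continuous_on UNIV (\<lambda>z. cross3 (fst z) (snd z))" by (intro continuous_on_cross continuous_intros)
  then have c: "(\<lambda>z. cross3 (fst z) (snd z)) \<in> borel_measurable (borel \<Otimes>\<^sub>M borel)"
    by (simp add: borel_prod borel_measurable_continuous_onI)
  have "(\<lambda>x. (\<lambda>z. cross3 (fst z) (snd z)) (f x, g x)) \<in> borel_measurable M"
    by (rule measurable_compose[OF _ c]) measurable
  then show ?thesis by simp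
qed

lemma measurable_linking:
  fixes K :: "'i::finite \<Rightarrow> real \<Rightarrow> real^3"
  assumes K: "closed_C2_curve K"
  shows "(\<lambda>\<gamma>. linking \<gamma> K) \<in> borel_measurable borel"
proof -
  note D = closed_C2_curveD[OF K]
  have [measurable]: "K i \<in> borel_measurable borel" "velocity (K i) \<in> borel_measurable borel" for i
    using D by (auto intro: borel_measurable_continuous_onI)
  have [measurable]: "frame_vector \<in> borel_measurable borel"
    unfolding frame_vector_def[abs_def] by measurable
  have vel: "velocity (circle_path \<gamma>) s = circle_velocity \<gamma> s" for \<gamma> s
    by (rule vector_derivative_at[OF circle_path_has_vector_derivative])
  have [measurable]: "(\<lambda>z. circle_path (fst z) (snd z)) \<in> borel_measurable ((borel \<Otimes>\<^sub>M borel \<Otimes>\<^sub>M borel) \<Otimes>\<^sub>M borel)"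
    "(\<lambda>z. circle_velocity (fst z) (snd z)) \<in> borel_measurable ((borel \<Otimes>\<^sub>M borel \<Otimes>\<^sub>M borel) \<Otimes>\<^sub>M borel)"
    unfolding circle_path_def circle_velocity_def split_def by measurable
  have "(\<lambda>\<gamma>. linking_number (circle_path \<gamma>) (K i)) \<in> borel_measurable (borel \<Otimes>\<^sub>M borel \<Otimes>\<^sub>M borel)" for i
  proof -
    have eq: "linking_number (circle_path \<gamma>) (K i) = 1 / (4 * pi) * integral\<^sup>L (lborel \<Otimes>\<^sub>M lborel) (\<lambda>z. indicator ({0..1} \<times> {0..1}) z *\<^sub>R
        ((circle_path \<gamma> (fst z) - K i (snd z)) \<bullet> cross3 (circle_velocity \<gamma> (fst z)) (velocity (K i) (snd z))
          / norm (circle_path \<gamma> (fst z) - K i (snd z)) ^ 3))" for \<gamma>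
      by (simp add: linking_number_def set_lebesgue_integral_def vel split_def lborel_prod)
    have [measurable]: "(\<lambda>q. circle_path (fst q) (fst (snd q))) \<in> borel_measurable ((borel \<Otimes>\<^sub>M borel \<Otimes>\<^sub>M borel) \<Otimes>\<^sub>M lborel \<Otimes>\<^sub>M lborel)"
      "(\<lambda>q. circle_velocity (fst q) (fst (snd q))) \<in> borel_measurable ((borel \<Otimes>\<^sub>M borel \<Otimes>\<^sub>M borel) \<Otimes>\<^sub>M lborel \<Otimes>\<^sub>M lborel)"
      unfolding circle_path_def circle_velocity_def split_def by measurable
    show ?thesis unfolding eq
      by (intro borel_measurable_times borel_measurable_const sigma_finite_measure.borel_measurable_lebesgue_integral)
         (simp add: lborel_prod sigma_finite_lborel, simp add: split_def, measurable)
  qed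
  then show ?thesis unfolding linking_def[abs_def] by (simp add: borel_prod)
qed

lemma periodic_frac:
  assumes "\<And>t::real. f (t + 1) = f t"
  shows "f (frac t) = f t"
proof -
  have nat: "f (x + of_nat k) = f x" for x k
    by (induction k) (use assms in \<open>simp_all add: add.assoc[symmetric] add.commute[of 1]\<close>)
  have "f (x + of_int k) = f x" for x k
  proof (cases k rule: int_cases2)
    case (nonneg n)
    then show ?thesis using nat[of x n] by simp
  next
    case (nonpos n)
    then show ?thesis using nat[of "x - of_nat n" n] by simp
  qed
  from this[of "frac t" "\<lfloor>t\<rfloor>"] show ?thesis by (simp add: frac_def)
qed

text \<open>By injectivity, the pairs with equal points are exactly the diagonal ones,
  \<open>i = j\<close> and \<open>s = t\<close>. Each of them contributes 1 to the expanded square,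
  and together they cancel the number of points in the disk.\<close>

lemma disk_intersections_minus_linking_square:
  fixes K :: "'i::finite \<Rightarrow> real \<Rightarrow> real^3"
  assumes K: "closed_C2_curve K" and \<gamma>: "\<gamma> \<in> circles"
    and good: "\<And>i. bad_crossings (K i) (velocity (K i)) \<gamma> = 0"
  shows "disk_intersections \<gamma> K = (\<Sum>i\<in>UNIV. enn2real (crossings (K i) \<gamma>))"
    and "disk_intersections \<gamma> K - (linking \<gamma> K)\<^sup>2 = (\<Sum>i\<in>UNIV. \<Sum>j\<in>UNIV.
      enn2real (crossing_pairs (K i) (velocity (K i)) (K j) (velocity (K j)) (- 1) \<gamma>)
      - enn2real (crossing_pairs (K i) (velocity (K i)) (K j) (velocity (K j)) 1 \<gamma>))"
proof -
  note D = closed_C2_curveD[OF K]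
  define V where "V i = velocity (K i)" for i
  obtain c r n where \<gamma>_eq: "\<gamma> = (c, r, n)" by (cases \<gamma>)
  have r: "r > 0" and n: "norm n = 1" using \<gamma> by (auto simp: \<gamma>_eq circles_def)
  have per_V: "V i (t + 1) = V i t" for i t
  proof -
    have "((\<lambda>t. t + 1) has_vector_derivative 1) (at t)" by (auto intro!: derivative_eq_intros)
    from vector_diff_chain_at[OF this D(1)] have "((\<lambda>t. K i (t + 1)) has_vector_derivative V i (t + 1)) (at t)"
      by (simp add: o_def V_def)
    then show ?thesis using D(1)[of i t] unfolding D(3) V_def by (rule vector_derivative_unique_at)
  qed
  \<comment> \<open>\<open>bad_crossings\<close> only sees parameters in [0, 1), whereas
    \<open>linking_number_circle\<close> asks for all parameters; periodicity closes the
    gap.\<close>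
  have trans: "n \<bullet> V i t \<noteq> 0 \<and> dist c (K i t) \<noteq> r" if "n \<bullet> (K i t - c) = 0" for i t
  proof -
    have "frac t \<notin> {t\<in>{0..<1}. n \<bullet> (K i t - c) = 0 \<and> (n \<bullet> V i t = 0 \<or> dist c (K i t) = r)}"
      using good[of i] by (simp add: bad_crossings_def \<gamma>_eq V_def emeasure_count_space_eq_0)
    moreover have "frac t \<in> {0..<1}" by (simp add: frac_lt_1)
    moreover have "K i (frac t) = K i t" "V i (frac t) = V i t"
      using periodic_frac[of "K i" t] D(3) periodic_frac[of "V i" t] per_V by auto
    ultimately show ?thesis using that by simp
  qed
  define S where "S i = {t\<in>{0..<1}. K i t \<in> circle_disk \<gamma>}" for i
  have S_sub: "S i \<subseteq> {t\<in>{0..<1}. n \<bullet> (K i t - c) = 0}" for i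
    by (auto simp: S_def \<gamma>_eq circle_disk_def inner_commute)
  have fin: "finite (S i)" for i
    using linking_number_circle(1)[OF n r D(1,2,3) trans[unfolded V_def]] S_sub finite_subset by blast
  have link: "linking \<gamma> K = (\<Sum>i\<in>UNIV. \<Sum>t\<in>S i. sgn (n \<bullet> V i t))"
    unfolding linking_def \<gamma>_eq V_def S_def
    by (intro sum.cong refl linking_number_circle(2)[OF n r D(1,2,3) trans[unfolded V_def]])
  have nz: "n \<bullet> V i t \<noteq> 0" if "t \<in> S i" for i t using trans[of i t] S_sub that by blast
  have inj: "K i s = K j t \<longleftrightarrow> i = j \<and> s = t" if "s \<in> S i" "t \<in> S j" for i j s t
    using closed_C2_curve_inj[OF K] that by (auto simp: S_def)
  have inter: "disk_intersections \<gamma> K = (\<Sum>i\<in>UNIV. real (card (S i)))"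
  proof -
    have "curve_trace K \<inter> circle_disk \<gamma> = (\<lambda>(i, t). K i t) ` (SIGMA i:UNIV. S i)"
    proof (intro equalityI subsetI)
      fix x assume x: "x \<in> curve_trace K \<inter> circle_disk \<gamma>"
      then obtain i t where "x = K i t" by (auto simp: curve_trace_def)
      then have "x = K i (frac t)" using periodic_frac[of "K i" t] D(3) by simp
      moreover have "frac t \<in> S i" using x calculation by (auto simp: S_def frac_lt_1)
      ultimately show "x \<in> (\<lambda>(i, t). K i t) ` (SIGMA i:UNIV. S i)" by force
    qed (auto simp: curve_trace_def S_def)
    moreover have "inj_on (\<lambda>(i, t). K i t) (SIGMA i:UNIV. S i)"
      by (rule inj_onI) (auto simp: inj)
    ultimately have "card (curve_trace K \<inter> circle_disk \<gamma>) = card (SIGMA i:UNIV. S i)" by (simp add: card_image)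
    also have "\<dots> = (\<Sum>i\<in>UNIV. card (S i))" using fin by (simp add: card_SigmaI)
    finally show ?thesis by (simp add: disk_intersections_def)
  qed
  have crossings: "enn2real (crossings (K i) \<gamma>) = real (card (S i))" for i
    using fin[of i] by (simp add: crossings_def S_def)
  show "disk_intersections \<gamma> K = (\<Sum>i\<in>UNIV. enn2real (crossings (K i) \<gamma>))"
    by (simp add: inter crossings)
  have pairs: "enn2real (crossing_pairs (K i) (V i) (K j) (V j) \<sigma> \<gamma>)
    = (\<Sum>s\<in>S i. \<Sum>t\<in>S j. of_bool (K i s \<noteq> K j t \<and> \<sigma> * ((n \<bullet> V i s) * (n \<bullet> V j t)) > 0))" for i j \<sigma>
  proof -
    let ?P = "{z \<in> S i \<times> S j. K i (fst z) \<noteq> K j (snd z) \<and> \<sigma> * ((n \<bullet> V i (fst z)) * (n \<bullet> V j (snd z))) > 0}"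
    have "crossing_pairs (K i) (V i) (K j) (V j) \<sigma> \<gamma> = emeasure (count_space UNIV) ?P"
      unfolding crossing_pairs_def \<gamma>_eq prod.case
      by (rule arg_cong[where f="emeasure (count_space UNIV)"]) (auto simp: S_def \<gamma>_eq)
    then have "enn2real (crossing_pairs (K i) (V i) (K j) (V j) \<sigma> \<gamma>) = real (card ?P)"
      using fin by simp
    also have "\<dots> = (\<Sum>z\<in>S i \<times> S j. of_bool (K i (fst z) \<noteq> K j (snd z) \<and> \<sigma> * ((n \<bullet> V i (fst z)) * (n \<bullet> V j (snd z))) > 0))"
      using fin by (simp add: sum_of_bool_eq Int_def)
    also have "\<dots> = (\<Sum>s\<in>S i. \<Sum>t\<in>S j. of_bool (K i s \<noteq> K j t \<and> \<sigma> * ((n \<bullet> V i s) * (n \<bullet> V j t)) > 0))"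
      by (simp add: sum.cartesian_product split_def)
    finally show ?thesis .
  qed
  have diag: "(\<Sum>i\<in>UNIV. real (card (S i))) = (\<Sum>i\<in>UNIV. \<Sum>j\<in>UNIV. \<Sum>s\<in>S i. \<Sum>t\<in>S j. of_bool (i = j \<and> s = t))"
  proof (rule sum.cong[OF refl])
    fix i
    have "(\<Sum>j\<in>UNIV. \<Sum>s\<in>S i. \<Sum>t\<in>S j. of_bool (i = j \<and> s = t)) = (\<Sum>j\<in>{i}. \<Sum>s\<in>S i. \<Sum>t\<in>S j. of_bool (i = j \<and> s = t) :: real)"
      by (rule sum.mono_neutral_right) auto
    also have "\<dots> = (\<Sum>s\<in>S i. 1)"
    proof -
      have "(\<Sum>t\<in>S i. of_bool (s = t)) = (1::real)" if "s \<in> S i" for s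
        using fin[of i] that by (simp add: of_bool_def)
      then show ?thesis by simp
    qed
    finally show "real (card (S i)) = (\<Sum>j\<in>UNIV. \<Sum>s\<in>S i. \<Sum>t\<in>S j. of_bool (i = j \<and> s = t))" by simp
  qed
  have square: "(linking \<gamma> K)\<^sup>2 = (\<Sum>i\<in>UNIV. \<Sum>j\<in>UNIV. \<Sum>s\<in>S i. \<Sum>t\<in>S j. sgn (n \<bullet> V i s) * sgn (n \<bullet> V j t))"
    unfolding link power2_eq_square sum_product ..
  have pointwise: "of_bool (i = j \<and> s = t) - sgn (n \<bullet> V i s) * sgn (n \<bullet> V j t)
    = of_bool (K i s \<noteq> K j t \<and> - 1 * ((n \<bullet> V i s) * (n \<bullet> V j t)) > 0) - (of_bool (K i s \<noteq> K j t \<and> 1 * ((n \<bullet> V i s) * (n \<bullet> V j t)) > 0) :: real)"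
    if "s \<in> S i" "t \<in> S j" for i j s t
  proof (cases "i = j \<and> s = t")
    case True
    then have "K i s = K j t" by simp
    then show ?thesis using True nz[OF that(1)] by (auto simp: sgn_if)
  next
    case False
    then have "K i s \<noteq> K j t" using inj[OF that] by simp
    then show ?thesis using False nz[OF that(1)] nz[OF that(2)] by (auto simp: sgn_if zero_less_mult_iff mult_less_0_iff)
  qed
  show "disk_intersections \<gamma> K - (linking \<gamma> K)\<^sup>2 = (\<Sum>i\<in>UNIV. \<Sum>j\<in>UNIV.
      enn2real (crossing_pairs (K i) (velocity (K i)) (K j) (velocity (K j)) (- 1) \<gamma>)
      - enn2real (crossing_pairs (K i) (velocity (K i)) (K j) (velocity (K j)) 1 \<gamma>))"
    unfolding V_def[symmetric] pairs inter diag square sum_subtractf[symmetric]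
    by (intro sum.cong refl pointwise)
qed

section \<open>Renormalization\<close>

text \<open>Real values are needed to form differences. Nothing is lost by \<open>enn2real\<close>
  for \<sigma> = 1 and \<sigma> = -1, where the density is finite by
  \<open>pair_density_eq\<close>.\<close>

definition pair_integrand :: "('i::finite \<Rightarrow> real \<Rightarrow> real^3) \<Rightarrow> 'i \<Rightarrow> 'i \<Rightarrow> real \<Rightarrow> real \<times> real \<Rightarrow> real" where
  "pair_integrand K i j \<sigma> = (\<lambda>(s, t). enn2real (pair_density \<sigma> (velocity (K i) s) (velocity (K j) t) (K j t - K i s)))"

lemma pair_density_eq_pair_integrand:
  assumes "\<bar>\<sigma>\<bar> = 1"
  shows "pair_density \<sigma> (velocity (K i) s) (velocity (K j) t) (K j t - K i s) = ennreal (pair_integrand K i j \<sigma> (s, t))"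
proof (cases "K j t - K i s = 0")
  case True
  then show ?thesis by (simp add: pair_integrand_def pair_density_def)
next
  case False
  have "\<sigma> = 1 \<or> \<sigma> = - 1" using assms by (auto simp: abs_if split: if_splits)
  then have "pair_density \<sigma> (velocity (K i) s) (velocity (K j) t) (K j t - K i s) < \<infinity>"
    using pair_density_eq[OF False, of "velocity (K i) s" "velocity (K j) t"] by (metis ennreal_less_top infinity_ennreal_def)
  then show ?thesis by (simp add: pair_integrand_def)
qed

lemma pair_integrand_diff:
  "pair_integrand K i j 1 z - pair_integrand K i j (- 1) z = 8 * pi / 3 * torsion_integrand K i j z"
proof -
  obtain s t where z: "z = (s, t)" by (cases z)
  show ?thesis
  proof (cases "K j t - K i s = 0")
    case True
    then show ?thesis by (simp add: z pair_integrand_def pair_density_def torsion_integrand_def torsion_density_def)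
  next
    case False
    obtain p q where "0 \<le> p" "0 \<le> q" "pair_density 1 (velocity (K i) s) (velocity (K j) t) (K j t - K i s) = ennreal p"
      "pair_density (- 1) (velocity (K i) s) (velocity (K j) t) (K j t - K i s) = ennreal q"
      "p - q = 8 * pi / 3 * (cross3 (velocity (K i) s) (K j t - K i s) \<bullet> cross3 (velocity (K j) t) (K j t - K i s)) / norm (K j t - K i s) ^ 4"
      by (rule pair_density_eq[OF False])
    then show ?thesis by (simp add: z pair_integrand_def torsion_integrand_def torsion_density_eq)
  qed
qed

lemma pair_integrand_nonneg: "0 \<le> pair_integrand K i j \<sigma> z"
  by (simp add: pair_integrand_def split_def)

lemma set_integrable_pair_integrand:
  fixes K :: "'i::finite \<Rightarrow> real \<Rightarrow> real^3"
  assumes K: "closed_C2_curve K" and \<sigma>: "\<bar>\<sigma>\<bar> = 1"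
  shows "set_integrable lborel ({0..1} \<times> {0..1}) (pair_integrand K i j \<sigma>)"
proof -
  note D = closed_C2_curveD[OF K]
  have [measurable]: "K i \<in> borel_measurable borel" "velocity (K i) \<in> borel_measurable borel" for i
    using D by (auto intro: borel_measurable_continuous_onI)
  obtain B where B: "\<And>i j s t. s \<in> {0..1} \<Longrightarrow> t \<in> {0..1} \<Longrightarrow> norm (cross3 (velocity (K i) s) (K j t - K i s)) \<le> B * (norm (K j t - K i s))\<^sup>2"
    using tangent_cross_bound[OF K] by blast
  have bound: "pair_integrand K i j \<sigma> (s, t) \<le> 16 * pi / 3 * B\<^sup>2" if st: "s \<in> {0..1}" "t \<in> {0..1}" for s t
  proof (cases "K j t - K i s = 0")
    case True
    then show ?thesis by (simp add: pair_integrand_def pair_density_def)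
  next
    case False
    define w where "w = K j t - K i s"
    let ?u = "velocity (K i) s" and ?v = "velocity (K j) t"
    have w: "norm w > 0" using False by (simp add: w_def)
    obtain p q where pq: "0 \<le> p" "0 \<le> q" "pair_density 1 ?u ?v w = ennreal p" "pair_density (- 1) ?u ?v w = ennreal q"
      "p + q \<le> 16 * pi / 3 * (norm (cross3 ?u w) * norm (cross3 ?v w)) / norm w ^ 4"
      by (rule pair_density_eq[OF False, folded w_def])
    have "\<sigma> = 1 \<or> \<sigma> = - 1" using \<sigma> by (auto simp: abs_if split: if_splits)
    then have "pair_integrand K i j \<sigma> (s, t) \<le> p + q"
      using pq(1-4) by (auto simp: pair_integrand_def w_def)
    also note pq(5)
    also have "16 * pi / 3 * (norm (cross3 ?u w) * norm (cross3 ?v w)) / norm w ^ 4 \<le> 16 * pi / 3 * ((B * (norm w)\<^sup>2) * (B * (norm w)\<^sup>2)) / norm w ^ 4"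
    proof (intro divide_right_mono mult_left_mono mult_mono)
      show u: "norm (cross3 ?u w) \<le> B * (norm w)\<^sup>2" using B[OF st] by (simp add: w_def)
      \<comment> \<open>The bound for the second tangent is the first one with the two points
        exchanged, for which the chord is \<open>- w\<close>.\<close>
      have "K i s - K j t = - w" by (simp add: w_def)
      then show "norm (cross3 ?v w) \<le> B * (norm w)\<^sup>2" using B[OF st(2) st(1), of j i] by (simp add: cross_minus_right)
      show "0 \<le> B * (norm w)\<^sup>2" using u norm_ge_zero order_trans by blast
    qed auto
    also have "\<dots> = 16 * pi / 3 * B\<^sup>2" using w by (simp add: power2_eq_square power4_eq_xxxx)
    finally show ?thesis .
  qed
  have "AE z in lborel. z \<in> {0..1} \<times> {0..1} \<longrightarrow> norm (pair_integrand K i j \<sigma> z) \<le> 16 * pi / 3 * B\<^sup>2"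
    using bound pair_integrand_nonneg[of K i j \<sigma>] by auto
  moreover have "pair_integrand K i j \<sigma> \<in> borel_measurable (borel \<Otimes>\<^sub>M borel)"
    unfolding pair_integrand_def by measurable
  moreover have "emeasure lborel ({0..1} \<times> {0..1} :: (real \<times> real) set) < \<infinity>"
  proof -
    have "bounded ({0..1} \<times> {0..1} :: (real \<times> real) set)" by (intro compact_imp_bounded compact_Times) auto
    then show ?thesis by (rule emeasure_bounded_finite)
  qed
  ultimately show ?thesis unfolding set_integrable_def
    by (intro integrableI_bounded_set_indicator[where B="16 * pi / 3 * B\<^sup>2"]) (auto simp: borel_prod intro!: borel_closed closed_Times)
qed

lemma has_bochner_integral_crossing_pairs:
  fixes K :: "'i::finite \<Rightarrow> real \<Rightarrow> real^3"
  assumes K: "closed_C2_curve K" and \<sigma>: "\<bar>\<sigma>\<bar> = 1"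
  shows "has_bochner_integral circle_measure
    (\<lambda>\<gamma>. indicator circles \<gamma> * enn2real (crossing_pairs (K i) (velocity (K i)) (K j) (velocity (K j)) \<sigma> \<gamma>))
    (LINT z:{0..1} \<times> {0..1}|lborel. pair_integrand K i j \<sigma> z)"
proof -
  note D = closed_C2_curveD[OF K]
  have [measurable]: "K i \<in> borel_measurable borel" "velocity (K i) \<in> borel_measurable borel" for i
    using D by (auto intro: borel_measurable_continuous_onI)
  note [measurable] = borel_measurable_crossing_pairs[OF D(5)[of i] D(2)[of i] D(5)[of j] D(2)[of j], of \<sigma>]
  have [measurable]: "pair_integrand K i j \<sigma> \<in> borel_measurable (borel \<Otimes>\<^sub>M borel)"
    unfolding pair_integrand_def by measurable
  let ?I = "\<lambda>z :: real \<times> real. ennreal (indicator ({0..1} \<times> {0..1}) z * pair_integrand K i j \<sigma> z)"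
  have [measurable]: "?I \<in> borel_measurable (borel \<Otimes>\<^sub>M borel)" by measurable
  \<comment> \<open>Crossings are counted on [0, 1), while the double integral runs over closed
    intervals; the difference is a null set.\<close>
  have ne1: "AE t in lborel. t \<noteq> (1::real)" by (rule AE_lborel_singleton)
  have "(\<integral>\<^sup>+\<gamma>. indicator circles \<gamma> * crossing_pairs (K i) (velocity (K i)) (K j) (velocity (K j)) \<sigma> \<gamma> \<partial>circle_measure)
    = (\<integral>\<^sup>+s. \<integral>\<^sup>+t. indicator {0..<1} s * indicator {0..<1} t
        * pair_density \<sigma> (velocity (K i) s) (velocity (K j) t) (K j t - K i s) \<partial>lborel \<partial>lborel)"
    by (simp only: nn_integral_crossing_pairs[OF D(1) D(2) D(1) D(2)] pair_density_def mult.assoc)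
  also have "\<dots> = (\<integral>\<^sup>+s. \<integral>\<^sup>+t. ?I (s, t) \<partial>lborel \<partial>lborel)"
  proof (rule nn_integral_cong_AE, rule eventually_mono[OF ne1])
    fix s :: real assume s: "s \<noteq> 1"
    show "(\<integral>\<^sup>+t. indicator {0..<1} s * indicator {0..<1} t * pair_density \<sigma> (velocity (K i) s) (velocity (K j) t) (K j t - K i s) \<partial>lborel)
      = (\<integral>\<^sup>+t. ?I (s, t) \<partial>lborel)"
    proof (rule nn_integral_cong_AE, rule eventually_mono[OF ne1])
      fix t :: real assume t: "t \<noteq> 1"
      show "indicator {0..<1} s * indicator {0..<1} t * pair_density \<sigma> (velocity (K i) s) (velocity (K j) t) (K j t - K i s) = ?I (s, t)"
        unfolding pair_density_eq_pair_integrand[OF \<sigma>] using s t by (auto simp: indicator_def)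
    qed
  qed
  also have "\<dots> = (\<integral>\<^sup>+z. ?I z \<partial>(lborel \<Otimes>\<^sub>M lborel))"
    by (rule lborel.nn_integral_fst) measurable
  also have "\<dots> = ennreal (LINT z:{0..1} \<times> {0..1}|lborel. pair_integrand K i j \<sigma> z)"
    unfolding lborel_prod set_lebesgue_integral_def real_scaleR_def
    using set_integrable_pair_integrand[OF K \<sigma>, of i j] pair_integrand_nonneg[of K i j \<sigma>]
    by (intro nn_integral_eq_integral) (auto simp: set_integrable_def)
  finally have *: "(\<integral>\<^sup>+\<gamma>. indicator circles \<gamma> * crossing_pairs (K i) (velocity (K i)) (K j) (velocity (K j)) \<sigma> \<gamma> \<partial>circle_measure)
    = ennreal (LINT z:{0..1} \<times> {0..1}|lborel. pair_integrand K i j \<sigma> z)" .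
  have "has_bochner_integral circle_measure
    (\<lambda>\<gamma>. enn2real (indicator circles \<gamma> * crossing_pairs (K i) (velocity (K i)) (K j) (velocity (K j)) \<sigma> \<gamma>))
    (LINT z:{0..1} \<times> {0..1}|lborel. pair_integrand K i j \<sigma> z)"
  proof (rule has_bochner_integral_enn2real[OF _ *])
    show "(\<lambda>\<gamma>. indicator circles \<gamma> * crossing_pairs (K i) (velocity (K i)) (K j) (velocity (K j)) \<sigma> \<gamma>) \<in> borel_measurable circle_measure"
      by measurable
    show "0 \<le> (LINT z:{0..1} \<times> {0..1}|lborel. pair_integrand K i j \<sigma> z)"
      unfolding set_lebesgue_integral_def by (intro integral_nonneg_AE) (simp add: pair_integrand_nonneg)
  qed
  then show ?thesis by (rule has_bochner_integral_cong[THEN iffD1, rotated -1]) (auto simp: indicator_def)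
qed

lemma has_bochner_integral_crossings:
  fixes K :: "'i::finite \<Rightarrow> real \<Rightarrow> real^3"
  assumes K: "closed_C2_curve K" and \<epsilon>: "\<epsilon> > 0"
  shows "has_bochner_integral circle_measure (\<lambda>\<gamma>. indicator (circles_above \<epsilon>) \<gamma> * enn2real (crossings (K i) \<gamma>))
    (2 * pi\<^sup>2 / \<epsilon> * (LINT t:{0..1}|lborel. norm (velocity (K i) t)))"
proof -
  note D = closed_C2_curveD[OF K]
  have [measurable]: "velocity (K i) \<in> borel_measurable borel"
    using D by (auto intro: borel_measurable_continuous_onI)
  note [measurable] = borel_measurable_crossings[OF D(5), of i]
  let ?L = "LINT t:{0..1}|lborel. norm (velocity (K i) t)"
  have L0: "0 \<le> ?L" unfolding set_lebesgue_integral_def by (intro integral_nonneg_AE) simp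
  have int: "set_integrable lborel {0..1} (\<lambda>t. norm (velocity (K i) t))"
    by (intro borel_integrable_atLeastAtMost' continuous_on_norm continuous_on_subset[OF D(2)]) auto
  have "(\<integral>\<^sup>+t. indicator {0..<1} t * ennreal (norm (velocity (K i) t)) \<partial>lborel)
    = (\<integral>\<^sup>+t. ennreal (indicator {0..1} t *\<^sub>R norm (velocity (K i) t)) \<partial>lborel)"
    by (rule nn_integral_cong_AE, rule eventually_mono[OF AE_lborel_singleton[of "1::real"]]) (auto simp: indicator_def)
  also have "\<dots> = ennreal ?L"
    unfolding set_lebesgue_integral_def using int by (intro nn_integral_eq_integral) (auto simp: set_integrable_def)
  finally have *: "(\<integral>\<^sup>+\<gamma>. indicator (circles_above \<epsilon>) \<gamma> * crossings (K i) \<gamma> \<partial>circle_measure) = ennreal (2 * pi\<^sup>2 / \<epsilon> * ?L)"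
    unfolding nn_integral_crossings[OF \<epsilon> D(1) D(2)] using L0 \<epsilon> by (simp add: ennreal_mult[symmetric])
  have "has_bochner_integral circle_measure (\<lambda>\<gamma>. enn2real (indicator (circles_above \<epsilon>) \<gamma> * crossings (K i) \<gamma>))
    (2 * pi\<^sup>2 / \<epsilon> * ?L)"
  proof (rule has_bochner_integral_enn2real[OF _ *])
    show "(\<lambda>\<gamma>. indicator (circles_above \<epsilon>) \<gamma> * crossings (K i) \<gamma>) \<in> borel_measurable circle_measure"
      by measurable
    show "0 \<le> 2 * pi\<^sup>2 / \<epsilon> * ?L" using L0 \<epsilon> by simp
  qed
  then show ?thesis by (rule has_bochner_integral_cong[THEN iffD1, rotated -1]) (auto simp: indicator_def)
qed

theorem proposition5p7:
  fixes K :: "'i::finite \<Rightarrow> real \<Rightarrow> real^3"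
  assumes "closed_C2_curve K"
  shows "(\<forall>\<epsilon>>0. set_integrable circle_measure (circles_above \<epsilon>) (\<lambda>\<gamma>. (linking \<gamma> K)\<^sup>2)) \<and>
    set_integrable circle_measure circles (\<lambda>\<gamma>. disk_intersections \<gamma> K - (linking \<gamma> K)\<^sup>2) \<and>
    (\<forall>i j. set_integrable lborel ({0..1} \<times> {0..1}) (torsion_integrand K i j)) \<and>
    (\<exists>E.
      ((\<lambda>\<epsilon>. 3 * pi * curve_length K / (8 * \<epsilon>)
           - 3 / (16 * pi) * (LINT \<gamma>:circles_above \<epsilon>|circle_measure. (linking \<gamma> K)\<^sup>2))
         \<longlongrightarrow> E) (at_right 0) \<and>
      E = 3 / (16 * pi) *
            (LINT \<gamma>:circles|circle_measure. disk_intersections \<gamma> K - (linking \<gamma> K)\<^sup>2) \<and>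
      E = - (1 / 2) *
            (\<Sum>i\<in>UNIV. \<Sum>j\<in>UNIV. LINT z:{0..1} \<times> {0..1}|lborel. torsion_integrand K i j z))"
proof -
  note K = assms
  note D = closed_C2_curveD[OF K]
  define N where "N \<gamma> = disk_intersections \<gamma> K" for \<gamma>
  define U where "U \<gamma> = disk_intersections \<gamma> K - (linking \<gamma> K)\<^sup>2" for \<gamma>
  have [measurable]: "(\<lambda>\<gamma>. linking \<gamma> K) \<in> borel_measurable borel" "N \<in> borel_measurable borel"
    using measurable_linking[OF K] measurable_disk_intersections[OF K] by (auto simp: N_def[abs_def])
  have [measurable]: "U \<in> borel_measurable borel"
    unfolding U_def[abs_def] N_def[symmetric] by measurable
  have above: "circles_above \<epsilon> \<subseteq> circles" for \<epsilon> by (auto simp: circles_above_def)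
  have good: "AE \<gamma> in circle_measure. \<gamma> \<in> circles \<longrightarrow> (\<forall>i. bad_crossings (K i) (velocity (K i)) \<gamma> = 0)"
    using AE_bad_crossings[OF D(1) D(2)] by (subst all_simps(6)[symmetric], intro eventually_all_finite)
  define P where "P \<sigma> i j = (LINT z:{0..1} \<times> {0..1}|lborel. pair_integrand K i j \<sigma> z)" for \<sigma> i j
  define T where "T i j = (LINT z:{0..1} \<times> {0..1}|lborel. torsion_integrand K i j z)" for i j
  have torsion: "torsion_integrand K i j = (\<lambda>z. 3 / (8 * pi) * (pair_integrand K i j 1 z - pair_integrand K i j (- 1) z))" for i j
    by (simp add: pair_integrand_diff fun_eq_iff)
  have int_torsion: "set_integrable lborel ({0..1} \<times> {0..1}) (torsion_integrand K i j)" for i j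
    unfolding torsion by (intro set_integrable_mult_right set_integral_diff set_integrable_pair_integrand K) auto
  have T: "P (- 1) i j - P 1 i j = - (8 * pi / 3) * T i j" for i j
  proof -
    have "T i j = 3 / (8 * pi) * (P 1 i j - P (- 1) i j)"
      unfolding T_def P_def torsion using set_integrable_pair_integrand[OF K, of _ i j]
      by (simp add: set_integral_diff)
    then show ?thesis by (simp add: field_simps)
  qed
  have pairs: "has_bochner_integral circle_measure (\<lambda>\<gamma>. \<Sum>i\<in>UNIV. \<Sum>j\<in>UNIV.
      indicator circles \<gamma> * enn2real (crossing_pairs (K i) (velocity (K i)) (K j) (velocity (K j)) (- 1) \<gamma>)
      - indicator circles \<gamma> * enn2real (crossing_pairs (K i) (velocity (K i)) (K j) (velocity (K j)) 1 \<gamma>))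
    (\<Sum>i\<in>UNIV. \<Sum>j\<in>UNIV. P (- 1) i j - P 1 i j)"
    unfolding P_def
    by (intro has_bochner_integral_sum has_bochner_integral_diff has_bochner_integral_crossing_pairs K) auto
  have pairs_eq: "AE \<gamma> in circle_measure. (\<Sum>i\<in>UNIV. \<Sum>j\<in>UNIV.
      indicator circles \<gamma> * enn2real (crossing_pairs (K i) (velocity (K i)) (K j) (velocity (K j)) (- 1) \<gamma>)
      - indicator circles \<gamma> * enn2real (crossing_pairs (K i) (velocity (K i)) (K j) (velocity (K j)) 1 \<gamma>))
    = indicator circles \<gamma> *\<^sub>R U \<gamma>"
    using good
  proof (rule eventually_mono)
    fix \<gamma> :: circle assume g: "\<gamma> \<in> circles \<longrightarrow> (\<forall>i. bad_crossings (K i) (velocity (K i)) \<gamma> = 0)"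
    show "(\<Sum>i\<in>UNIV. \<Sum>j\<in>UNIV.
      indicator circles \<gamma> * enn2real (crossing_pairs (K i) (velocity (K i)) (K j) (velocity (K j)) (- 1) \<gamma>)
      - indicator circles \<gamma> * enn2real (crossing_pairs (K i) (velocity (K i)) (K j) (velocity (K j)) 1 \<gamma>))
      = indicator circles \<gamma> *\<^sub>R U \<gamma>"
    proof (cases "\<gamma> \<in> circles")
      case True
      then show ?thesis using disk_intersections_minus_linking_square(2)[OF K True] g by (simp add: U_def)
    qed simp
  qed
  have U: "has_bochner_integral circle_measure (\<lambda>\<gamma>. indicator circles \<gamma> *\<^sub>R U \<gamma>) (\<Sum>i\<in>UNIV. \<Sum>j\<in>UNIV. P (- 1) i j - P 1 i j)"
    by (rule has_bochner_integralI_AE[OF pairs _ pairs_eq]) measurable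
  then have int_U: "set_integrable circle_measure circles U"
    unfolding set_integrable_def by (rule integrable.intros)
  have int_U_above: "set_integrable circle_measure (circles_above \<epsilon>) U" for \<epsilon>
    using int_U by (rule set_integrable_subset) (auto simp: above)
  have N: "has_bochner_integral circle_measure (\<lambda>\<gamma>. indicator (circles_above \<epsilon>) \<gamma> *\<^sub>R N \<gamma>) (2 * pi\<^sup>2 / \<epsilon> * curve_length K)"
    if \<epsilon>: "\<epsilon> > 0" for \<epsilon>
  proof -
    have "has_bochner_integral circle_measure (\<lambda>\<gamma>. \<Sum>i\<in>UNIV. indicator (circles_above \<epsilon>) \<gamma> * enn2real (crossings (K i) \<gamma>))
      (\<Sum>i\<in>UNIV. 2 * pi\<^sup>2 / \<epsilon> * (LINT t:{0..1}|lborel. norm (velocity (K i) t)))"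
      by (intro has_bochner_integral_sum has_bochner_integral_crossings K \<epsilon>)
    then have count: "has_bochner_integral circle_measure (\<lambda>\<gamma>. \<Sum>i\<in>UNIV. indicator (circles_above \<epsilon>) \<gamma> * enn2real (crossings (K i) \<gamma>))
      (2 * pi\<^sup>2 / \<epsilon> * curve_length K)"
      by (simp only: sum_distrib_left[symmetric] curve_length_def)
    have count_eq: "AE \<gamma> in circle_measure. (\<Sum>i\<in>UNIV. indicator (circles_above \<epsilon>) \<gamma> * enn2real (crossings (K i) \<gamma>))
      = indicator (circles_above \<epsilon>) \<gamma> *\<^sub>R N \<gamma>"
      using good
    proof (rule eventually_mono)
      fix \<gamma> :: circle assume g: "\<gamma> \<in> circles \<longrightarrow> (\<forall>i. bad_crossings (K i) (velocity (K i)) \<gamma> = 0)"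
      show "(\<Sum>i\<in>UNIV. indicator (circles_above \<epsilon>) \<gamma> * enn2real (crossings (K i) \<gamma>)) = indicator (circles_above \<epsilon>) \<gamma> *\<^sub>R N \<gamma>"
      proof (cases "\<gamma> \<in> circles_above \<epsilon>")
        case True
        then have "\<gamma> \<in> circles" using above by blast
        then show ?thesis using disk_intersections_minus_linking_square(1)[OF K \<open>\<gamma> \<in> circles\<close>] g True by (simp add: N_def)
      qed simp
    qed
    show ?thesis by (rule has_bochner_integralI_AE[OF count _ count_eq]) measurable
  qed
  have int_N: "set_integrable circle_measure (circles_above \<epsilon>) N" if "\<epsilon> > 0" for \<epsilon>
    unfolding set_integrable_def using N[OF that] by (rule integrable.intros)
  \<comment> \<open>The integral of \<open>N\<close> grows like 1/\<epsilon>, so this splitting is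
    integrated only above \<epsilon>; \<open>U\<close> is integrable over all circles.\<close>
  have square: "(\<lambda>\<gamma>. (linking \<gamma> K)\<^sup>2) = (\<lambda>\<gamma>. N \<gamma> - U \<gamma>)" by (simp add: N_def U_def)
  have int_square: "set_integrable circle_measure (circles_above \<epsilon>) (\<lambda>\<gamma>. (linking \<gamma> K)\<^sup>2)" if "\<epsilon> > 0" for \<epsilon>
    unfolding square by (intro set_integral_diff int_N int_U_above that)
  define E where "E = 3 / (16 * pi) * (LINT \<gamma>:circles|circle_measure. U \<gamma>)"
  have renorm: "3 * pi * curve_length K / (8 * \<epsilon>) - 3 / (16 * pi) * (LINT \<gamma>:circles_above \<epsilon>|circle_measure. (linking \<gamma> K)\<^sup>2)
    = 3 / (16 * pi) * (LINT \<gamma>:circles_above \<epsilon>|circle_measure. U \<gamma>)" if "\<epsilon> > 0" for \<epsilon>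
  proof -
    have eq: "(LINT \<gamma>:circles_above \<epsilon>|circle_measure. (linking \<gamma> K)\<^sup>2)
      = 2 * pi\<^sup>2 / \<epsilon> * curve_length K - (LINT \<gamma>:circles_above \<epsilon>|circle_measure. U \<gamma>)"
      unfolding square set_integral_diff(2)[OF int_N[OF that] int_U_above]
      using has_bochner_integral_integral_eq[OF N[OF that]] by (simp add: set_lebesgue_integral_def)
    \<comment> \<open>The counterterm is exactly 3/(16 pi) times the integral of \<open>N\<close>,
      so that no error term is left even before the limit.\<close>
    have "3 * pi * L / (8 * \<epsilon>) - 3 / (16 * pi) * (2 * pi\<^sup>2 / \<epsilon> * L - x) = 3 / (16 * pi) * x" for L x
      using that by (simp add: field_simps power2_eq_square)
    then show ?thesis by (simp only: eq)
  qed
  \<comment> \<open>Inversion turns the limit at 0 from the right into one at infinity. The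
    integrands are dominated by that of the full integral, and each circle is eventually included,
    because its radius is positive.\<close>
  have "((\<lambda>\<epsilon>. LINT \<gamma>:circles_above \<epsilon>|circle_measure. U \<gamma>) \<longlongrightarrow> (LINT \<gamma>:circles|circle_measure. U \<gamma>)) (at_right 0)"
    unfolding filterlim_at_right_to_top set_lebesgue_integral_def
  proof (rule integral_dominated_convergence_at_top)
    show "integrable circle_measure (\<lambda>\<gamma>. norm (indicator circles \<gamma> *\<^sub>R U \<gamma>))"
      using int_U by (intro integrable_norm) (simp add: set_integrable_def)
    show "\<forall>\<^sub>F x in at_top. AE \<gamma> in circle_measure. norm (indicator (circles_above (inverse x)) \<gamma> *\<^sub>R U \<gamma>) \<le> norm (indicator circles \<gamma> *\<^sub>R U \<gamma>)"
      by (intro always_eventually allI AE_I2) (auto simp: indicator_def dest: subsetD[OF above])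
    show "AE \<gamma> in circle_measure. ((\<lambda>x. indicator (circles_above (inverse x)) \<gamma> *\<^sub>R U \<gamma>) \<longlongrightarrow> indicator circles \<gamma> *\<^sub>R U \<gamma>) at_top"
    proof (rule AE_I2)
      fix \<gamma> :: circle
      have "\<forall>\<^sub>F x in at_top. \<gamma> \<in> circles_above (inverse x) \<longleftrightarrow> \<gamma> \<in> circles"
      proof (cases "\<gamma> \<in> circles")
        case True
        obtain c r n where \<gamma>: "\<gamma> = (c, r, n)" by (cases \<gamma>)
        have r: "r > 0" using True by (simp add: \<gamma> circles_def)
        have "\<forall>\<^sub>F x in at_top. inverse x < r" using r by real_asymp
        then show ?thesis by (rule eventually_mono) (use True in \<open>auto simp: circles_above_def \<gamma>\<close>)
      next
        case False
        then have "\<gamma> \<notin> circles_above e" for e using above by blast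
        with False show ?thesis by simp
      qed
      then have "\<forall>\<^sub>F x in at_top. indicator (circles_above (inverse x)) \<gamma> *\<^sub>R U \<gamma> = indicator circles \<gamma> *\<^sub>R U \<gamma>"
        by (rule eventually_mono) (simp add: indicator_def)
      then show "((\<lambda>x. indicator (circles_above (inverse x)) \<gamma> *\<^sub>R U \<gamma>) \<longlongrightarrow> indicator circles \<gamma> *\<^sub>R U \<gamma>) at_top"
        by (rule tendsto_eventually)
    qed
  qed measurable
  then have "((\<lambda>\<epsilon>. 3 / (16 * pi) * (LINT \<gamma>:circles_above \<epsilon>|circle_measure. U \<gamma>)) \<longlongrightarrow> E) (at_right 0)"
    unfolding E_def by (intro tendsto_intros)
  then have lim: "((\<lambda>\<epsilon>. 3 * pi * curve_length K / (8 * \<epsilon>)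
      - 3 / (16 * pi) * (LINT \<gamma>:circles_above \<epsilon>|circle_measure. (linking \<gamma> K)\<^sup>2)) \<longlongrightarrow> E) (at_right 0)"
    by (rule Lim_transform_eventually) (use renorm in \<open>auto simp: eventually_at_filter\<close>)
  have "(LINT \<gamma>:circles|circle_measure. U \<gamma>) = (\<Sum>i\<in>UNIV. \<Sum>j\<in>UNIV. P (- 1) i j - P 1 i j)"
    unfolding set_lebesgue_integral_def using U by (rule has_bochner_integral_integral_eq)
  \<comment> \<open>The minus sign arises because \<open>U\<close> counts opposite signs minus equal
    ones, whereas the torsion integrand is the density of equal signs minus that of opposite ones,
    up to a positive factor.\<close>
  then have "E = 3 / (16 * pi) * (- (8 * pi / 3) * (\<Sum>i\<in>UNIV. \<Sum>j\<in>UNIV. T i j))"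
    unfolding E_def T by (simp only: sum_distrib_left)
  then have "E = - (1 / 2) * (\<Sum>i\<in>UNIV. \<Sum>j\<in>UNIV. T i j)" by simp
  with lim int_U int_square int_torsion show ?thesis unfolding T_def E_def U_def[abs_def] by blast
qed

end
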